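(* For a given fixed network, the two-stage stochastic integer linear multi-commodity flow problem (with $M$ commodities and $N$ scenarios, as defined in the context) is solvable in polynomial time in the number $M$ of commodities, in the number $N$ of scenarios, and in the encoding lengths of the input data.
   Context: A network with node-edge incidence matrix $A$ is fixed (not part of the input). There are $M$ integer commodities to be transported over the network, with deterministic supplies and demands given by integer vectors $\mathbf{b}_1,\dots,\mathbf{b}_M$ indexed by the nodes. The upper bounds for the capacities per edge are uncertain; their probability distribution is discretized into $N$ scenarios, where scenario $l$ has probability $\pi_l$ and integer edge capacity vector $\mathbf{u}_l$. First one decides how to transport the commodities, i.e. chooses integer flows $\mathbf{x}_1,\dots,\mathbf{x}_M$ (vectors indexed by the edges), without knowing the true capacities; then, after observing the true capacities, penalties have to be paid if the capacities are exceeded. The two-stage stochastic integer linear multi-commodity flow problem is to minimize the linear costs of the integer multi-commodity flow plus the expected (linear) penalties, i.e. to solve the integer linear program \[ \min \ \sum_{i=1}^M \mathbf{c}_i^\intercal\mathbf{x}_i+\sum_{l=1}^N \pi_l\,\mathbf{q}_l^\intercal\mathbf{p}_l \] subject to \[ A\mathbf{x}_i=\mathbf{b}_i\ (i=1,\dots,M),\qquad \sum_{i=1}^M\mathbf{x}_i+\mathbf{s}_l-\mathbf{p}_l=\mathbf{u}_l\ (l=1,\dots,N), \] with all $\mathbf{x}_i,\mathbf{s}_l,\mathbf{p}_l$ nonnegative integer vectors; here $\mathbf{s}_l$ are slack variables, $\mathbf{p}_l$ are the penalty variables, and $\mathbf{c}_i$ and $\mathbf{q}_l$ are given flow cost and penalty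 cost vectors (no sign restriction is imposed on them). The constraint matrix thus consists of $M$ diagonal blocks $A$ for the flow variables, followed by $N$ block rows $(I\ \cdots\ I)$ in the flow variables, each with its own block $(I\ \ {-I})$ in the variables $(\mathbf{s}_l,\mathbf{p}_l)$. The input data consist of the $\mathbf{b}_i,\mathbf{u}_l$ (integer) and $\mathbf{c}_i,\mathbf{q}_l,\pi_l$ (rational). "Solvable" means that an algorithm finds an optimal solution or decides that the problem is infeasible or unbounded. *)

theory Defs
  imports
    "HOL-Library.Log_Nat"
    "HOL-Computational_Algebra.Polynomial"
    "Graph_Theory.Digraph"
    "Jordan_Normal_Form.Matrix"
begin

section \<open>Machine model and polynomial time\<close>

text \<open>
  Algorithms are programs of a deeply embedded WHILE language. A store maps variables to finite
  binary trees with integer leaves. Costs are logarithmic: evaluating an expression costs the sum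
  of the sizes (numbers of bits and tree nodes) of the values of all its subexpressions. Hence
  every value computed within time \<open>t\<close> has size at most \<open>t\<close>, and running time agrees with that of
  Turing machines up to a polynomial.
\<close>

datatype data = Num int | Cell data data

definition int_length :: "int \<Rightarrow> nat" where
  "int_length k = 1 + floorlog 2 (nat \<bar>k\<bar>)"

fun data_size :: "data \<Rightarrow> nat" where
  "data_size (Num k) = int_length k"
| "data_size (Cell a b) = 1 + data_size a + data_size b"

text \<open>Operations applied to arguments of the wrong shape treat a cell as the number 0, and a number
  has components \<open>Num 0\<close>.\<close>

fun to_int :: "data \<Rightarrow> int" where
  "to_int (Num k) = k"
| "to_int (Cell a b) = 0"

fun left_of :: "data \<Rightarrow> data" where
  "left_of (Num k) = Num 0"
| "left_of (Cell a b) = a"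

fun right_of :: "data \<Rightarrow> data" where
  "right_of (Num k) = Num 0"
| "right_of (Cell a b) = b"

fun is_cell :: "data \<Rightarrow> bool" where
  "is_cell (Num k) = False"
| "is_cell (Cell a b) = True"

datatype exp =
    Const data
  | Var nat
  | MkCell exp exp
  | LeftOf exp
  | RightOf exp
  | IsCell exp
  | Add exp exp
  | Sub exp exp
  | Mul exp exp
  | Div exp exp
  | Less exp exp

type_synonym store = "nat \<Rightarrow> data"

fun eval :: "exp \<Rightarrow> store \<Rightarrow> data" where
  "eval (Const d) s = d"
| "eval (Var x) s = s x"
| "eval (MkCell e f) s = Cell (eval e s) (eval f s)"
| "eval (LeftOf e) s = left_of (eval e s)"
| "eval (RightOf e) s = right_of (eval e s)"
| "eval (IsCell e) s = Num (of_bool (is_cell (eval e s)))"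
| "eval (Add e f) s = Num (to_int (eval e s) + to_int (eval f s))"
| "eval (Sub e f) s = Num (to_int (eval e s) - to_int (eval f s))"
| "eval (Mul e f) s = Num (to_int (eval e s) * to_int (eval f s))"
| "eval (Div e f) s = Num (to_int (eval e s) div to_int (eval f s))"
| "eval (Less e f) s = Num (of_bool (to_int (eval e s) < to_int (eval f s)))"

fun args :: "exp \<Rightarrow> exp list" where
  "args (Const d) = []"
| "args (Var x) = []"
| "args (MkCell e f) = [e, f]"
| "args (LeftOf e) = [e]"
| "args (RightOf e) = [e]"
| "args (IsCell e) = [e]"
| "args (Add e f) = [e, f]"
| "args (Sub e f) = [e, f]"
| "args (Mul e f) = [e, f]"
| "args (Div e f) = [e, f]"
| "args (Less e f) = [e, f]"

lemma size_args [termination_simp]: "f \<in> set (args e) \<Longrightarrow> size f < size e"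
  by (cases e) auto

fun eval_cost :: "exp \<Rightarrow> store \<Rightarrow> nat" where
  "eval_cost e s = data_size (eval e s) + (\<Sum>f\<leftarrow>args e. eval_cost f s)"

declare eval_cost.simps [simp del]

definition holds :: "exp \<Rightarrow> store \<Rightarrow> bool" where
  "holds e s \<longleftrightarrow> eval e s \<noteq> Num 0"

datatype com =
    Skip
  | Assign nat exp
  | Seq com com
  | If exp com com
  | While exp com

text \<open>\<open>exec c s t s'\<close>: started in store \<open>s\<close>, program \<open>c\<close> terminates at cost \<open>t\<close> in store \<open>s'\<close>.\<close>

inductive exec :: "com \<Rightarrow> store \<Rightarrow> nat \<Rightarrow> store \<Rightarrow> bool" where
  Skip: "exec Skip s 1 s"
| Assign: "exec (Assign x e) s (eval_cost e s) (s(x := eval e s))"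
| Seq: "exec c s t s' \<Longrightarrow> exec d s' t' s'' \<Longrightarrow> exec (Seq c d) s (t + t') s''"
| IfTrue: "holds e s \<Longrightarrow> exec c s t s' \<Longrightarrow> exec (If e c d) s (eval_cost e s + t) s'"
| IfFalse: "\<not> holds e s \<Longrightarrow> exec d s t s' \<Longrightarrow> exec (If e c d) s (eval_cost e s + t) s'"
| WhileFalse: "\<not> holds e s \<Longrightarrow> exec (While e c) s (eval_cost e s) s"
| WhileTrue: "holds e s \<Longrightarrow> exec c s t s' \<Longrightarrow> exec (While e c) s' t' s'' \<Longrightarrow>
    exec (While e c) s (eval_cost e s + t + t') s''"

inductive_cases exec_elims:
  "exec Skip s t s'"
  "exec (Assign x e) s t s'"
  "exec (Seq c d) s t s'"
  "exec (If e c d) s t s'"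
  "exec (While e c) s t s'"

lemma exec_deterministic:
  "exec c s t s' \<Longrightarrow> exec c s u s'' \<Longrightarrow> u = t \<and> s'' = s'"
proof (induction arbitrary: u s'' rule: exec.induct)
  case Skip
  then show ?case by (auto elim: exec_elims)
next
  case Assign
  then show ?case by (auto elim: exec_elims)
next
  case Seq
  from Seq.prems show ?case by (rule exec_elims(3)) (auto dest: Seq.IH)
next
  case IfTrue
  from IfTrue.prems show ?case by (rule exec_elims(4)) (auto simp: IfTrue.hyps dest: IfTrue.IH)
next
  case IfFalse
  from IfFalse.prems show ?case by (rule exec_elims(4)) (auto simp: IfFalse.hyps dest: IfFalse.IH)
next
  case WhileFalse
  from WhileFalse.prems show ?case by (rule exec_elims(5)) (auto simp: WhileFalse.hyps)
next
  case WhileTrue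
  from WhileTrue.prems show ?case
    by (rule exec_elims(5)) (auto simp: WhileTrue.hyps dest: WhileTrue.IH)
qed

text \<open>
  The input is passed in variable 0 and the answer is returned in variable 1. The running time is
  bounded by a polynomial in the measure \<open>len\<close>; for a sum of several parameters this
  is the same as a polynomial bound in these parameters.
\<close>

definition solvable_in_poly_time ::
  "'i set \<Rightarrow> ('i \<Rightarrow> data) \<Rightarrow> ('i \<Rightarrow> nat) \<Rightarrow> ('o \<Rightarrow> data) \<Rightarrow> ('i \<Rightarrow> 'o \<Rightarrow> bool) \<Rightarrow> bool" where
  "solvable_in_poly_time Inst enc_in len enc_out correct \<longleftrightarrow>
    (\<exists>(c :: com) (p :: nat poly). \<forall>I\<in>Inst. \<exists>t s out.
      exec c ((\<lambda>_. Num 0)(0 := enc_in I)) t s \<and>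
      t \<le> poly p (len I) \<and>
      s 1 = enc_out out \<and>
      correct I out)"

section \<open>The two-stage stochastic integer multi-commodity flow problem\<close>

text \<open>
  The nodes and edges of the network are listed by \<open>vs\<close> and \<open>es\<close>. Supplies are positive and
  demands negative: row \<open>i\<close> of \<open>A x\<close> is the outflow minus the inflow at node \<open>vs ! i\<close>.
\<close>

definition incidence_mat :: "('a, 'b) pre_digraph \<Rightarrow> 'a list \<Rightarrow> 'b list \<Rightarrow> int mat" where
  "incidence_mat G vs es = mat (length vs) (length es)
    (\<lambda>(i, j). of_bool (tail G (es ! j) = vs ! i) - of_bool (head G (es ! j) = vs ! i))"

record flow_instance =
  supplies :: "int vec list"
  flow_costs :: "rat vec list"
  capacities :: "int vec list"
  penalty_costs :: "rat vec list"
  probabilities :: "rat list"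

definition num_commodities :: "flow_instance \<Rightarrow> nat" where
  "num_commodities I = length (supplies I)"

definition num_scenarios :: "flow_instance \<Rightarrow> nat" where
  "num_scenarios I = length (capacities I)"

definition flow_instances :: "int mat \<Rightarrow> flow_instance set" where
  "flow_instances A = {I.
    set (supplies I) \<subseteq> carrier_vec (dim_row A) \<and>
    length (flow_costs I) = num_commodities I \<and> set (flow_costs I) \<subseteq> carrier_vec (dim_col A) \<and>
    set (capacities I) \<subseteq> carrier_vec (dim_col A) \<and>
    length (penalty_costs I) = num_scenarios I \<and> set (penalty_costs I) \<subseteq> carrier_vec (dim_col A) \<and>
    length (probabilities I) = num_scenarios I \<and>
    (\<forall>r\<in>set (probabilities I). 0 \<le> r) \<and> sum_list (probabilities I) = 1}"

record flow_solution =
  flows :: "int vec list"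
  slacks :: "int vec list"
  penalties :: "int vec list"

text \<open>On vectors, \<open>0\<^sub>v m \<le> x\<close> includes that \<open>x\<close> has dimension \<open>m\<close>.\<close>

definition feasible :: "int mat \<Rightarrow> flow_instance \<Rightarrow> flow_solution \<Rightarrow> bool" where
  "feasible A I X \<longleftrightarrow>
    length (flows X) = num_commodities I \<and>
    length (slacks X) = num_scenarios I \<and>
    length (penalties X) = num_scenarios I \<and>
    (\<forall>x \<in> set (flows X) \<union> set (slacks X) \<union> set (penalties X). 0\<^sub>v (dim_col A) \<le> x) \<and>
    (\<forall>i < num_commodities I. A *\<^sub>v (flows X ! i) = supplies I ! i) \<and>
    (\<forall>l < num_scenarios I.
      vec (dim_col A) (\<lambda>e. \<Sum>i < num_commodities I. flows X ! i $ e) + slacks X ! l - penalties X ! l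
        = capacities I ! l)"

definition objective :: "flow_instance \<Rightarrow> flow_solution \<Rightarrow> rat" where
  "objective I X =
    (\<Sum>i < num_commodities I. flow_costs I ! i \<bullet> map_vec of_int (flows X ! i)) +
    (\<Sum>l < num_scenarios I. probabilities I ! l * (penalty_costs I ! l \<bullet> map_vec of_int (penalties X ! l)))"

datatype answer = Infeasible | Unbounded | Optimal flow_solution

fun correct_answer :: "int mat \<Rightarrow> flow_instance \<Rightarrow> answer \<Rightarrow> bool" where
  "correct_answer A I Infeasible \<longleftrightarrow> (\<nexists>X. feasible A I X)"
| "correct_answer A I Unbounded \<longleftrightarrow> (\<forall>r. \<exists>X. feasible A I X \<and> objective I X < r)"
| "correct_answer A I (Optimal X) \<longleftrightarrow>
    feasible A I X \<and> (\<forall>Y. feasible A I Y \<longrightarrow> objective I X \<le> objective I Y)"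

section \<open>Encodings\<close>

definition rat_length :: "rat \<Rightarrow> nat" where
  "rat_length r = (case quotient_of r of (a, b) \<Rightarrow> int_length a + int_length b)"

definition vecs_length :: "('a \<Rightarrow> nat) \<Rightarrow> 'a vec list \<Rightarrow> nat" where
  "vecs_length len xs = (\<Sum>x\<leftarrow>xs. \<Sum>a\<leftarrow>list_of_vec x. len a)"

definition encoding_length :: "flow_instance \<Rightarrow> nat" where
  "encoding_length I =
    vecs_length int_length (supplies I) + vecs_length rat_length (flow_costs I) +
    vecs_length int_length (capacities I) + vecs_length rat_length (penalty_costs I) +
    (\<Sum>r\<leftarrow>probabilities I. rat_length r)"

fun enc_list :: "data list \<Rightarrow> data" where
  "enc_list [] = Num 0"
| "enc_list (d # ds) = Cell d (enc_list ds)"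

definition enc_rat :: "rat \<Rightarrow> data" where
  "enc_rat r = (case quotient_of r of (a, b) \<Rightarrow> Cell (Num a) (Num b))"

definition enc_vecs :: "('a \<Rightarrow> data) \<Rightarrow> 'a vec list \<Rightarrow> data" where
  "enc_vecs enc xs = enc_list (map (\<lambda>x. enc_list (map enc (list_of_vec x))) xs)"

definition enc_instance :: "flow_instance \<Rightarrow> data" where
  "enc_instance I = enc_list
    [enc_vecs Num (supplies I), enc_vecs enc_rat (flow_costs I),
     enc_vecs Num (capacities I), enc_vecs enc_rat (penalty_costs I),
     enc_list (map enc_rat (probabilities I))]"

fun enc_answer :: "answer \<Rightarrow> data" where
  "enc_answer Infeasible = Num 0"
| "enc_answer Unbounded = Num 1"
| "enc_answer (Optimal X) =
    enc_list [enc_vecs Num (flows X), enc_vecs Num (slacks X), enc_vecs Num (penalties X)]"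

end

theory Submission
  imports Defs
begin

text \<open>
  Let \<open>A\<close> be the fixed incidence matrix. Once a total flow is chosen, the second stage
  separates over scenarios and edges, so for nonnegative penalty costs the problem is to
  minimise a sum of convex piecewise linear functions of the flows \<open>x\<^sub>i\<close>, of the imbalances \<open>A x\<^sub>i - b\<^sub>i\<close>, and
  of the total flow \<open>x\<^sub>1 + \<dots> + x\<^sub>M\<close>. Dickson's lemma, applied first to the pairs \<open>(v, A v)\<close> and then to
  multiplicities of the minimal such pairs, shows that every difference of two flows is a sum of moves
  that agree in sign with it in all these quantities and whose 1-norm is at most a constant \<open>K\<close>
  independent of \<open>M\<close>. There are only polynomially many such moves, the function is superadditive along
  them, and splitting multiplicities into binary digits shows that the best step \<open>2\<^sup>k g\<close> closes a
  polynomial fraction of the gap to the optimum. Hence repeated best steps reach the optimum in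
  polynomially many rounds. Unboundedness is witnessed by a negative weight or by one of finitely many
  nonnegative circulations of negative cost; without a witness some optimum lies in a box of polynomial
  encoding length.
\<close>

section \<open>A calculus of polynomial time computable functions\<close>

text \<open>A scenario meets the flows only through the total on each edge, where it contributes a
  kink at its capacity. Conformity in the total therefore serves all kinks at once, wherever they
  lie, so no constant depends on \<open>N\<close>. With the network and \<open>K\<close> fixed, a
  move is a sum of at most \<open>K\<close> signed unit entries, each chosen from
  \<open>2 * m * M\<close>, which is why all moves can be listed. The multiplicity of a move in the
  difference to an optimum may be exponential. Cutting it at its binary digits gives polynomially
  many pieces, and since a joint gain never exceeds the sum of the separate gains, one piece gains
  at least the average. Neither the optimum nor its decomposition is ever computed: the best
  candidate is at least as good as that piece. The gap is an integer, so a geometric decrease below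
  1 ends at 0. The search box comes from decomposing a flow itself: a test vector used very often
  can be removed once without loss, because all its kinks have been passed, unless it is a
  nonnegative circulation of negative cost.\<close>

class enc =
  fixes enc :: "'a \<Rightarrow> data"

instantiation data :: enc
begin
definition "enc (d :: data) = d"
instance ..
end

instantiation int :: enc
begin
definition "enc k = Num k"
instance ..
end

instantiation bool :: enc
begin
definition "enc b = Num (of_bool b)"
instance ..
end

instantiation prod :: (enc, enc) enc
begin
definition "enc p = Cell (enc (fst p)) (enc (snd p))"
instance ..
end

instantiation list :: (enc) enc
begin
definition "enc xs = enc_list (map enc xs)"
instance ..
end

definition sz :: "'a::enc \<Rightarrow> nat" where
  "sz a = data_size (enc a)"

lemma int_length_ge_1 [simp]: "Suc 0 \<le> int_length k"
  by (simp add: int_length_def)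

lemma data_size_ge_1: "1 \<le> data_size d"
  by (cases d) auto

lemma sz_ge_1 [simp]: "Suc 0 \<le> sz a"
  using data_size_ge_1 by (simp add: sz_def)

lemma sz_int: "sz (k :: int) = int_length k"
  by (simp add: sz_def enc_int_def)

lemma sz_Pair [simp]: "sz (a, b) = 1 + sz a + sz b"
  by (simp add: sz_def enc_prod_def)

lemma enc_Nil: "enc [] = Num 0"
  by (simp add: enc_list_def)

lemma enc_Cons: "enc (x # xs) = Cell (enc x) (enc xs)"
  by (simp add: enc_list_def)

lemma sz_Nil [simp]: "sz [] = 1"
  by (simp add: sz_def enc_Nil int_length_def floorlog_def)

lemma sz_Cons [simp]: "sz (x # xs) = 1 + sz x + sz xs"
  by (simp add: sz_def enc_Cons)

lemma sz_bool: "sz (b :: bool) \<le> 2"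
  by (cases b) (simp_all add: sz_def enc_bool_def int_length_def floorlog_def)

lemma sz_list: "sz xs = 1 + length xs + (\<Sum>x\<leftarrow>xs. sz x)"
  by (induction xs) auto

lemma length_le_sz: "length xs \<le> sz xs"
  by (simp add: sz_list)

text \<open>Every list encoding ends in one \<open>Num 0\<close> of size 1, and appending drops one
  of the two.\<close>

lemma sz_append: "sz (xs @ ys) + 1 = sz xs + sz ys"
  by (simp add: sz_list)

lemma sz_rev [simp]: "sz (rev xs) = sz xs"
  by (simp add: sz_list sum_list_rev flip: rev_map)

lemma sz_elem: "x \<in> set xs \<Longrightarrow> sz x < sz xs"
  by (induction xs) auto

lemma sz_take: "sz (take k xs) \<le> sz xs"
  using sz_append[of "take k xs" "drop k xs"] sz_ge_1[of "drop k xs"] by (simp del: sz_ge_1)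

lemma sz_drop: "sz (drop k xs) \<le> sz xs"
  using sz_append[of "take k xs" "drop k xs"] sz_ge_1[of "take k xs"] by (simp del: sz_ge_1)

lemma sz_list_bound: "(\<And>x. x \<in> set xs \<Longrightarrow> sz x \<le> B) \<Longrightarrow> sz xs \<le> 1 + length xs * (1 + B)"
proof (induction xs)
  case (Cons x xs)
  have "sz x \<le> B" "sz xs \<le> 1 + length xs * (1 + B)"
    using Cons by auto
  then show ?case by simp
qed auto

subsection \<open>Polynomial bounds\<close>

text \<open>Bounds are written as lambda terms and recognised as polynomials afterwards by
  \<open>polyf_intros\<close>, so that no polynomial has to be built by hand.\<close>

definition polyf :: "(nat \<Rightarrow> nat) \<Rightarrow> bool" where
  "polyf g \<longleftrightarrow> (\<exists>q :: nat poly. \<forall>n. g n = poly q n)"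

lemma polyf_poly: "polyf (poly q)"
  by (auto simp: polyf_def)

lemma polyf_const: "polyf (\<lambda>n. k)"
  unfolding polyf_def by (rule exI[of _ "[:k:]"]) simp

lemma polyf_id: "polyf (\<lambda>n. n)"
  unfolding polyf_def by (rule exI[of _ "[:0, 1:]"]) simp

lemma polyf_add: "polyf g \<Longrightarrow> polyf h \<Longrightarrow> polyf (\<lambda>n. g n + h n)"
  unfolding polyf_def by (metis poly_add)

lemma polyf_mult: "polyf g \<Longrightarrow> polyf h \<Longrightarrow> polyf (\<lambda>n. g n * h n)"
  unfolding polyf_def by (metis poly_mult)

lemma polyf_Suc: "polyf g \<Longrightarrow> polyf (\<lambda>n. Suc (g n))"
  using polyf_add[OF polyf_const[of 1]] by simp

lemma polyf_comp: "polyf g \<Longrightarrow> polyf (\<lambda>n. poly q (g n))"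
  unfolding polyf_def by (metis poly_pcompose)

lemmas polyf_intros = polyf_add polyf_mult polyf_Suc polyf_comp polyf_id polyf_const polyf_poly

lemma polyf_obtain:
  assumes "polyf g" obtains q :: "nat poly" where "\<And>n. g n = poly q n"
  using assms by (auto simp: polyf_def)

text \<open>Natural coefficients make every polynomial monotone. This lets a bound in the size of an
  intermediate value be turned into one in the size of the input.\<close>

lemma poly_nat_mono: "x \<le> y \<Longrightarrow> poly q x \<le> poly q y" for q :: "nat poly" and x y :: nat
  by (induction q) (auto intro: add_mono mult_le_mono)

subsection \<open>Computable functions and composition\<close>

text \<open>The program works in place on variable 0; variables from \<open>n\<close> on are free for its callers.\<close>

definition computes :: "com \<Rightarrow> (nat \<Rightarrow> nat) \<Rightarrow> nat \<Rightarrow> 'a::enc set \<Rightarrow> ('a \<Rightarrow> 'b::enc) \<Rightarrow> bool" where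
  "computes c p n D f \<longleftrightarrow> (\<forall>s. \<forall>a\<in>D. s 0 = enc a \<longrightarrow>
     (\<exists>t s'. exec c s t s' \<and> t \<le> p (sz a) \<and> s' 0 = enc (f a) \<and> (\<forall>x\<ge>n. s' x = s x)))"

lemma computesE:
  assumes "computes c p n D f" "a \<in> D" "s 0 = enc a"
  obtains t s' where "exec c s t s'" "t \<le> p (sz a)" "s' 0 = enc (f a)" "\<forall>x\<ge>n. s' x = s x"
  using assms unfolding computes_def by blast

text \<open>The domain \<open>D\<close> serves partial situations: \<open>hd\<close> is computed
  only on nonempty lists, and a branch or loop body only where its test holds.\<close>

definition ptime_on :: "'a::enc set \<Rightarrow> ('a \<Rightarrow> 'b::enc) \<Rightarrow> bool" where
  "ptime_on D f \<longleftrightarrow> (\<exists>c (p :: nat poly) n. computes c (poly p) n D f)"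

abbreviation ptime :: "('a::enc \<Rightarrow> 'b::enc) \<Rightarrow> bool" where
  "ptime \<equiv> ptime_on UNIV"

lemma ptime_onI: assumes "polyf p" "computes c p n D f" shows "ptime_on D f"
proof -
  obtain q where "\<And>n. p n = poly q n" using polyf_obtain[OF assms(1)] by blast
  then have "p = poly q" by (rule ext)
  then show ?thesis using assms(2) unfolding ptime_on_def by blast
qed

lemma eval_cost_eqs:
  "eval_cost (Const d) s = data_size d"
  "eval_cost (Var x) s = data_size (s x)"
  "eval_cost (MkCell e f) s = data_size (Cell (eval e s) (eval f s)) + (eval_cost e s + eval_cost f s)"
  "eval_cost (LeftOf e) s = data_size (left_of (eval e s)) + eval_cost e s"
  "eval_cost (RightOf e) s = data_size (right_of (eval e s)) + eval_cost e s"
  "eval_cost (IsCell e) s = data_size (eval (IsCell e) s) + eval_cost e s"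
  "eval_cost (Add e f) s = data_size (eval (Add e f) s) + (eval_cost e s + eval_cost f s)"
  "eval_cost (Sub e f) s = data_size (eval (Sub e f) s) + (eval_cost e s + eval_cost f s)"
  "eval_cost (Mul e f) s = data_size (eval (Mul e f) s) + (eval_cost e s + eval_cost f s)"
  "eval_cost (Div e f) s = data_size (eval (Div e f) s) + (eval_cost e s + eval_cost f s)"
  "eval_cost (Less e f) s = data_size (eval (Less e f) s) + (eval_cost e s + eval_cost f s)"
  by (subst eval_cost.simps, simp)+

lemma data_size_le_eval_cost: "data_size (eval e s) \<le> eval_cost e s"
  by (subst eval_cost.simps) simp

lemma exec_size: "exec c s t s' \<Longrightarrow> data_size (s' x) \<le> data_size (s x) + t"
proof (induction rule: exec.induct)
  case (Assign y e s)
  then show ?case using data_size_le_eval_cost[of e s] by (auto intro: trans_le_add2)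
qed auto

text \<open>A program cannot write more than its running time. The second function of a composition
  is timed in the size of the intermediate value, so this bound enters the combinators
  below.\<close>

lemma ptime_on_size:
  assumes "ptime_on D f"
  obtains q :: "nat poly" where "\<And>a. a \<in> D \<Longrightarrow> sz (f a) \<le> poly q (sz a)"
proof -
  obtain c p n where c: "computes c (poly p) n D f" using assms unfolding ptime_on_def by blast
  obtain q where q: "\<And>n. n + poly p n = poly q n"
    by (rule polyf_obtain[of "\<lambda>n. n + poly p n"]) (intro polyf_intros, auto)
  have "sz (f a) \<le> poly q (sz a)" if a: "a \<in> D" for a
  proof -
    obtain t s' where "exec c (\<lambda>_. enc a) t s'" "t \<le> poly p (sz a)" "s' 0 = enc (f a)"
      by (rule computesE[OF c, of a "\<lambda>_. enc a", OF a]) auto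
    then show ?thesis
      using exec_size[of c "\<lambda>_. enc a" t s' 0] by (simp add: sz_def flip: q)
  qed
  then show thesis by (rule that)
qed

lemma ptime_size:
  assumes "ptime f" obtains q :: "nat poly" where "\<And>a. sz (f a) \<le> poly q (sz a)"
  using ptime_on_size[OF assms] by auto

lemma ptime_on_comp:
  assumes f: "ptime_on D f" and g: "ptime_on E g" and sub: "f ` D \<subseteq> E"
  shows "ptime_on D (\<lambda>a. g (f a))"
proof -
  obtain q where q: "\<And>a. a \<in> D \<Longrightarrow> sz (f a) \<le> poly q (sz a)"
    using ptime_on_size[OF f] by blast
  obtain c p n where c: "computes c (poly p) n D f" using f unfolding ptime_on_def by blast
  obtain d r m where d: "computes d (poly r) m E g" using g unfolding ptime_on_def by blast
  have "computes (Seq c d) (\<lambda>n. poly p n + poly r (poly q n)) (max n m) D (\<lambda>a. g (f a))"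
    unfolding computes_def
  proof (intro allI ballI impI)
    fix s :: store and a assume a: "a \<in> D" "s 0 = enc a"
    obtain t s' where 1: "exec c s t s'" "t \<le> poly p (sz a)" "s' 0 = enc (f a)" "\<forall>x\<ge>n. s' x = s x"
      by (rule computesE[OF c, of a s, OF a])
    obtain t' s'' where 2: "exec d s' t' s''" "t' \<le> poly r (sz (f a))" "s'' 0 = enc (g (f a))"
      "\<forall>x\<ge>m. s'' x = s' x"
      by (rule computesE[OF d, of "f a" s', OF _ 1(3)]) (use sub a in auto)
    have "t' \<le> poly r (poly q (sz a))"
      using 2(2) q[OF a(1)] poly_nat_mono order_trans by blast
    then show "\<exists>t s'. exec (Seq c d) s t s' \<and> t \<le> poly p (sz a) + poly r (poly q (sz a)) \<and>
       s' 0 = enc (g (f a)) \<and> (\<forall>x\<ge>max n m. s' x = s x)"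
      using 1 2 by (intro exI[of _ "t + t'"] exI[of _ s'']) (auto intro: exec.Seq)
  qed
  then show ?thesis by (rule ptime_onI[rotated]) (intro polyf_intros)
qed

lemma ptime_comp: "ptime g \<Longrightarrow> ptime f \<Longrightarrow> ptime (\<lambda>a. g (f a))"
  by (rule ptime_on_comp) auto

lemma ptime_on_subset: "ptime_on E f \<Longrightarrow> D \<subseteq> E \<Longrightarrow> ptime_on D f"
  unfolding ptime_on_def computes_def by blast

lemma ptime_on_exp:
  assumes "polyf p"
    and "\<And>s a. a \<in> D \<Longrightarrow> s 0 = enc a \<Longrightarrow> eval e s = enc (f a) \<and> eval_cost e s \<le> p (sz a)"
  shows "ptime_on D f"
proof (rule ptime_onI[OF assms(1)])
  show "computes (Assign 0 e) p 1 D f"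
    unfolding computes_def
  proof (intro allI ballI impI)
    fix s :: store and a assume "a \<in> D" "s 0 = enc a"
    with assms(2) have "eval e s = enc (f a)" "eval_cost e s \<le> p (sz a)" by auto
    then show "\<exists>t s'. exec (Assign 0 e) s t s' \<and> t \<le> p (sz a) \<and> s' 0 = enc (f a) \<and> (\<forall>x\<ge>1. s' x = s x)"
      using exec.Assign[of 0 e s] by fastforce
  qed
qed

lemma ptime_id: "ptime (\<lambda>a. a)"
  by (rule ptime_on_exp[where e = "Var 0", OF polyf_id]) (simp add: eval_cost_eqs sz_def)

lemma ptime_enc: "ptime f \<Longrightarrow> ptime (\<lambda>a. enc (f a))"
  by (erule ptime_comp[rotated], rule ptime_on_exp[where e = "Var 0", OF polyf_id])
    (simp add: eval_cost_eqs sz_def enc_data_def)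

lemma ptime_const: "ptime (\<lambda>a. k)"
  by (rule ptime_on_exp[where e = "Const (enc k)", OF polyf_const[of "sz k"]])
    (simp add: eval_cost_eqs sz_def)

lemma ptime_fst: "ptime f \<Longrightarrow> ptime (\<lambda>a. fst (f a))"
proof (erule ptime_comp[rotated], rule ptime_on_exp[where e = "LeftOf (Var 0)"])
  show "polyf (\<lambda>n. n + n)" by (intro polyf_intros)
qed (simp add: eval_cost_eqs enc_prod_def sz_def)

lemma ptime_snd: "ptime f \<Longrightarrow> ptime (\<lambda>a. snd (f a))"
proof (erule ptime_comp[rotated], rule ptime_on_exp[where e = "RightOf (Var 0)"])
  show "polyf (\<lambda>n. n + n)" by (intro polyf_intros)
qed (simp add: eval_cost_eqs enc_prod_def sz_def)

lemma ptime_on_Pair: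
  assumes f: "ptime_on D f" and g: "ptime_on D g"
  shows "ptime_on D (\<lambda>a. (f a, g a))"
proof -
  obtain q where q: "\<And>a. a \<in> D \<Longrightarrow> sz (f a) \<le> poly q (sz a)"
    using ptime_on_size[OF f] by blast
  obtain q' where q': "\<And>a. a \<in> D \<Longrightarrow> sz (g a) \<le> poly q' (sz a)"
    using ptime_on_size[OF g] by blast
  obtain c p n where c: "computes c (poly p) n D f" using f unfolding ptime_on_def by blast
  obtain d r m where d: "computes d (poly r) m D g" using g unfolding ptime_on_def by blast
  \<comment> \<open>Both programs work in place on variable 0. Variables \<open>k\<close> and
    \<open>Suc k\<close> survive them and hold the argument and the first result; \<open>Suc\<close>
    keeps \<open>k\<close> away from 0.\<close>
  define k where "k = Suc (max n m)"
  have k: "k \<ge> n" "k \<ge> m" "k \<noteq> 0" by (auto simp: k_def)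
  define prog where "prog = Seq (Assign k (Var 0)) (Seq c (Seq (Assign (Suc k) (Var 0))
    (Seq (Assign 0 (Var k)) (Seq d (Assign 0 (MkCell (Var (Suc k)) (Var 0)))))))"
  let ?p = "\<lambda>n. n + (poly p n + (poly q n + (n + (poly r n + (1 + poly q n + poly q' n + (poly q n + poly q' n))))))"
  have "computes prog ?p (Suc (Suc k)) D (\<lambda>a. (f a, g a))"
    unfolding computes_def
  proof (intro allI ballI impI)
    fix s :: store and a assume a: "a \<in> D" "s 0 = enc a"
    define s1 where "s1 = s(k := enc a)"
    have e1: "exec (Assign k (Var 0)) s (sz a) s1"
      using exec.Assign[of k "Var 0" s] a by (simp add: s1_def eval_cost_eqs sz_def)
    obtain t s' where 1: "exec c s1 t s'" "t \<le> poly p (sz a)" "s' 0 = enc (f a)" "\<forall>x\<ge>n. s' x = s1 x"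
      by (rule computesE[OF c, of a s1, OF a(1)]) (use a(2) k in \<open>auto simp: s1_def\<close>)
    define s2 where "s2 = s'(Suc k := enc (f a))"
    have e2: "exec (Assign (Suc k) (Var 0)) s' (sz (f a)) s2"
      using exec.Assign[of "Suc k" "Var 0" s'] 1 by (simp add: s2_def eval_cost_eqs sz_def)
    define s3 where "s3 = s2(0 := enc a)"
    have s2k: "s2 k = enc a" using 1(4) k by (simp add: s2_def s1_def)
    have e3: "exec (Assign 0 (Var k)) s2 (sz a) s3"
      using exec.Assign[of 0 "Var k" s2] s2k by (simp add: s3_def eval_cost_eqs sz_def)
    obtain t' s'' where 2: "exec d s3 t' s''" "t' \<le> poly r (sz a)" "s'' 0 = enc (g a)"
      "\<forall>x\<ge>m. s'' x = s3 x"
      by (rule computesE[OF d, of a s3, OF a(1)]) (auto simp: s3_def)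
    define s4 where "s4 = s''(0 := Cell (enc (f a)) (enc (g a)))"
    have s''k: "s'' (Suc k) = enc (f a)" using 2(4) k by (simp add: s3_def s2_def)
    have e4: "exec (Assign 0 (MkCell (Var (Suc k)) (Var 0))) s''
        (1 + sz (f a) + sz (g a) + (sz (f a) + sz (g a))) s4"
      using exec.Assign[of 0 "MkCell (Var (Suc k)) (Var 0)" s''] s''k 2(3)
      by (simp add: s4_def eval_cost_eqs sz_def)
    have ex: "exec prog s (sz a + (t + (sz (f a) + (sz a + (t' +
        (1 + sz (f a) + sz (g a) + (sz (f a) + sz (g a)))))))) s4"
      unfolding prog_def
      using exec.Seq[OF e1 exec.Seq[OF 1(1) exec.Seq[OF e2 exec.Seq[OF e3 exec.Seq[OF 2(1) e4]]]]] .
    have "sz a + (t + (sz (f a) + (sz a + (t' + (1 + sz (f a) + sz (g a) + (sz (f a) + sz (g a))))))) \<le> ?p (sz a)"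
      using 1(2) 2(2) q[OF a(1)] q'[OF a(1)] by (intro add_mono) auto
    moreover have "\<forall>x\<ge>Suc (Suc k). s4 x = s x"
      using 1(4) 2(4) k by (auto simp: s4_def s3_def s2_def s1_def)
    ultimately show "\<exists>t s'. exec prog s t s' \<and> t \<le> ?p (sz a) \<and> s' 0 = enc (f a, g a) \<and>
        (\<forall>x\<ge>Suc (Suc k). s' x = s x)"
      using ex by (intro exI[of _ s4] exI conjI) (assumption | simp add: s4_def enc_prod_def)+
  qed
  then show ?thesis by (rule ptime_onI[rotated]) (intro polyf_intros)
qed

lemmas ptime_Pair = ptime_on_Pair[where D = UNIV]

lemma ptime_comp2:
  "ptime (\<lambda>p. g (fst p) (snd p)) \<Longrightarrow> ptime f1 \<Longrightarrow> ptime f2 \<Longrightarrow> ptime (\<lambda>a. g (f1 a) (f2 a))"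
  using ptime_comp[OF _ ptime_Pair, of "\<lambda>p. g (fst p) (snd p)" f1 f2] by simp

text \<open>Pairing the argument with the truth value of the test keeps it available for the branches, and
  for the next iteration of a loop.\<close>

lemma ptime_on_If:
  assumes b: "ptime_on D b" and f: "ptime_on {a\<in>D. b a} f" and g: "ptime_on {a\<in>D. \<not> b a} g"
  shows "ptime_on D (\<lambda>a. if b a then f a else g a)"
proof -
  define E where "E = (\<lambda>a. (a, b a)) ` D"
  have "ptime_on {p\<in>E. snd p} (\<lambda>p. f (fst p))" "ptime_on {p\<in>E. \<not> snd p} (\<lambda>p. g (fst p))"
    by (rule ptime_on_comp[OF ptime_on_subset[OF ptime_fst[OF ptime_id]] f]
        ptime_on_comp[OF ptime_on_subset[OF ptime_fst[OF ptime_id]] g]; auto simp: E_def)+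
  then obtain c p n d r m where c: "computes c (poly p) n {p\<in>E. snd p} (\<lambda>p. f (fst p))"
    and d: "computes d (poly r) m {p\<in>E. \<not> snd p} (\<lambda>p. g (fst p))"
    unfolding ptime_on_def by blast
  have "computes (If (RightOf (Var 0)) c d) (\<lambda>n. 2 + n + (poly p n + poly r n)) (max n m) E
      (\<lambda>p. if snd p then f (fst p) else g (fst p))"
    unfolding computes_def
  proof (intro allI ballI impI)
    fix s :: store and q assume q: "q \<in> E" "s 0 = enc q"
    let ?e = "RightOf (Var 0)"
    have e: "eval_cost ?e s \<le> 2 + sz q" "holds ?e s \<longleftrightarrow> snd q"
      using sz_bool[of "snd q"] q(2) by (simp_all add: eval_cost_eqs sz_def enc_prod_def holds_def enc_bool_def)
    show "\<exists>t s'. exec (If ?e c d) s t s' \<and> t \<le> 2 + sz q + (poly p (sz q) + poly r (sz q)) \<and>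
        s' 0 = enc (if snd q then f (fst q) else g (fst q)) \<and> (\<forall>x\<ge>max n m. s' x = s x)"
    proof (cases "snd q")
      case True
      then obtain t s' where 1: "exec c s t s'" "t \<le> poly p (sz q)" "s' 0 = enc (f (fst q))" "\<forall>x\<ge>n. s' x = s x"
        using computesE[OF c, of q s, OF _ q(2)] q(1) by blast
      then show ?thesis using exec.IfTrue[OF _ 1(1), of ?e d] e True
        by (intro exI[of _ "eval_cost ?e s + t"] exI[of _ s']) auto
    next
      case False
      then obtain t s' where 1: "exec d s t s'" "t \<le> poly r (sz q)" "s' 0 = enc (g (fst q))" "\<forall>x\<ge>m. s' x = s x"
        using computesE[OF d, of q s, OF _ q(2)] q(1) by blast
      then show ?thesis using exec.IfFalse[OF _ 1(1), of ?e c] e False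
        by (intro exI[of _ "eval_cost ?e s + t"] exI[of _ s']) auto
    qed
  qed
  then have "ptime_on E (\<lambda>p. if snd p then f (fst p) else g (fst p))"
    by (rule ptime_onI[rotated]) (intro polyf_intros)
  from ptime_on_comp[OF ptime_on_Pair[OF ptime_on_subset[OF ptime_id] b] this]
  show ?thesis by (simp add: E_def cong: if_cong)
qed

lemma ptime_If: "ptime b \<Longrightarrow> ptime f \<Longrightarrow> ptime g \<Longrightarrow> ptime (\<lambda>a. if b a then f a else g a)"
  by (rule ptime_on_If) (auto intro: ptime_on_subset)

subsection \<open>Loops\<close>

lemma ptime_on_while:
  assumes cond: "ptime cond" and step: "ptime_on {a. cond a} step"
    and cond_true: "\<And>a j. a \<in> D \<Longrightarrow> j < N a \<Longrightarrow> cond ((step ^^ j) a)"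
    and cond_false: "\<And>a. a \<in> D \<Longrightarrow> \<not> cond ((step ^^ N a) a)"
    and N: "polyf r" "\<And>a. a \<in> D \<Longrightarrow> N a \<le> r (sz a)"
    and size: "polyf q" "\<And>a j. a \<in> D \<Longrightarrow> j \<le> N a \<Longrightarrow> sz ((step ^^ j) a) \<le> q (sz a)"
  shows "ptime_on D (\<lambda>a. (step ^^ N a) a)"
proof -
  define body where "body p = (step (fst p), cond (step (fst p)))" for p :: "'a \<times> bool"
  define E where "E = {p :: 'a \<times> bool. cond (fst p)}"
  have s: "ptime_on E (\<lambda>p. step (fst p))"
    by (rule ptime_on_comp[OF ptime_on_subset[OF ptime_fst[OF ptime_id]] step]) (auto simp: E_def)
  have "ptime_on E body"
    unfolding body_def by (intro ptime_on_Pair s ptime_on_comp[OF s cond]) auto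
  then obtain c p n where c: "computes c (poly p) n E body" unfolding ptime_on_def by blast
  obtain qp where qp: "\<And>n. q n = poly qp n" using polyf_obtain[OF size(1)] by blast
  obtain rp where rp: "\<And>n. r n = poly rp n" using polyf_obtain[OF N(1)] by blast
  define loop where "loop = While (RightOf (Var 0)) c"
  \<comment> \<open>Cost of one round: a truth value has size at most 2, so the pair of iterate and
    truth value has size at most \<open>3 + B\<close>, and extracting its second component adds at
    most 2 more.\<close>
  define C where "C B = 5 + B + poly p (3 + B)" for B
  have loop: "\<exists>t s'. exec loop s t s' \<and> t \<le> (j + 1) * C B \<and>
      s' 0 = enc ((step ^^ j) a, cond ((step ^^ j) a)) \<and> (\<forall>x\<ge>n. s' x = s x)"
    if "s 0 = enc (a, cond a)" "\<And>i. i < j \<Longrightarrow> cond ((step ^^ i) a)"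
      "\<not> cond ((step ^^ j) a)" "\<And>i. i \<le> j \<Longrightarrow> sz ((step ^^ i) a) \<le> B" for s a j B
    using that
  proof (induction j arbitrary: s a)
    case (0 s a)
    have "sz a \<le> B" using 0(4)[of 0] by simp
    then have e: "eval_cost (RightOf (Var 0)) s \<le> C B" "\<not> holds (RightOf (Var 0)) s"
      using sz_bool[of "cond a"] 0(1,3)
      by (simp_all add: eval_cost_eqs sz_def enc_prod_def holds_def enc_bool_def C_def)
    then show ?case using exec.WhileFalse[OF e(2), of c] 0 unfolding loop_def
      by (intro exI[of _ "eval_cost (RightOf (Var 0)) s"] exI[of _ s]) auto
  next
    case (Suc j s a)
    have ca: "cond a" using Suc.prems(2)[of 0] by simp
    have B: "sz a \<le> B" using Suc.prems(4)[of 0] by simp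
    then have e: "eval_cost (RightOf (Var 0)) s \<le> 5 + B" "holds (RightOf (Var 0)) s"
      using sz_bool[of "cond a"] Suc.prems(1) ca
      by (simp_all add: eval_cost_eqs sz_def enc_prod_def holds_def enc_bool_def)
    obtain t1 s1 where 1: "exec c s t1 s1" "t1 \<le> poly p (sz (a, cond a))" "s1 0 = enc (step a, cond (step a))"
      "\<forall>x\<ge>n. s1 x = s x"
      using computesE[OF c, of "(a, cond a)" s, OF _ Suc.prems(1)] ca by (auto simp: E_def body_def)
    have shift: "(step ^^ i) (step a) = (step ^^ Suc i) a" for i
      by (simp add: funpow_swap1)
    obtain t2 s2 where 2: "exec loop s1 t2 s2" "t2 \<le> (j + 1) * C B"
      "s2 0 = enc ((step ^^ j) (step a), cond ((step ^^ j) (step a)))" "\<forall>x\<ge>n. s2 x = s1 x"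
      using Suc.IH[of s1 "step a", OF 1(3), unfolded shift, OF Suc.prems(2,3,4)] unfolding shift by auto
    have "sz (a, cond a) \<le> 3 + B" using B sz_bool[of "cond a"] by simp
    then have "eval_cost (RightOf (Var 0)) s + t1 + t2 \<le> (Suc j + 1) * C B"
      using e(1) 1(2) 2(2) poly_nat_mono[of "sz (a, cond a)" "3 + B" p] by (simp add: C_def)
    then show ?case
      using exec.WhileTrue[OF e(2) 1(1) 2(1)[unfolded loop_def]] 1(4) 2(3,4) unfolding loop_def shift
      by (intro exI[of _ "eval_cost (RightOf (Var 0)) s + t1 + t2"] exI[of _ s2]) simp
  qed
  define F where "F = (\<lambda>a. (a, cond a)) ` D"
  have "computes loop (\<lambda>k. (poly rp k + 1) * C (poly qp k)) n F
      (\<lambda>p. ((step ^^ N (fst p)) (fst p), cond ((step ^^ N (fst p)) (fst p))))"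
    unfolding computes_def
  proof (intro allI ballI impI)
    fix s :: store and x assume x: "x \<in> F" "s 0 = enc x"
    obtain a where a: "a \<in> D" "x = (a, cond a)" using x(1) by (auto simp: F_def)
    have "q (sz a) \<le> poly qp (sz x)" "N a \<le> poly rp (sz x)"
      using N(2)[OF a(1)] poly_nat_mono[of "sz a" "sz x"] unfolding a(2) qp rp
      by (simp_all add: order_trans)
    then have "sz ((step ^^ i) a) \<le> poly qp (sz x)" if "i \<le> N a" for i
      using size(2)[OF a(1) that] by simp
    from loop[of s a "N a", OF _ cond_true[OF a(1)] cond_false[OF a(1)] this] x(2) a
    obtain t s' where t: "exec loop s t s'" "t \<le> (N a + 1) * C (poly qp (sz x))"
      "s' 0 = enc ((step ^^ N a) a, cond ((step ^^ N a) a))" "\<forall>x\<ge>n. s' x = s x" by auto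
    have "(N a + 1) * C (poly qp (sz x)) \<le> (poly rp (sz x) + 1) * C (poly qp (sz x))"
      using \<open>N a \<le> poly rp (sz x)\<close> by simp
    with t(2) have "t \<le> (poly rp (sz x) + 1) * C (poly qp (sz x))" by (rule order_trans)
    then show "\<exists>t s'. exec loop s t s' \<and> t \<le> (poly rp (sz x) + 1) * C (poly qp (sz x)) \<and>
        s' 0 = enc ((step ^^ N (fst x)) (fst x), cond ((step ^^ N (fst x)) (fst x))) \<and> (\<forall>x\<ge>n. s' x = s x)"
      using t a(2) by auto
  qed
  then have F: "ptime_on F (\<lambda>p. ((step ^^ N (fst p)) (fst p), cond ((step ^^ N (fst p)) (fst p))))"
    by (rule ptime_onI[rotated]) (unfold C_def, intro polyf_intros)
  have "ptime_on D (\<lambda>a. (a, cond a))"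
    by (intro ptime_on_Pair ptime_on_subset[OF ptime_id] ptime_on_subset[OF cond]) auto
  from ptime_on_comp[OF this F] have "ptime_on D (\<lambda>a. ((step ^^ N a) a, cond ((step ^^ N a) a)))"
    by (simp add: F_def)
  from ptime_on_comp[OF this ptime_fst[OF ptime_id]] show ?thesis by simp
qed

lemma ptime_tl: "ptime l \<Longrightarrow> ptime (\<lambda>a. tl (l a))"
proof (erule ptime_comp[rotated], rule ptime_on_exp[where e = "RightOf (Var 0)"])
  show "polyf (\<lambda>n. n + n)" by (intro polyf_intros)
  fix s :: store and xs :: "'b::enc list" assume "s 0 = enc xs"
  then show "eval (RightOf (Var 0)) s = enc (tl xs) \<and> eval_cost (RightOf (Var 0)) s \<le> sz xs + sz xs"
    by (cases xs) (simp_all add: eval_cost_eqs enc_Nil enc_Cons sz_def int_length_def)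
qed

lemma ptime_on_hd: "ptime_on {xs. xs \<noteq> []} hd"
proof (rule ptime_on_exp[where e = "LeftOf (Var 0)"])
  show "polyf (\<lambda>n. n + n)" by (intro polyf_intros)
  fix s :: store and xs :: "'b::enc list" assume "s 0 = enc xs" "xs \<in> {xs. xs \<noteq> []}"
  then show "eval (LeftOf (Var 0)) s = enc (hd xs) \<and> eval_cost (LeftOf (Var 0)) s \<le> sz xs + sz xs"
    by (cases xs) (simp_all add: eval_cost_eqs enc_Nil enc_Cons sz_def int_length_def)
qed

lemma ptime_not_Nil: "ptime l \<Longrightarrow> ptime (\<lambda>a. l a \<noteq> [])"
proof (erule ptime_comp[rotated], rule ptime_on_exp[where e = "IsCell (Var 0)"])
  show "polyf (\<lambda>n. 2 + n)" by (intro polyf_intros)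
  fix s :: store and xs :: "'b::enc list" assume "s 0 = enc xs"
  then show "eval (IsCell (Var 0)) s = enc (xs \<noteq> []) \<and> eval_cost (IsCell (Var 0)) s \<le> 2 + sz xs"
    by (cases xs) (simp_all add: eval_cost_eqs enc_Nil enc_Cons enc_bool_def sz_def int_length_def floorlog_def)
qed

text \<open>A pair of head and tail already has the encoding of the list, so after pairing the
  program changes nothing.\<close>

lemma ptime_Cons: "ptime f \<Longrightarrow> ptime l \<Longrightarrow> ptime (\<lambda>a. f a # l a)"
proof (rule ptime_comp2[of "\<lambda>x xs. x # xs"], rule ptime_on_exp[where e = "Var 0"])
  show "polyf (\<lambda>n. n)" by (intro polyf_intros)
qed (auto simp: eval_cost_eqs enc_Cons enc_prod_def sz_def)

text \<open>The size bound is needed because iterating a polynomial time function, such as squaring, can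
  produce exponentially large values.\<close>

lemma ptime_foldl_size:
  assumes f: "ptime (\<lambda>p. f (fst p) (fst (snd p)) (snd (snd p)))" and i: "ptime i" and l: "ptime l"
    and q: "polyf q" "\<And>a k. sz (foldl (f a) (i a) (take k (l a))) \<le> q (sz a)"
  shows "ptime (\<lambda>a. foldl (f a) (i a) (l a))"
proof -
  \<comment> \<open>The loop state holds the whole input, the accumulator and the remaining list;
    the input is carried along because \<open>f\<close> may depend on it.\<close>
  define step where "step p = ((fst (fst p), f (fst (fst p)) (snd (fst p)) (hd (snd p))), tl (snd p))"
    for p :: "('a \<times> 'b) \<times> 'c list"
  define cond where "cond p \<longleftrightarrow> snd p \<noteq> []" for p :: "('a \<times> 'b) \<times> 'c list"
  have iter: "(step ^^ k) ((a, b), xs) = ((a, foldl (f a) b (take k xs)), drop k xs)"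
    if "k \<le> length xs" for k a b xs
    using that
  proof (induction k)
    case (Suc k)
    then show ?case
      by (simp add: step_def take_Suc_conv_app_nth hd_drop_conv_nth tl_drop drop_Suc)
  qed simp
  obtain qp where qp: "\<And>n. q n = poly qp n" using polyf_obtain[OF q(1)] by blast
  define N where "N p = length (snd p)" for p :: "('a \<times> 'b) \<times> 'c list"
  define D where "D = range (\<lambda>a. ((a, i a), l a))"
  have hd: "ptime_on {p. cond p} (\<lambda>p. hd (snd p))"
    by (rule ptime_on_comp[OF ptime_on_subset[OF ptime_snd[OF ptime_id]] ptime_on_hd]) (auto simp: cond_def)
  have "ptime_on {p. cond p} (\<lambda>p. (fst (fst p), (snd (fst p), hd (snd p))))"
    by (intro ptime_on_Pair hd ptime_on_subset[OF ptime_fst] ptime_on_subset[OF ptime_snd] ptime_fst ptime_id) auto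
  from ptime_on_comp[OF this f]
  have "ptime_on {p. cond p} (\<lambda>p. f (fst (fst p)) (snd (fst p)) (hd (snd p)))" by simp
  then have step: "ptime_on {p. cond p} step"
    unfolding step_def
    by (intro ptime_on_Pair hd ptime_on_subset[OF ptime_fst] ptime_on_subset[OF ptime_tl] ptime_snd ptime_fst ptime_id) auto
  have "ptime_on D (\<lambda>p. (step ^^ N p) p)"
  proof (rule ptime_on_while)
    show "ptime cond" unfolding cond_def by (intro ptime_not_Nil ptime_snd ptime_id)
    show "ptime_on {a. cond a} step" by (fact step)
    show "cond ((step ^^ j) p)" if "p \<in> D" "j < N p" for p j
      using that by (auto simp: D_def N_def iter cond_def)
    show "\<not> cond ((step ^^ N p) p)" if "p \<in> D" for p
      using that by (auto simp: D_def N_def iter cond_def)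
    show "polyf (\<lambda>n. n)" by (rule polyf_id)
    show "N p \<le> sz p" for p by (cases p) (auto simp: N_def intro: order_trans[OF length_le_sz])
    show "polyf (\<lambda>n. 2 + n + q n)" unfolding qp by (intro polyf_intros)
    show "sz ((step ^^ j) p) \<le> 2 + sz p + q (sz p)" if p: "p \<in> D" "j \<le> N p" for p j
    proof -
      obtain a where a: "p = ((a, i a), l a)" using p by (auto simp: D_def)
      have "sz (drop j (l a)) \<le> sz (l a)" by (rule sz_drop)
      moreover have "q (sz a) \<le> q (sz p)"
        unfolding qp by (rule poly_nat_mono) (simp add: a)
      ultimately show ?thesis
        using p(2) q(2)[of a j] by (simp add: a N_def iter)
    qed
  qed
  then have "ptime (\<lambda>a. (\<lambda>p. (step ^^ N p) p) ((a, i a), l a))"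
    by (rule ptime_on_comp[rotated]) (auto simp: D_def intro!: ptime_Pair ptime_id i l)
  then have "ptime (\<lambda>a. snd (fst ((\<lambda>p. (step ^^ N p) p) ((a, i a), l a))))"
    by (intro ptime_snd ptime_fst)
  then show ?thesis by (simp add: N_def iter)
qed

lemma foldl_invariant:
  assumes "P b" and "\<And>b x. P b \<Longrightarrow> x \<in> set xs \<Longrightarrow> P (f b x)"
  shows "P (foldl f b xs)"
  using assms by (induction xs arbitrary: b) auto

text \<open>For loops that replace the accumulator: a new value is no larger than the old one or
  bounded in terms of the input alone.\<close>

lemma ptime_foldl:
  assumes f: "ptime (\<lambda>p. f (fst p) (fst (snd p)) (snd (snd p)))" and i: "ptime i" and l: "ptime l"
    and q: "polyf q" "\<And>a b x. x \<in> set (l a) \<Longrightarrow> sz (f a b x) \<le> max (sz b) (q (sz a))"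
  shows "ptime (\<lambda>a. foldl (f a) (i a) (l a))"
proof -
  obtain r where r: "\<And>a. sz (i a) \<le> poly r (sz a)" using ptime_size[OF i] by blast
  show ?thesis
  proof (rule ptime_foldl_size[OF f i l])
    show "polyf (\<lambda>n. poly r n + q n)" by (intro polyf_intros q)
    show "sz (foldl (f a) (i a) (take k (l a))) \<le> poly r (sz a) + q (sz a)" for a k
    proof (rule foldl_invariant)
      show "sz (f a b x) \<le> poly r (sz a) + q (sz a)"
        if "sz b \<le> poly r (sz a) + q (sz a)" "x \<in> set (take k (l a))" for b x
        using that q(2)[of x a b] by (auto dest: in_set_takeD)
    qed (use r in \<open>simp add: trans_le_add1\<close>)
  qed
qed

text \<open>For loops that build up a value: every list element pays for the growth it causes, so
  the result is no larger than the initial value and the list together.\<close>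

lemma ptime_foldl_additive:
  assumes f: "ptime (\<lambda>p. f (fst p) (fst (snd p)) (snd (snd p)))" and i: "ptime i" and l: "ptime l"
    and add: "\<And>a b x. sz (f a b x) \<le> sz b + (1 + sz x)"
  shows "ptime (\<lambda>a. foldl (f a) (i a) (l a))"
proof -
  obtain r where r: "\<And>a. sz (i a) \<le> poly r (sz a)" using ptime_size[OF i] by blast
  obtain u where u: "\<And>a. sz (l a) \<le> poly u (sz a)" using ptime_size[OF l] by blast
  show ?thesis
  proof (rule ptime_foldl_size[OF f i l])
    show "polyf (\<lambda>n. poly r n + poly u n)" by (intro polyf_intros)
    show "sz (foldl (f a) (i a) (take k (l a))) \<le> poly r (sz a) + poly u (sz a)" for a k
    proof -
      have "sz (foldl (f a) b xs) \<le> sz b + sz xs" for b xs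
      proof (induction xs arbitrary: b)
        case (Cons x xs)
        show ?case using Cons.IH[of "f a b x"] add[of a b x] by simp
      qed simp
      from this[of "i a" "take k (l a)"] show ?thesis
        using r[of a] u[of a] sz_take[of k "l a"] by simp
    qed
  qed
qed

subsection \<open>Integers and truth values\<close>

lemma nat_abs_less_power: "nat \<bar>k\<bar> < 2 ^ floorlog 2 (nat \<bar>k\<bar>)"
  using floorlog_bounds[of "nat \<bar>k\<bar>" 2] by (cases "nat \<bar>k\<bar> = 0") auto

lemma int_length_mono: "\<bar>a\<bar> \<le> \<bar>b\<bar> \<Longrightarrow> int_length a \<le> int_length b"
  by (simp add: int_length_def floorlog_mono nat_mono)

lemma int_length_add: "int_length (a + b) \<le> int_length a + int_length b"
proof -
  let ?p = "floorlog 2 (nat \<bar>a\<bar>)" and ?q = "floorlog 2 (nat \<bar>b\<bar>)"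
  have "nat \<bar>a + b\<bar> \<le> nat \<bar>a\<bar> + nat \<bar>b\<bar>" by simp
  also have "\<dots> < 2 ^ ?p + 2 ^ ?q" by (intro add_strict_mono nat_abs_less_power)
  also have "\<dots> \<le> 2 ^ (?p + ?q) + 2 ^ (?p + ?q)" by (intro add_mono power_increasing) auto
  also have "\<dots> = 2 ^ (?p + ?q + 1)" by simp
  finally have "floorlog 2 (nat \<bar>a + b\<bar>) \<le> ?p + ?q + 1" by (intro floorlog_leI) auto
  then show ?thesis by (simp add: int_length_def)
qed

lemma int_length_minus: "int_length (- a) = int_length a"
  by (simp add: int_length_def)

lemma int_length_mult: "int_length (a * b) \<le> int_length a + int_length b"
proof -
  let ?p = "floorlog 2 (nat \<bar>a\<bar>)" and ?q = "floorlog 2 (nat \<bar>b\<bar>)"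
  have "nat \<bar>a * b\<bar> = nat \<bar>a\<bar> * nat \<bar>b\<bar>" by (simp add: abs_mult nat_mult_distrib)
  also have "\<dots> < 2 ^ ?p * 2 ^ ?q"
    using nat_abs_less_power[of a] nat_abs_less_power[of b] by (intro mult_strict_mono) auto
  also have "\<dots> = 2 ^ (?p + ?q)" by (simp add: power_add)
  finally have "floorlog 2 (nat \<bar>a * b\<bar>) \<le> ?p + ?q" by (intro floorlog_leI) auto
  then show ?thesis by (simp add: int_length_def)
qed

text \<open>Rounding down enlarges the absolute value only of a negative inexact quotient, and then
  the divisor has absolute value at least 2. Division by 0 yields 0.\<close>

lemma abs_div_le: "\<bar>a div b\<bar> \<le> \<bar>a\<bar>" for a b :: int
proof -
  have pos: "\<bar>c div d\<bar> \<le> \<bar>c\<bar>" if d: "d > 0" for c d :: int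
  proof (cases "c \<ge> 0")
    case True
    then show ?thesis using d zdiv_mono2[of c 1 d] by (simp add: pos_imp_zdiv_nonneg_iff)
  next
    case False
    have "c * 1 \<ge> c * d" using False d by (intro mult_left_mono_neg) auto
    then have "c div d \<ge> c" using d zdiv_mono1[of "c * d" c d] by simp
    moreover have "c div d < 0" using False d by (simp add: pos_imp_zdiv_neg_iff)
    ultimately show ?thesis using False by simp
  qed
  show ?thesis
    using pos[of b a] pos[of "- b" "- a"] by (cases "b > 0"; cases "b = 0") auto
qed

lemma ptime_int_op:
  assumes op: "\<And>e f s. eval (op e f) s = enc (g (to_int (eval e s)) (to_int (eval f s)))"
    "\<And>e f. args (op e f) = [e, f]"
    and size: "\<And>a b. sz (g a b) \<le> sz a + sz b + 2"
    and "ptime x" "ptime y"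
  shows "ptime (\<lambda>a. g (x a) (y a))"
proof (rule ptime_comp2[OF _ assms(4,5)], rule ptime_on_exp[where e = "op (LeftOf (Var 0)) (RightOf (Var 0))"])
  show "polyf (\<lambda>n. n + 2 + 4 * n)" by (intro polyf_intros)
  fix s :: store and p :: "int \<times> int" assume p: "s 0 = enc p"
  have "eval_cost (op (LeftOf (Var 0)) (RightOf (Var 0))) s =
    sz (g (fst p) (snd p)) + eval_cost (LeftOf (Var 0)) s + eval_cost (RightOf (Var 0)) s"
    by (subst eval_cost.simps) (simp add: op p enc_prod_def enc_int_def sz_def)
  moreover have "sz (fst p) + sz (snd p) + 1 = sz p" by (cases p) simp
  ultimately show "eval (op (LeftOf (Var 0)) (RightOf (Var 0))) s = enc (g (fst p) (snd p)) \<and>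
      eval_cost (op (LeftOf (Var 0)) (RightOf (Var 0))) s \<le> sz p + 2 + 4 * sz p"
    using size[of "fst p" "snd p"]
    by (simp add: op p eval_cost_eqs) (simp add: enc_prod_def enc_int_def sz_def)
qed

lemma ptime_add: "ptime x \<Longrightarrow> ptime y \<Longrightarrow> ptime (\<lambda>a. x a + y a :: int)"
  by (rule ptime_int_op[where op = Add and g = "(+)"])
    (use int_length_add in \<open>simp_all add: enc_int_def sz_int le_SucI trans_le_add1\<close>)

lemma ptime_diff: "ptime x \<Longrightarrow> ptime y \<Longrightarrow> ptime (\<lambda>a. x a - y a :: int)"
  by (rule ptime_int_op[where op = Sub and g = "(-)"])
    (use int_length_add[of _ "- _"] in \<open>simp_all add: enc_int_def sz_int le_SucI trans_le_add1 int_length_minus\<close>)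

lemma ptime_mult: "ptime x \<Longrightarrow> ptime y \<Longrightarrow> ptime (\<lambda>a. x a * y a :: int)"
  by (rule ptime_int_op[where op = Mul and g = "(*)"])
    (use int_length_mult in \<open>simp_all add: enc_int_def sz_int le_SucI trans_le_add1\<close>)

lemma ptime_div: "ptime x \<Longrightarrow> ptime y \<Longrightarrow> ptime (\<lambda>a. x a div y a :: int)"
  by (rule ptime_int_op[where op = Div and g = "(div)"])
    (use int_length_mono[OF abs_div_le] in \<open>simp_all add: enc_int_def sz_int le_SucI trans_le_add1\<close>)

lemma ptime_less: "ptime x \<Longrightarrow> ptime y \<Longrightarrow> ptime (\<lambda>a. (x a :: int) < y a)"
  by (rule ptime_int_op[where op = Less and g = "(<)"])
    (use order_trans[OF sz_bool] in \<open>simp_all add: enc_bool_def\<close>)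

lemma ptime_Not: "ptime b \<Longrightarrow> ptime (\<lambda>a. \<not> b a)"
  using ptime_If[OF _ ptime_const ptime_const, of b False True] by (simp add: if_bool_eq_conj)

lemma ptime_conj: "ptime b \<Longrightarrow> ptime c \<Longrightarrow> ptime (\<lambda>a. b a \<and> c a)"
  using ptime_If[OF _ _ ptime_const, of b c False] by (simp add: if_bool_eq_disj)

lemma ptime_disj: "ptime b \<Longrightarrow> ptime c \<Longrightarrow> ptime (\<lambda>a. b a \<or> c a)"
  using ptime_If[OF _ ptime_const, of b c True] by (simp add: if_bool_eq_conj disj_imp)

lemma ptime_le: "ptime x \<Longrightarrow> ptime y \<Longrightarrow> ptime (\<lambda>a. (x a :: int) \<le> y a)"
  using ptime_Not[OF ptime_less, of y x] by (simp add: not_less)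

lemma ptime_eq: "ptime x \<Longrightarrow> ptime y \<Longrightarrow> ptime (\<lambda>a. (x a :: int) = y a)"
  unfolding order.eq_iff by (intro ptime_conj ptime_le)

lemma ptime_max: "ptime x \<Longrightarrow> ptime y \<Longrightarrow> ptime (\<lambda>a. max (x a) (y a :: int))"
  unfolding max_def by (intro ptime_If ptime_le)

lemma ptime_uminus: "ptime x \<Longrightarrow> ptime (\<lambda>a. - x a :: int)"
  using ptime_diff[OF ptime_const[of 0]] by simp

lemma ptime_abs: "ptime x \<Longrightarrow> ptime (\<lambda>a. \<bar>x a :: int\<bar>)"
  unfolding abs_if by (intro ptime_If ptime_less ptime_uminus ptime_const)

lemma ptime_Let:
  "ptime (\<lambda>p. g (fst p) (snd p)) \<Longrightarrow> ptime f \<Longrightarrow> ptime (\<lambda>a. let x = f a in g a x)"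
  unfolding Let_def by (rule ptime_comp2[OF _ ptime_id])

subsection \<open>Lists\<close>

lemma sum_list_upt: "(\<Sum>e\<leftarrow>[0..<m]. f e) = (\<Sum>e<m. f e)"
  by (simp add: interv_sum_list_conv_sum_set_nat atLeast0LessThan)

lemma foldl_snoc: "foldl (\<lambda>b x. f x # b) b xs = rev (map f xs) @ b"
  by (induction xs arbitrary: b) auto

lemma ptime_rev: assumes "ptime l" shows "ptime (\<lambda>a. rev (l a))"
proof -
  have "ptime (\<lambda>a. foldl (\<lambda>b x. x # b) [] (l a))"
    by (rule ptime_foldl_additive) (intro ptime_Cons ptime_fst ptime_snd ptime_id ptime_const assms | simp)+
  then show ?thesis by (simp add: foldl_snoc[of "\<lambda>x. x"])
qed

lemma ptime_append: assumes "ptime k" "ptime l" shows "ptime (\<lambda>a. k a @ l a)"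
proof -
  have "ptime (\<lambda>a. foldl (\<lambda>b x. x # b) (l a) (rev (k a)))"
    by (rule ptime_foldl_additive) (intro ptime_Cons ptime_rev ptime_fst ptime_snd ptime_id ptime_const assms | simp)+
  then show ?thesis by (simp add: foldl_snoc[of "\<lambda>x. x"])
qed

lemma ptime_concat: assumes "ptime l" shows "ptime (\<lambda>a. concat (l a))"
proof -
  have "ptime (\<lambda>a. foldl (\<lambda>b x. b @ x) [] (l a))"
  proof (rule ptime_foldl_additive)
    show "sz (b @ x) \<le> sz b + (1 + sz x)" for b x :: "'b list"
      using sz_append[of b x] by simp
  qed (intro ptime_append ptime_fst ptime_snd ptime_id ptime_const assms)+
  moreover have "foldl (\<lambda>b x. b @ x) b xs = b @ concat xs" for b and xs :: "'b list list"
    by (induction xs arbitrary: b) auto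
  ultimately show ?thesis by simp
qed

lemma ptime_map:
  assumes f: "ptime (\<lambda>p. f (fst p) (snd p))" and l: "ptime l"
  shows "ptime (\<lambda>a. map (f a) (l a))"
proof -
  obtain u where u: "\<And>a. sz (l a) \<le> poly u (sz a)" using ptime_size[OF l] by blast
  obtain r where r: "\<And>p. sz (f (fst p) (snd p)) \<le> poly r (sz p)"
    using ptime_size[OF f] by blast
  have fp: "ptime (\<lambda>p. f (fst p) (snd (snd p)))"
    by (rule ptime_comp2[OF f]) (intro ptime_fst ptime_snd ptime_id)+
  have "ptime (\<lambda>a. foldl (\<lambda>b x. f a x # b) [] (l a))"
  proof (rule ptime_foldl_size)
    show "polyf (\<lambda>n. 1 + poly u n * (1 + poly r (1 + n + poly u n)))" by (intro polyf_intros)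
    show "sz (foldl (\<lambda>b x. f a x # b) [] (take k (l a))) \<le> 1 + poly u (sz a) * (1 + poly r (1 + sz a + poly u (sz a)))" for a k
    proof -
      have "sz (map (f a) (take k (l a))) \<le> 1 + length (map (f a) (take k (l a))) * (1 + poly r (1 + sz a + poly u (sz a)))"
      proof (rule sz_list_bound)
        fix y assume "y \<in> set (map (f a) (take k (l a)))"
        then obtain x where x: "x \<in> set (l a)" "y = f a x" by (auto dest: in_set_takeD)
        have "sz (a, x) \<le> 1 + sz a + poly u (sz a)"
          using sz_elem[OF x(1)] u[of a] by simp
        then have "poly r (sz (a, x)) \<le> poly r (1 + sz a + poly u (sz a))" by (rule poly_nat_mono)
        then show "sz y \<le> poly r (1 + sz a + poly u (sz a))" using r[of "(a, x)"] x by simp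
      qed
      moreover have "length (map (f a) (take k (l a))) \<le> poly u (sz a)"
        using length_le_sz[of "l a"] u[of a] by simp
      ultimately show ?thesis
        by (simp only: foldl_snoc append_Nil2 sz_rev) (meson add_left_mono mult_le_mono1 order_trans)
    qed
  qed (intro ptime_Cons fp ptime_fst ptime_snd ptime_id ptime_const l)+
  from ptime_rev[OF this] show ?thesis by (simp add: foldl_snoc)
qed

lemma ptime_filter:
  assumes P: "ptime (\<lambda>p. P (fst p) (snd p))" and l: "ptime l"
  shows "ptime (\<lambda>a. filter (P a) (l a))"
proof -
  have Pp: "ptime (\<lambda>p. P (fst p) (snd (snd p)))"
    by (rule ptime_comp2[OF P]) (intro ptime_fst ptime_snd ptime_id)+
  have "ptime (\<lambda>a. foldl (\<lambda>b x. if P a x then x # b else b) [] (l a))"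
    by (rule ptime_foldl_additive)
      (intro ptime_If Pp ptime_Cons ptime_fst ptime_snd ptime_id ptime_const l | simp)+
  moreover have "foldl (\<lambda>b x. if P a x then x # b else b) b xs = rev (filter (P a) xs) @ b" for a b xs
    by (induction xs arbitrary: b) auto
  ultimately have "ptime (\<lambda>a. rev (filter (P a) (l a)))" by simp
  from ptime_rev[OF this] show ?thesis by simp
qed

lemma ptime_list_all:
  assumes P: "ptime (\<lambda>p. P (fst p) (snd p))" and l: "ptime l"
  shows "ptime (\<lambda>a. list_all (P a) (l a))"
proof -
  have "ptime (\<lambda>a. \<not> filter (\<lambda>x. \<not> P a x) (l a) \<noteq> [])"
    by (intro ptime_Not ptime_not_Nil ptime_filter P l)
  then show ?thesis by (simp add: filter_empty_conv list_all_iff)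
qed

lemma ptime_list_ex:
  assumes P: "ptime (\<lambda>p. P (fst p) (snd p))" and l: "ptime l"
  shows "ptime (\<lambda>a. list_ex (P a) (l a))"
proof -
  have "ptime (\<lambda>a. \<not> list_all (\<lambda>x. \<not> P a x) (l a))"
    by (intro ptime_Not ptime_list_all P l)
  then show ?thesis by (simp add: list_all_iff list_ex_iff)
qed

lemma foldl_plus: "foldl (+) b xs = b + sum_list xs" for b :: int
  by (induction xs arbitrary: b) auto

lemma ptime_sum_list:
  fixes l :: "'a::enc \<Rightarrow> int list"
  assumes "ptime l" shows "ptime (\<lambda>a. sum_list (l a))"
proof -
  have "ptime (\<lambda>a. foldl (+) 0 (l a))"
  proof (rule ptime_foldl_additive)
    show "sz (b + x) \<le> sz b + (1 + sz x)" for b x :: int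
      using int_length_add[of b x] by (simp add: sz_int)
  qed (intro ptime_add ptime_fst ptime_snd ptime_id ptime_const assms)+
  then show ?thesis by (simp add: foldl_plus)
qed

lemma ptime_prod_list:
  fixes l :: "'a::enc \<Rightarrow> int list"
  assumes "ptime l" shows "ptime (\<lambda>a. prod_list (l a))"
proof -
  have "ptime (\<lambda>a. foldl (*) 1 (l a))"
  proof (rule ptime_foldl_additive)
    show "sz (b * x) \<le> sz b + (1 + sz x)" for b x :: int
      using int_length_mult[of b x] by (simp add: sz_int)
  qed (intro ptime_mult ptime_fst ptime_snd ptime_id ptime_const assms)+
  moreover have "foldl (*) b xs = b * prod_list xs" for b :: int and xs
    by (induction xs arbitrary: b) (auto simp: mult.assoc)
  ultimately show ?thesis by simp
qed

lemma ptime_map_const: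
  assumes "\<And>k. k \<in> set ks \<Longrightarrow> ptime (f k)"
  shows "ptime (\<lambda>a. map (\<lambda>k. f k a) ks)"
  using assms
proof (induction ks)
  case Nil
  show ?case by (simp add: ptime_const)
next
  case (Cons k ks)
  then show ?case by (auto intro!: ptime_Cons)
qed

text \<open>Both 0 and the empty list are encoded by \<open>Num 0\<close>, which is also the head and the tail of the
  empty list on encodings.\<close>

definition head :: "'a \<Rightarrow> 'a list \<Rightarrow> 'a" where
  "head z xs = (case xs of [] \<Rightarrow> z | x # _ \<Rightarrow> x)"

lemma ptime_head:
  assumes "enc z = Num 0" and "ptime l" shows "ptime (\<lambda>a. head z (l a))"
proof (rule ptime_comp[OF ptime_on_exp[where e = "LeftOf (Var 0)"] assms(2)])
  show "polyf (\<lambda>n. n + n)" by (intro polyf_intros)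
  fix s :: store and xs :: "'a list" assume "s 0 = enc xs"
  then show "eval (LeftOf (Var 0)) s = enc (head z xs) \<and> eval_cost (LeftOf (Var 0)) s \<le> sz xs + sz xs"
    using assms(1) by (cases xs) (simp_all add: eval_cost_eqs enc_Nil enc_Cons head_def sz_def int_length_def)
qed

definition elt :: "int list \<Rightarrow> nat \<Rightarrow> int" where
  "elt xs k = (if k < length xs then xs ! k else 0)"

text \<open>The index is a constant of the program, so the access is unrolled into \<open>k\<close>
  tails and one head. The default 0 of \<open>elt\<close> is what the machine returns beyond the end
  of the list.\<close>

lemma ptime_elt: assumes "ptime l" shows "ptime (\<lambda>a. elt (l a) k)"
proof -
  have "ptime (\<lambda>a. (tl ^^ k) (l a))"
    by (induction k) (auto intro: assms ptime_tl)
  then have "ptime (\<lambda>a. head 0 ((tl ^^ k) (l a)))" by (intro ptime_head) (simp add: enc_int_def)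
  moreover have "(tl ^^ k) xs = drop k xs" for xs :: "int list"
    by (induction k) (auto simp: drop_Suc tl_drop)
  moreover have "head 0 (drop k xs) = elt xs k" for xs
    by (cases "drop k xs") (auto simp: head_def elt_def simp flip: hd_drop_conv_nth)
  ultimately show ?thesis by simp
qed

text \<open>The second list consists of lists because \<open>head\<close> needs a default encoded by
  \<open>Num 0\<close>, here the empty list.\<close>

lemma ptime_zip:
  fixes k :: "'a::enc \<Rightarrow> 'b::enc list" and l :: "'a \<Rightarrow> 'c::enc list list"
  assumes "ptime k" "ptime l" shows "ptime (\<lambda>a. zip (k a) (l a))"
proof -
  define f where "f p x = (tl (fst p), if fst p \<noteq> [] then (x, head [] (fst p)) # snd p else snd p)"
    for p :: "'c list list \<times> ('b \<times> 'c list) list" and x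
  have foldl: "foldl f (ys, out) xs = (drop (length xs) ys, rev (zip xs ys) @ out)" for xs ys out
  proof (induction xs arbitrary: ys out)
    case (Cons x xs)
    then show ?case by (cases ys) (simp_all add: f_def head_def)
  qed simp
  obtain u where u: "\<And>a. sz (k a) \<le> poly u (sz a)" using ptime_size[OF assms(1)] by blast
  obtain v where v: "\<And>a. sz (l a) \<le> poly v (sz a)" using ptime_size[OF assms(2)] by blast
  have "ptime (\<lambda>a. foldl f (l a, []) (k a))"
  proof (rule ptime_foldl_size)
    show "ptime (\<lambda>p. f (fst (snd p)) (snd (snd p)))"
      unfolding f_def
      by (intro ptime_Pair ptime_tl ptime_If ptime_Cons ptime_not_Nil ptime_head ptime_fst ptime_snd ptime_id enc_Nil)
    show "polyf (\<lambda>n. 2 + poly v n + poly u n + poly v n + poly u n)" by (intro polyf_intros)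
    fix a j
    have z: "sz (zip xs ys) \<le> 1 + sz xs + sz ys + length xs" for xs :: "'b list" and ys :: "'c list list"
    proof (induction xs arbitrary: ys)
      case (Cons x xs)
      then show ?case by (cases ys) (auto simp: add.commute add.left_commute intro: le_SucI)
    qed simp
    show "sz (foldl f (l a, []) (take j (k a))) \<le> 2 + poly v (sz a) + poly u (sz a) + poly v (sz a) + poly u (sz a)"
      using z[of "take j (k a)" "l a"] sz_take[of j "k a"] sz_drop[of "length (take j (k a))" "l a"]
        length_le_sz[of "k a"] u[of a] v[of a] unfolding foldl by simp
  qed (intro ptime_Pair ptime_const assms)+
  from ptime_rev[OF ptime_snd[OF this]] show ?thesis by (simp add: foldl)
qed

text \<open>Indices are integers because natural numbers have no instance of
  \<open>enc\<close>.\<close>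

definition indices :: "'a list \<Rightarrow> int list" where
  "indices xs = map int [0..<length xs]"

lemma ptime_indices: assumes "ptime l" shows "ptime (\<lambda>a. indices (l a))"
proof -
  define f where "f = (\<lambda>(b :: int \<times> int list) (x :: 'b). (fst b + 1, fst b # snd b))"
  have f: "foldl f (0, []) xs = (int (length xs), rev (map int [0..<length xs]))" for xs
    by (induction xs rule: rev_induct) (auto simp: f_def)
  obtain u where u: "\<And>a. sz (l a) \<le> poly u (sz a)" using ptime_size[OF assms] by blast
  have "ptime (\<lambda>a. foldl f (0, []) (l a))"
  proof (rule ptime_foldl_size)
    show "polyf (\<lambda>n. 1 + (2 + poly u n) + (1 + poly u n * (1 + (2 + poly u n))))" by (intro polyf_intros)
    fix a k
    define n where "n = length (take k (l a))"
    have n: "n \<le> poly u (sz a)" using length_le_sz[of "l a"] u[of a] by (simp add: n_def)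
    have si: "sz (int m) \<le> 2 + m" for m
    proof -
      have "m < 2 ^ m" by simp
      then have "floorlog 2 m \<le> m" by (intro floorlog_leI) auto
      then show ?thesis by (simp add: sz_int int_length_def)
    qed
    have "sz (rev (map int [0..<n])) \<le> 1 + length (rev (map int [0..<n])) * (1 + (2 + n))"
      by (rule sz_list_bound) (auto intro!: order_trans[OF si])
    also have "\<dots> \<le> 1 + poly u (sz a) * (1 + (2 + poly u (sz a)))"
      using n by (auto intro!: add_mono mult_le_mono)
    finally show "sz (foldl f (0, []) (take k (l a))) \<le>
        1 + (2 + poly u (sz a)) + (1 + poly u (sz a) * (1 + (2 + poly u (sz a))))"
      using si[of n] n unfolding f by (simp add: n_def[symmetric] del: length_take)
  next
    show "ptime (\<lambda>p. f (fst (snd p)) (snd (snd p)))"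
      unfolding f_def by (intro ptime_Pair ptime_Cons ptime_add ptime_fst ptime_snd ptime_id ptime_const)
  qed (intro ptime_const assms)+
  then have "ptime (\<lambda>a. rev (snd (foldl f (0, []) (l a))))" by (intro ptime_rev ptime_snd)
  then show ?thesis by (simp add: f indices_def)
qed

text \<open>The elements serve as step lengths. The length, which is the number of binary digits of
  \<open>n\<close> and 0 for \<open>n \<le> 0\<close>, also serves as a loop count.\<close>

definition powers :: "int \<Rightarrow> int list" where
  "powers n = map (\<lambda>k. 2 ^ k) [0..<floorlog 2 (nat n)]"

lemma less_power_length_powers: "n < 2 ^ length (powers n)"
proof (cases "n \<ge> 0")
  case False
  then have "n < 0" by simp
  also have "0 < (2::int) ^ length (powers n)" by simp
  finally show ?thesis .
qed (use nat_abs_less_power[of n] in \<open>simp add: powers_def nat_less_iff\<close>)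

text \<open>Halving \<open>n\<close> until it is 0 takes as many rounds as \<open>n\<close> has
  digits, while a second component doubles and is recorded. The list has quadratic size.\<close>

lemma ptime_powers: assumes "ptime f" shows "ptime (\<lambda>a. powers (f a))"
proof -
  define cond where "cond p \<longleftrightarrow> 0 < fst p" for p :: "int \<times> int \<times> int list"
  define step where "step p = (fst p div 2, (2 * fst (snd p), fst (snd p) # snd (snd p)))"
    for p :: "int \<times> int \<times> int list"
  define N where "N p = floorlog 2 (nat (fst p))" for p :: "int \<times> int \<times> int list"
  define D where "D = range (\<lambda>n :: int. (n, (1 :: int, [] :: int list)))"
  have iter: "(step ^^ j) (n, (1, [])) = (n div 2 ^ j, (2 ^ j, rev (map (\<lambda>k. 2 ^ k) [0..<j])))" for j n
    by (induction j) (auto simp: step_def zdiv_zmult2_eq power_Suc2 simp del: power_Suc)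
  have "ptime_on D (\<lambda>p. (step ^^ N p) p)"
  proof (rule ptime_on_while)
    show "ptime cond" unfolding cond_def by (intro ptime_less ptime_fst ptime_id ptime_const)
    show "ptime_on {p. cond p} step" unfolding step_def
      by (rule ptime_on_subset[of UNIV])
        (intro ptime_Pair ptime_Cons ptime_div ptime_mult ptime_fst ptime_snd ptime_id ptime_const, simp)
    show "cond ((step ^^ j) p)" if p: "p \<in> D" "j < N p" for p j
    proof -
      obtain n where n: "p = (n, (1, []))" using p unfolding D_def by blast
      have "nat n \<noteq> 0" using p(2) by (auto simp: N_def n floorlog_def)
      then have "2 ^ (floorlog 2 (nat n) - 1) \<le> nat n" using floorlog_bounds[of "nat n" 2] by simp
      moreover have "(2::nat) ^ j \<le> 2 ^ (floorlog 2 (nat n) - 1)"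
        using p(2) by (intro power_increasing) (auto simp: N_def n)
      ultimately have "int (2 ^ j) \<le> int (nat n)" unfolding of_nat_le_iff by (rule order_trans[rotated])
      then have "2 ^ j \<le> n" using \<open>nat n \<noteq> 0\<close> by simp
      then show ?thesis by (simp add: n iter cond_def pos_imp_zdiv_pos_iff)
    qed
    show "\<not> cond ((step ^^ N p) p)" if p: "p \<in> D" for p
    proof -
      obtain n where n: "p = (n, (1, []))" using p unfolding D_def by blast
      have "n < 2 ^ floorlog 2 (nat n)" using less_power_length_powers[of n] by (simp add: powers_def)
      then show ?thesis by (simp add: n iter cond_def N_def pos_imp_zdiv_pos_iff)
    qed
    have Nsz: "N p \<le> sz p" for p
    proof (cases p)
      case (fields n y)
      have "floorlog 2 (nat n) \<le> floorlog 2 (nat \<bar>n\<bar>)" by (intro floorlog_mono) simp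
      then show ?thesis by (simp add: N_def fields sz_int int_length_def)
    qed
    then show "N p \<le> sz p" for p .
    show "polyf (\<lambda>n. n)" by (rule polyf_id)
    show "polyf (\<lambda>n. 2 + n + (2 + n) + (1 + n * (1 + (2 + n))))" by (intro polyf_intros)
    show "sz ((step ^^ j) p) \<le> 2 + sz p + (2 + sz p) + (1 + sz p * (1 + (2 + sz p)))" if p: "p \<in> D" "j \<le> N p" for p j
    proof -
      obtain n where n: "p = (n, (1, []))" using p by (auto simp: D_def)
      have j: "j \<le> sz p" using p(2) Nsz order_trans by blast
      have si: "sz ((2::int) ^ m) = 2 + m" for m
        using floorlog_power[of 1 2 m] by (simp add: sz_int int_length_def nat_power_eq floorlog_def)
      have "sz (rev (map (\<lambda>k. (2::int) ^ k) [0..<j])) \<le> 1 + length (rev (map (\<lambda>k. (2::int) ^ k) [0..<j])) * (1 + (2 + j))"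
        by (rule sz_list_bound) (auto simp: si)
      also have "\<dots> \<le> 1 + sz p * (1 + (2 + sz p))"
        using j by (auto intro!: add_mono mult_le_mono)
      finally have "sz (rev (map (\<lambda>k. (2::int) ^ k) [0..<j])) \<le> 1 + sz p * (1 + (2 + sz p))" .
      moreover have "sz (n div 2 ^ j) \<le> sz p"
        using int_length_mono[OF abs_div_le[of n "2 ^ j"]] by (simp add: n sz_int)
      moreover have "sz ((2::int) ^ j) \<le> 2 + sz p" using j by (simp add: si)
      ultimately show ?thesis unfolding n iter by (simp only: sz_Pair)
    qed
  qed
  then have "ptime (\<lambda>a. (\<lambda>p. (step ^^ N p) p) (f a, (1, [])))"
    by (rule ptime_on_comp[rotated]) (auto simp: D_def intro!: ptime_Pair assms ptime_const)
  then have "ptime (\<lambda>a. rev (snd (snd ((\<lambda>p. (step ^^ N p) p) (f a, (1, []))))))"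
    by (intro ptime_rev ptime_snd)
  then show ?thesis by (simp add: N_def iter powers_def)
qed

definition argmin :: "('a \<Rightarrow> int) \<Rightarrow> 'a \<Rightarrow> 'a list \<Rightarrow> 'a" where
  "argmin k x xs = foldl (\<lambda>b y. if k y < k b then y else b) x xs"

lemma argmin_in: "argmin k x xs \<in> set (x # xs)"
  unfolding argmin_def by (rule foldl_invariant) auto

lemma argmin_le: "y \<in> set (x # xs) \<Longrightarrow> k (argmin k x xs) \<le> k y"
proof (induction xs rule: rev_induct)
  case (snoc z xs)
  then show ?case by (auto simp: argmin_def)
qed (simp add: argmin_def)

lemma ptime_argmin:
  assumes k: "ptime (\<lambda>p. k (fst p) (snd p))" and x: "ptime x" and l: "ptime l"
  shows "ptime (\<lambda>a. argmin (k a) (x a) (l a))"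
proof -
  obtain u where u: "\<And>a. sz (l a) \<le> poly u (sz a)" using ptime_size[OF l] by blast
  show ?thesis
    unfolding argmin_def
  proof (rule ptime_foldl[OF _ x l])
    have "ptime (\<lambda>p. k (fst p) (snd (snd p)))" "ptime (\<lambda>p. k (fst p) (fst (snd p)))"
      by (rule ptime_comp2[OF k]; intro ptime_fst ptime_snd ptime_id)+
    then show "ptime (\<lambda>p. if k (fst p) (snd (snd p)) < k (fst p) (fst (snd p)) then snd (snd p) else fst (snd p))"
      by (intro ptime_If ptime_less ptime_fst ptime_snd ptime_id)
    show "polyf (poly u)" by (rule polyf_poly)
    show "sz (if k a y < k a b then y else b) \<le> max (sz b) (poly u (sz a))" if "y \<in> set (l a)" for a b y
      using sz_elem[OF that] u[of a] by auto
  qed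
qed

lemmas ptime_intros =
  ptime_id ptime_const ptime_fst ptime_snd ptime_Pair ptime_enc ptime_If ptime_Let
  ptime_add ptime_diff ptime_mult ptime_div ptime_less ptime_le ptime_eq ptime_max ptime_uminus ptime_abs
  ptime_Not ptime_conj ptime_disj
  ptime_Cons ptime_append ptime_concat ptime_map ptime_filter ptime_list_all ptime_list_ex
  ptime_sum_list ptime_prod_list ptime_map_const ptime_elt ptime_zip ptime_indices ptime_powers ptime_argmin

section \<open>Conformal decompositions\<close>

text \<open>One coordinate of the conformal order known from Graver bases: \<open>a\<close> lies
  between 0 and \<open>b\<close>.\<close>

definition conf :: "int \<Rightarrow> int \<Rightarrow> bool" where
  "conf a b \<longleftrightarrow> 0 \<le> a \<and> a \<le> b \<or> b \<le> a \<and> a \<le> 0"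

lemma conf_refl [simp]: "conf a a"
  by (auto simp: conf_def)

lemma conf_trans: "conf a b \<Longrightarrow> conf b c \<Longrightarrow> conf a c"
  by (auto simp: conf_def)

lemma conf_add: "conf a (d - v) \<Longrightarrow> conf v d \<Longrightarrow> conf (a + v) d"
  unfolding conf_def by linarith

lemma conf_shrink: "conf a (d - v) \<Longrightarrow> conf v d \<Longrightarrow> conf a d"
  unfolding conf_def by linarith

text \<open>All \<open>f i\<close> have the sign of their sum \<open>d\<close>, so nothing cancels
  and the inequalities add up.\<close>

lemma conf_sum:
  assumes "finite I" "\<And>i. i \<in> I \<Longrightarrow> conf (g i) (f i)" "\<And>i. i \<in> I \<Longrightarrow> conf (f i) d" "d = (\<Sum>i\<in>I. f i)"
  shows "conf (\<Sum>i\<in>I. g i) d"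
proof (cases "d \<ge> 0")
  case True
  then have "0 \<le> g i" "g i \<le> f i" if "i \<in> I" for i
    using assms(2,3)[OF that] by (auto simp: conf_def)
  then show ?thesis unfolding conf_def assms(4) by (auto intro: sum_nonneg sum_mono)
next
  case False
  then have "g i \<le> 0" "f i \<le> g i" if "i \<in> I" for i
    using assms(2,3)[OF that] by (auto simp: conf_def)
  then show ?thesis unfolding conf_def assms(4) by (auto intro: sum_nonpos sum_mono)
qed

type_synonym vector = "nat \<Rightarrow> int"
type_synonym array = "nat \<Rightarrow> nat \<Rightarrow> int"

text \<open>Induction on the coordinates, separately for the two signs of the new one. A basis for
  the other coordinates serves every element whose new coordinate is, in absolute value, at least
  the largest one \<open>L\<close> in that basis; each of the finitely many values up to
  \<open>L\<close> gets a basis of its own.\<close>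

lemma dickson:
  fixes \<phi> :: "'x \<Rightarrow> 'j \<Rightarrow> int"
  assumes "finite J"
  shows "\<exists>B\<subseteq>S. finite B \<and> (\<forall>s\<in>S. \<exists>b\<in>B. \<forall>j\<in>J. conf (\<phi> b j) (\<phi> s j))"
  using assms
proof (induction J arbitrary: S)
  case empty
  show ?case
  proof (cases "S = {}")
    case False
    then obtain s where "s \<in> S" by blast
    then show ?thesis by (intro exI[of _ "{s}"]) auto
  qed auto
next
  case (insert j J)
  have half: "\<exists>B\<subseteq>S. finite B \<and> (\<forall>s\<in>S. 0 \<le> \<sigma> * \<phi> s j \<longrightarrow> (\<exists>b\<in>B. \<forall>i\<in>insert j J. conf (\<phi> b i) (\<phi> s i)))"
    if \<sigma>: "\<sigma> = 1 \<or> \<sigma> = -1" for \<sigma> :: int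
  proof -
    obtain B where B: "B \<subseteq> {s\<in>S. 0 \<le> \<sigma> * \<phi> s j}" "finite B"
      "\<And>s. s \<in> S \<Longrightarrow> 0 \<le> \<sigma> * \<phi> s j \<Longrightarrow> \<exists>b\<in>B. \<forall>i\<in>J. conf (\<phi> b i) (\<phi> s i)"
      using insert.IH[of "{s\<in>S. 0 \<le> \<sigma> * \<phi> s j}"] by auto
    have "\<forall>t. \<exists>C. C \<subseteq> {s\<in>S. \<sigma> * \<phi> s j = t} \<and> finite C \<and>
        (\<forall>s\<in>{s\<in>S. \<sigma> * \<phi> s j = t}. \<exists>b\<in>C. \<forall>i\<in>J. conf (\<phi> b i) (\<phi> s i))"
      by (intro allI insert.IH)
    from choice[OF this] obtain C where C': "\<forall>t. C t \<subseteq> {s\<in>S. \<sigma> * \<phi> s j = t} \<and> finite (C t) \<and>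
        (\<forall>s\<in>{s\<in>S. \<sigma> * \<phi> s j = t}. \<exists>b\<in>C t. \<forall>i\<in>J. conf (\<phi> b i) (\<phi> s i))" ..
    have C: "C t \<subseteq> {s\<in>S. \<sigma> * \<phi> s j = t}" "finite (C t)" for t
      using C' by auto
    have C3: "\<exists>b\<in>C (\<sigma> * \<phi> s j). \<forall>i\<in>J. conf (\<phi> b i) (\<phi> s i)" if "s \<in> S" for s
      using C' that by blast
    obtain L where L: "\<And>b. b \<in> B \<Longrightarrow> \<sigma> * \<phi> b j \<le> L"
      using Max_ge[OF finite_imageI[OF B(2), of "\<lambda>b. \<sigma> * \<phi> b j"]] by blast
    define B' where "B' = B \<union> (\<Union>t\<in>{0..L}. C t)"
    have "\<exists>b\<in>B'. \<forall>i\<in>insert j J. conf (\<phi> b i) (\<phi> s i)" if s: "s \<in> S" "0 \<le> \<sigma> * \<phi> s j" for s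
    proof (cases "L \<le> \<sigma> * \<phi> s j")
      case True
      obtain b where b: "b \<in> B" "\<forall>i\<in>J. conf (\<phi> b i) (\<phi> s i)" using B(3)[OF s] by blast
      then have "0 \<le> \<sigma> * \<phi> b j" "\<sigma> * \<phi> b j \<le> \<sigma> * \<phi> s j" using B(1) L[of b] True by auto
      then have "conf (\<phi> b j) (\<phi> s j)" using \<sigma> by (auto simp: conf_def)
      then show ?thesis using b by (auto simp: B'_def)
    next
      case False
      obtain b where b: "b \<in> C (\<sigma> * \<phi> s j)" "\<forall>i\<in>J. conf (\<phi> b i) (\<phi> s i)" using C3[OF s(1)] by blast
      then have "\<phi> b j = \<phi> s j" using C(1) \<sigma> by fastforce
      moreover have "b \<in> B'" using b(1) s(2) False by (auto simp: B'_def)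
      ultimately show ?thesis using b(2) by (intro bexI[of _ b]) auto
    qed
    moreover have "B' \<subseteq> S" unfolding B'_def using B(1) C(1) by blast
    moreover have "finite B'" unfolding B'_def using B(2) C(2) by auto
    ultimately show ?thesis by blast
  qed
  obtain B1 where B1: "B1 \<subseteq> S" "finite B1"
    "\<And>s. s \<in> S \<Longrightarrow> 0 \<le> \<phi> s j \<Longrightarrow> \<exists>b\<in>B1. \<forall>i\<in>insert j J. conf (\<phi> b i) (\<phi> s i)"
    using half[of 1] by auto
  obtain B2 where B2: "B2 \<subseteq> S" "finite B2"
    "\<And>s. s \<in> S \<Longrightarrow> \<phi> s j \<le> 0 \<Longrightarrow> \<exists>b\<in>B2. \<forall>i\<in>insert j J. conf (\<phi> b i) (\<phi> s i)"
    using half[of "-1"] by auto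
  have "\<exists>b\<in>B1 \<union> B2. \<forall>i\<in>insert j J. conf (\<phi> b i) (\<phi> s i)" if "s \<in> S" for s
    using B1(3)[OF that] B2(3)[OF that] linear[of 0 "\<phi> s j"] by blast
  then show ?case using B1(1,2) B2(1,2) by (intro exI[of _ "B1 \<union> B2"]) auto
qed

text \<open>Subtracting a nonzero conformal piece strictly lowers the 1-norm of
  \<open>\<phi> d\<close>, and what is conformal to the remainder stays conformal to
  \<open>\<phi> d\<close>. Only closure under differences is asked of \<open>\<phi>\<close>, so that
  single vectors and whole arrays are treated alike.\<close>

lemma conf_decomposition:
  fixes \<phi> :: "'x \<Rightarrow> 'j \<Rightarrow> int"
  assumes "finite J" "finite G"
    and diff: "\<And>x y. \<exists>z. \<forall>j\<in>J. \<phi> z j = \<phi> x j - \<phi> y j"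
    and piece: "\<And>d. \<exists>j\<in>J. \<phi> d j \<noteq> 0 \<Longrightarrow>
      \<exists>g\<in>G. (\<exists>j\<in>J. \<phi> g j \<noteq> 0) \<and> (\<forall>j\<in>J. conf (\<phi> g j) (\<phi> d j))"
  shows "\<exists>\<alpha> :: 'x \<Rightarrow> nat. \<forall>j\<in>J. \<phi> d j = (\<Sum>g\<in>G. int (\<alpha> g) * \<phi> g j) \<and>
    (\<forall>g\<in>G. conf (int (\<alpha> g) * \<phi> g j) (\<phi> d j))"
proof (induction "nat (\<Sum>j\<in>J. \<bar>\<phi> d j\<bar>)" arbitrary: d rule: less_induct)
  case less
  show ?case
  proof (cases "\<exists>j\<in>J. \<phi> d j \<noteq> 0")
    case False
    then show ?thesis by (intro exI[of _ "\<lambda>_. 0"]) auto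
  next
    case True
    obtain g where g: "g \<in> G" "\<exists>j\<in>J. \<phi> g j \<noteq> 0" "\<And>j. j \<in> J \<Longrightarrow> conf (\<phi> g j) (\<phi> d j)"
      using piece[OF True] by blast
    obtain d' where d': "\<And>j. j \<in> J \<Longrightarrow> \<phi> d' j = \<phi> d j - \<phi> g j" using diff by blast
    have le: "\<bar>\<phi> d' j\<bar> \<le> \<bar>\<phi> d j\<bar>" if "j \<in> J" for j
      using g(3)[OF that] d'[OF that] by (auto simp: conf_def)
    have "(\<Sum>j\<in>J. \<bar>\<phi> d' j\<bar>) < (\<Sum>j\<in>J. \<bar>\<phi> d j\<bar>)"
    proof (rule sum_strict_mono_ex1[OF assms(1)])
      obtain j where "j \<in> J" "\<phi> g j \<noteq> 0" using g(2) by blast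
      then show "\<exists>j\<in>J. \<bar>\<phi> d' j\<bar> < \<bar>\<phi> d j\<bar>"
        using g(3)[of j] d'[of j] by (intro bexI[of _ j]) (auto simp: conf_def)
    qed (use le in auto)
    then have "nat (\<Sum>j\<in>J. \<bar>\<phi> d' j\<bar>) < nat (\<Sum>j\<in>J. \<bar>\<phi> d j\<bar>)"
      by (subst nat_less_eq_zless) (auto intro: sum_nonneg)
    from less[OF this] obtain \<alpha> :: "'x \<Rightarrow> nat" where \<alpha>: "\<And>j. j \<in> J \<Longrightarrow> \<phi> d' j = (\<Sum>g\<in>G. int (\<alpha> g) * \<phi> g j)"
      "\<And>j g. j \<in> J \<Longrightarrow> g \<in> G \<Longrightarrow> conf (int (\<alpha> g) * \<phi> g j) (\<phi> d' j)" by blast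
    define \<alpha>' where "\<alpha>' = \<alpha>(g := \<alpha> g + 1)"
    have "\<phi> d j = (\<Sum>g\<in>G. int (\<alpha>' g) * \<phi> g j)" if j: "j \<in> J" for j
    proof -
      have "(\<Sum>h\<in>G. int (\<alpha>' h) * \<phi> h j) = (\<Sum>h\<in>G. int (\<alpha> h) * \<phi> h j + (if h = g then \<phi> g j else 0))"
        by (rule sum.cong) (auto simp: \<alpha>'_def algebra_simps)
      also have "\<dots> = \<phi> d' j + \<phi> g j" using \<alpha>(1)[OF j] g(1) assms(2) by (simp add: sum.distrib)
      finally show ?thesis using d'[OF j] by simp
    qed
    moreover have "conf (int (\<alpha>' h) * \<phi> h j) (\<phi> d j)" if j: "j \<in> J" "h \<in> G" for j h
    proof (cases "h = g")
      case True
      have "int (\<alpha>' h) * \<phi> h j = int (\<alpha> h) * \<phi> h j + \<phi> h j" by (simp add: \<alpha>'_def True distrib_right)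
      then show ?thesis
        using conf_add[OF \<alpha>(2)[OF j, unfolded d'[OF j(1)]] g(3)[OF j(1)]] True by simp
    next
      case False
      then show ?thesis
        using conf_shrink[OF \<alpha>(2)[OF j, unfolded d'[OF j(1)]] g(3)[OF j(1)]] by (simp add: \<alpha>'_def)
    qed
    ultimately show ?thesis by blast
  qed
qed

section \<open>Test sets and decompositions for a single commodity\<close>

definition dot :: "nat \<Rightarrow> vector \<Rightarrow> vector \<Rightarrow> int" where
  "dot m a v = (\<Sum>e<m. a e * v e)"

lemma dot_add: "dot m a (\<lambda>e. v e + w e) = dot m a v + dot m a w"
  by (simp add: dot_def algebra_simps sum.distrib)

lemma dot_diff: "dot m a (\<lambda>e. v e - w e) = dot m a v - dot m a w"
  by (simp add: dot_def algebra_simps sum_subtractf)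

lemma dot_sum: "dot m a (\<lambda>e. \<Sum>i\<in>I. k i * v i e) = (\<Sum>i\<in>I. k i * dot m a (v i))"
  unfolding dot_def sum_distrib_left by (subst sum.swap) (simp add: algebra_simps)

lemma dot_cong: "(\<And>e. e < m \<Longrightarrow> v e = w e) \<Longrightarrow> dot m a v = dot m a w"
  by (simp add: dot_def)

lemma dot_zero [simp]: "dot m a (\<lambda>e. 0) = 0"
  by (simp add: dot_def)

lemma dot_scale: "dot m a (\<lambda>e. k * v e) = k * dot m a v"
  by (simp add: dot_def algebra_simps sum_distrib_left)

text \<open>A test set for one commodity, such as a Graver basis of the incidence matrix extended by an
  identity block.\<close>

definition test_set :: "nat \<Rightarrow> nat \<Rightarrow> array \<Rightarrow> vector set \<Rightarrow> bool" where
  "test_set m n A G \<longleftrightarrow> finite G \<and> (\<forall>v\<in>G. \<exists>e<m. v e \<noteq> 0) \<and>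
    (\<forall>d. (\<exists>e<m. d e \<noteq> 0) \<longrightarrow> (\<exists>v\<in>G. (\<forall>e<m. conf (v e) (d e)) \<and>
      (\<forall>r<n. conf (dot m (A r) v) (dot m (A r) d))))"

lemma test_setD:
  assumes "test_set m n A G"
  shows "finite G"
    and "v \<in> G \<Longrightarrow> \<exists>e<m. v e \<noteq> 0"
    and "\<exists>e<m. d e \<noteq> 0 \<Longrightarrow> \<exists>v\<in>G. (\<forall>e<m. conf (v e) (d e)) \<and>
      (\<forall>r<n. conf (dot m (A r) v) (dot m (A r) d))"
  using assms unfolding test_set_def by simp_all

lemma test_set_exists: "\<exists>G. test_set m n A G"
proof -
  define \<phi> where "\<phi> v = case_sum v (\<lambda>r. dot m (A r) v)" for v
  obtain B where B: "B \<subseteq> {v. \<exists>e<m. v e \<noteq> 0}" "finite B"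
    "\<forall>s\<in>{v. \<exists>e<m. v e \<noteq> 0}. \<exists>b\<in>B. \<forall>j\<in>Inl ` {..<m} \<union> Inr ` {..<n}. conf (\<phi> b j) (\<phi> s j)"
    using dickson[of "Inl ` {..<m} \<union> Inr ` {..<n}" "{v. \<exists>e<m. v e \<noteq> 0}" \<phi>] by auto
  have "test_set m n A B"
    unfolding test_set_def
  proof (intro conjI allI impI)
    fix d :: vector assume "\<exists>e<m. d e \<noteq> 0"
    then obtain v where "v \<in> B" "\<forall>j\<in>Inl ` {..<m} \<union> Inr ` {..<n}. conf (\<phi> v j) (\<phi> d j)" using B(3) by blast
    then show "\<exists>v\<in>B. (\<forall>e<m. conf (v e) (d e)) \<and> (\<forall>r<n. conf (dot m (A r) v) (dot m (A r) d))"
      by (intro bexI[of _ v]) (auto simp: \<phi>_def ball_Un)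
  qed (use B in auto)
  then show ?thesis ..
qed

definition decomposes :: "nat \<Rightarrow> nat \<Rightarrow> array \<Rightarrow> vector set \<Rightarrow>
    (vector \<Rightarrow> nat) \<Rightarrow> vector \<Rightarrow> bool" where
  "decomposes m n A G \<mu> d \<longleftrightarrow>
    (\<forall>e<m. d e = (\<Sum>v\<in>G. int (\<mu> v) * v e) \<and> (\<forall>v\<in>G. conf (int (\<mu> v) * v e) (d e))) \<and>
    (\<forall>r<n. dot m (A r) d = (\<Sum>v\<in>G. int (\<mu> v) * dot m (A r) v) \<and>
      (\<forall>v\<in>G. conf (int (\<mu> v) * dot m (A r) v) (dot m (A r) d)))"

lemma decomposesD:
  assumes "decomposes m n A G \<mu> d"
  shows "e < m \<Longrightarrow> d e = (\<Sum>v\<in>G. int (\<mu> v) * v e)"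
    and "e < m \<Longrightarrow> v \<in> G \<Longrightarrow> conf (int (\<mu> v) * v e) (d e)"
    and "r < n \<Longrightarrow> dot m (A r) d = (\<Sum>v\<in>G. int (\<mu> v) * dot m (A r) v)"
    and "r < n \<Longrightarrow> v \<in> G \<Longrightarrow> conf (int (\<mu> v) * dot m (A r) v) (dot m (A r) d)"
  using assms unfolding decomposes_def by blast+

lemma test_set_decomposition:
  assumes G: "test_set m n A G"
  shows "\<exists>\<mu>. decomposes m n A G \<mu> d"
proof -
  define \<phi> where "\<phi> v = case_sum v (\<lambda>r. dot m (A r) v)" for v
  let ?J = "Inl ` {..<m} \<union> Inr ` {..<n}"
  have "\<exists>\<mu> :: vector \<Rightarrow> nat. \<forall>j\<in>?J. \<phi> d j = (\<Sum>v\<in>G. int (\<mu> v) * \<phi> v j) \<and>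
      (\<forall>v\<in>G. conf (int (\<mu> v) * \<phi> v j) (\<phi> d j))"
  proof (rule conf_decomposition[where \<phi> = \<phi> and G = G and J = ?J and d = d])
    show "\<exists>z. \<forall>j\<in>?J. \<phi> z j = \<phi> x j - \<phi> y j" for x y
      by (rule exI[of _ "\<lambda>e. x e - y e"]) (auto simp: \<phi>_def dot_diff)
    fix d :: vector assume "\<exists>j\<in>?J. \<phi> d j \<noteq> 0"
    then have "\<exists>e<m. d e \<noteq> 0"
    proof (rule contrapos_pp)
      assume *: "\<not> (\<exists>e<m. d e \<noteq> 0)"
      then have "dot m (A r) d = 0" for r unfolding dot_def by (intro sum.neutral) auto
      then show "\<not> (\<exists>j\<in>?J. \<phi> d j \<noteq> 0)" using * by (auto simp: \<phi>_def)
    qed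
    from test_setD(3)[OF G this] obtain v where v: "v \<in> G" "\<forall>e<m. conf (v e) (d e)"
      "\<forall>r<n. conf (dot m (A r) v) (dot m (A r) d)" by blast
    obtain e where "e < m" "v e \<noteq> 0" using test_setD(2)[OF G v(1)] by blast
    then have "\<exists>j\<in>?J. \<phi> v j \<noteq> 0" by (intro bexI[of _ "Inl e"]) (auto simp: \<phi>_def)
    moreover have "\<forall>j\<in>?J. conf (\<phi> v j) (\<phi> d j)" using v(2,3) by (auto simp: \<phi>_def)
    ultimately show "\<exists>g\<in>G. (\<exists>j\<in>?J. \<phi> g j \<noteq> 0) \<and> (\<forall>j\<in>?J. conf (\<phi> g j) (\<phi> d j))"
      using v(1) by (intro bexI[of _ v] conjI)
  qed (use test_setD(1)[OF G] in simp_all)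
  then obtain \<mu> :: "vector \<Rightarrow> nat" where
    \<mu>: "\<forall>j\<in>?J. \<phi> d j = (\<Sum>v\<in>G. int (\<mu> v) * \<phi> v j) \<and> (\<forall>v\<in>G. conf (int (\<mu> v) * \<phi> v j) (\<phi> d j))" ..
  have "d e = (\<Sum>v\<in>G. int (\<mu> v) * v e) \<and> (\<forall>v\<in>G. conf (int (\<mu> v) * v e) (d e))" if "e < m" for e
    using bspec[OF \<mu>, of "Inl e"] that unfolding \<phi>_def sum.case by blast
  moreover have "dot m (A r) d = (\<Sum>v\<in>G. int (\<mu> v) * dot m (A r) v) \<and>
      (\<forall>v\<in>G. conf (int (\<mu> v) * dot m (A r) v) (dot m (A r) d))" if "r < n" for r
    using bspec[OF \<mu>, of "Inr r"] that unfolding \<phi>_def sum.case by blast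
  ultimately show ?thesis unfolding decomposes_def by blast
qed

text \<open>Greedy from the last index on. This hands the total multiplicities selected by Dickson's
  lemma back to the individual commodities.\<close>

lemma split_multiplicity:
  fixes \<mu> :: "nat \<Rightarrow> nat"
  assumes "k \<le> (\<Sum>i<M. \<mu> i)"
  shows "\<exists>\<nu>. (\<forall>i<M. \<nu> i \<le> \<mu> i) \<and> (\<Sum>i<M. \<nu> i) = k"
  using assms
proof (induction M arbitrary: k)
  case (Suc M)
  define j where "j = min k (\<mu> M)"
  have "k - j \<le> (\<Sum>i<M. \<mu> i)" using Suc.prems by (auto simp: j_def)
  then obtain \<nu> where \<nu>: "\<forall>i<M. \<nu> i \<le> \<mu> i" "(\<Sum>i<M. \<nu> i) = k - j" using Suc.IH by blast
  have "(\<Sum>i<Suc M. (\<nu>(M := j)) i) = (\<Sum>i<M. \<nu> i) + j"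
    by (simp add: sum.cong[of "{..<M}" "{..<M}" "\<lambda>i. if i = M then j else \<nu> i" \<nu>])
  then show ?case using \<nu> by (intro exI[of _ "\<nu>(M := j)"]) (auto simp: j_def less_Suc_eq)
qed simp

section \<open>Conformal pieces for all commodities together\<close>

definition size_of :: "nat \<Rightarrow> nat \<Rightarrow> array \<Rightarrow> int" where
  "size_of M m g = (\<Sum>i<M. \<Sum>e<m. \<bar>g i e\<bar>)"

definition conf_move :: "nat \<Rightarrow> nat \<Rightarrow> nat \<Rightarrow> array \<Rightarrow> array \<Rightarrow> array \<Rightarrow> bool" where
  "conf_move M m n A g d \<longleftrightarrow> (\<forall>i<M. \<forall>e<m. conf (g i e) (d i e)) \<and>
    (\<forall>i<M. \<forall>r<n. conf (dot m (A r) (g i)) (dot m (A r) (d i))) \<and>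
    (\<forall>e<m. conf (\<Sum>i<M. g i e) (\<Sum>i<M. d i e))"

definition nonzero :: "nat \<Rightarrow> nat \<Rightarrow> array \<Rightarrow> bool" where
  "nonzero M m g \<longleftrightarrow> (\<exists>i<M. \<exists>e<m. g i e \<noteq> 0)"

definition pieces_bound :: "nat \<Rightarrow> nat \<Rightarrow> array \<Rightarrow> nat \<Rightarrow> bool" where
  "pieces_bound m n A K \<longleftrightarrow> (\<forall>M d. nonzero M m d \<longrightarrow>
     (\<exists>g. nonzero M m g \<and> conf_move M m n A g d \<and> size_of M m g \<le> int K))"

text \<open>The bound does not depend on the number \<open>M\<close> of commodities: Dickson's lemma is applied to
  the multiplicities of the test vectors, added up over all commodities.\<close>

lemma bounded_pieces: "\<exists>K. pieces_bound m n A K"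
proof -
  obtain G where G: "test_set m n A G" using test_set_exists by blast
  then have fin: "finite G" by (rule test_setD)
  \<comment> \<open>The totals per edge are coordinates of their own: test vectors of different
    commodities may cancel there, so smaller multiplicities alone would not make the total
    conformal.\<close>
  define \<phi> where "\<phi> = (\<lambda>l :: vector \<Rightarrow> nat. case_sum (\<lambda>v. int (l v)) (\<lambda>e. \<Sum>v\<in>G. int (l v) * v e))"
  let ?J = "Inl ` G \<union> Inr ` {..<m}"
  let ?S = "{l :: vector \<Rightarrow> nat. \<exists>v\<in>G. 0 < l v}"
  have "finite ?J" using fin by simp
  from dickson[OF this, of ?S \<phi>] obtain H where H: "H \<subseteq> ?S" "finite H"
    "\<forall>l\<in>?S. \<exists>h\<in>H. \<forall>j\<in>?J. conf (\<phi> h j) (\<phi> l j)" by blast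
  define size where "size h = (\<Sum>v\<in>G. int (h v) * (\<Sum>e<m. \<bar>v e\<bar>))" for h
  \<comment> \<open>\<open>G\<close> and \<open>H\<close> are fixed before \<open>M\<close> and
    \<open>d\<close> appear, hence so is \<open>K\<close>.\<close>
  define K where "K = nat (\<Sum>h\<in>H. size h)"
  have size_nonneg: "0 \<le> size h" for h unfolding size_def by (intro sum_nonneg mult_nonneg_nonneg) auto
  have "\<exists>g. nonzero M m g \<and> conf_move M m n A g d \<and> size_of M m g \<le> int K"
    if d: "nonzero M m d" for M d
  proof -
    have "\<forall>i. \<exists>\<mu>. decomposes m n A G \<mu> (d i)" using test_set_decomposition[OF G] by blast
    from choice[OF this] obtain \<mu> where "\<forall>i. decomposes m n A G (\<mu> i) (d i)" ..
    then have \<mu>': "decomposes m n A G (\<mu> i) (d i)" for i by blast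
    note \<mu> = decomposesD[OF \<mu>']
    define l where "l v = (\<Sum>i<M. \<mu> i v)" for v
    obtain i0 e0 where i0: "i0 < M" "e0 < m" "d i0 e0 \<noteq> 0" using d unfolding nonzero_def by blast
    then have "\<exists>v\<in>G. 0 < \<mu> i0 v" using \<mu>(1)[of e0 i0] by (auto intro: ccontr)
    then have "l \<in> ?S" unfolding l_def using i0(1) by (auto intro: sum_pos2)
    then obtain h where h: "h \<in> H" "\<And>j. j \<in> ?J \<Longrightarrow> conf (\<phi> h j) (\<phi> l j)" using H(3) by blast
    have hl: "h v \<le> l v" if "v \<in> G" for v
      using h(2)[of "Inl v"] that by (auto simp: \<phi>_def conf_def)
    have hY: "conf (\<Sum>v\<in>G. int (h v) * v e) (\<Sum>v\<in>G. int (l v) * v e)" if "e < m" for e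
      using h(2)[of "Inr e"] that by (auto simp: \<phi>_def)
    have "\<forall>v. \<exists>\<nu>. v \<in> G \<longrightarrow> (\<forall>i<M. \<nu> i \<le> \<mu> i v) \<and> (\<Sum>i<M. \<nu> i) = h v"
      using split_multiplicity hl unfolding l_def by blast
    from choice[OF this] obtain \<nu> where
      \<nu>': "\<forall>v. v \<in> G \<longrightarrow> (\<forall>i<M. \<nu> v i \<le> \<mu> i v) \<and> (\<Sum>i<M. \<nu> v i) = h v" ..
    have \<nu>: "\<And>v i. v \<in> G \<Longrightarrow> i < M \<Longrightarrow> \<nu> v i \<le> \<mu> i v"
      "\<And>v. v \<in> G \<Longrightarrow> (\<Sum>i<M. \<nu> v i) = h v" using \<nu>' by blast+
    \<comment> \<open>Commodity \<open>i\<close> keeps a part of its own decomposition, which gives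
      conformity in its edges and imbalances. The multiplicities add up to \<open>h\<close>, which
      gives conformity in the totals.\<close>
    define g where "g i e = (\<Sum>v\<in>G. int (\<nu> v i) * v e)" for i e
    have mult_conf: "conf (int p * t) (int q * t)" if "p \<le> q" for p q t
      using that by (cases "t \<ge> 0") (auto simp: conf_def mult_right_mono mult_right_mono_neg mult_nonneg_nonpos)
    have 1: "conf (g i e) (d i e)" if "i < M" "e < m" for i e
      unfolding g_def
      by (rule conf_sum[where f = "\<lambda>v. int (\<mu> i v) * v e"]) (use that \<mu>(1,2) \<nu>(1) fin mult_conf in auto)
    have 2: "conf (dot m (A r) (g i)) (dot m (A r) (d i))" if "i < M" "r < n" for i r
      unfolding g_def dot_sum
      by (rule conf_sum[where f = "\<lambda>v. int (\<mu> i v) * dot m (A r) v"]) (use that \<mu>(3,4) \<nu>(1) fin mult_conf in auto)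
    have sum_g: "(\<Sum>i<M. g i e) = (\<Sum>v\<in>G. int (h v) * v e)" for e
      unfolding g_def by (subst sum.swap) (simp add: \<nu>(2)[symmetric] sum_distrib_right)
    have sum_d: "(\<Sum>i<M. d i e) = (\<Sum>v\<in>G. int (l v) * v e)" if "e < m" for e
      using that unfolding l_def by (subst sum.cong[OF refl \<mu>(1)]) (simp_all add: sum.swap[of _ G] sum_distrib_right)
    have 3: "conf (\<Sum>i<M. g i e) (\<Sum>i<M. d i e)" if "e < m" for e
      unfolding sum_g sum_d[OF that] by (rule hY[OF that])
    have "size_of M m g \<le> (\<Sum>i<M. \<Sum>v\<in>G. int (\<nu> v i) * (\<Sum>e<m. \<bar>v e\<bar>))"
      unfolding size_of_def
    proof (rule sum_mono)
      fix i
      have "(\<Sum>e<m. \<bar>g i e\<bar>) \<le> (\<Sum>e<m. \<Sum>v\<in>G. int (\<nu> v i) * \<bar>v e\<bar>)"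
        unfolding g_def by (intro sum_mono order_trans[OF sum_abs]) (simp add: abs_mult)
      also have "\<dots> = (\<Sum>v\<in>G. int (\<nu> v i) * (\<Sum>e<m. \<bar>v e\<bar>))"
        by (subst sum.swap) (simp add: sum_distrib_left)
      finally show "(\<Sum>e<m. \<bar>g i e\<bar>) \<le> (\<Sum>v\<in>G. int (\<nu> v i) * (\<Sum>e<m. \<bar>v e\<bar>))" .
    qed
    also have "\<dots> = size h"
      unfolding size_def by (subst sum.swap) (simp add: \<nu>(2)[symmetric] sum_distrib_right)
    also have "\<dots> \<le> (\<Sum>h\<in>H. size h)" using H(2) h(1) size_nonneg by (intro member_le_sum) auto
    finally have 4: "size_of M m g \<le> int K" by (simp add: K_def)
    obtain v where v: "v \<in> G" "0 < h v" using H(1) h(1) by blast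
    then have "\<exists>i<M. 0 < \<nu> v i" using \<nu>(2)[OF v(1)] by (auto intro: ccontr)
    then obtain i where i: "i < M" "0 < \<nu> v i" by blast
    obtain e where e: "e < m" "v e \<noteq> 0" using test_setD(2)[OF G v(1)] by blast
    have "g i e \<noteq> 0"
    proof
      assume z: "g i e = 0"
      \<comment> \<open>All summands of \<open>g i e\<close> have the sign of \<open>d i e\<close>,
        so their sum vanishes only if each of them does.\<close>
      have c: "conf (int (\<nu> w i) * w e) (d i e)" if "w \<in> G" for w
        using conf_trans[OF mult_conf[OF \<nu>(1)[OF that i(1)]] \<mu>(2)[OF e(1) that]] .
      have "(\<forall>w\<in>G. 0 \<le> int (\<nu> w i) * w e) \<or> (\<forall>w\<in>G. 0 \<le> - (int (\<nu> w i) * w e))"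
        using c by (cases "d i e \<ge> 0") (fastforce simp: conf_def)+
      then have "int (\<nu> v i) * v e = 0"
      proof
        assume "\<forall>w\<in>G. 0 \<le> int (\<nu> w i) * w e"
        then show ?thesis using z v(1) fin unfolding g_def by (subst (asm) sum_nonneg_eq_0_iff) auto
      next
        assume *: "\<forall>w\<in>G. 0 \<le> - (int (\<nu> w i) * w e)"
        have "(\<Sum>w\<in>G. - (int (\<nu> w i) * w e)) = 0" using z unfolding g_def sum_negf by simp
        then show ?thesis using * v(1) fin by (subst (asm) sum_nonneg_eq_0_iff) auto
      qed
      then show False using i(2) e(2) by simp
    qed
    then have "nonzero M m g" unfolding nonzero_def using i(1) e(1) by blast
    then show ?thesis using 1 2 3 4 unfolding conf_move_def by blast
  qed
  then show ?thesis unfolding pieces_bound_def by blast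
qed

section \<open>The penalty function\<close>

text \<open>Convexity in one variable: for increments of equal sign, the second one costs at least
  as much after the first as it does alone.\<close>

lemma superadditive_abs: "\<bar>t + a - s\<bar> + \<bar>t + b - s\<bar> \<le> \<bar>t - s\<bar> + \<bar>t + a + b - s\<bar>"
  if "0 \<le> a \<and> 0 \<le> b \<or> a \<le> 0 \<and> b \<le> 0" for a b s t :: int
  using that by linarith

lemma superadditive_max: "max 0 (t + a - s) + max 0 (t + b - s) \<le> max 0 (t - s) + max 0 (t + a + b - s)"
  if "0 \<le> a \<and> 0 \<le> b \<or> a \<le> 0 \<and> b \<le> 0" for a b s t :: int
  using that by linarith

definition agree_sign :: "int \<Rightarrow> int \<Rightarrow> bool" where
  "agree_sign a b \<longleftrightarrow> 0 \<le> a \<and> 0 \<le> b \<or> a \<le> 0 \<and> b \<le> 0"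

lemma abs_le_size_of: "i < M \<Longrightarrow> e < m \<Longrightarrow> \<bar>g i e\<bar> \<le> size_of M m g"
proof -
  assume "i < M" "e < m"
  then have "\<bar>g i e\<bar> \<le> (\<Sum>e<m. \<bar>g i e\<bar>)" by (intro member_le_sum) auto
  also have "\<dots> \<le> size_of M m g"
    unfolding size_of_def using \<open>i < M\<close> by (intro member_le_sum[of i]) (auto intro: sum_nonneg)
  finally show ?thesis .
qed

definition nonneg_on :: "nat \<Rightarrow> nat \<Rightarrow> array \<Rightarrow> bool" where
  "nonneg_on M m x \<longleftrightarrow> (\<forall>i<M. \<forall>e<m. 0 \<le> x i e)"

lemma nonneg_onD: "nonneg_on M m x \<Longrightarrow> i < M \<Longrightarrow> e < m \<Longrightarrow> 0 \<le> x i e"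
  by (simp add: nonneg_on_def)

text \<open>Nonnegative circulations: the integer points of the recession cone of the flows of one
  commodity.\<close>

definition ray :: "nat \<Rightarrow> nat \<Rightarrow> array \<Rightarrow> vector \<Rightarrow> bool" where
  "ray m n A v \<longleftrightarrow> (\<forall>e<m. 0 \<le> v e) \<and> (\<forall>r<n. dot m (A r) v = 0)"

text \<open>\<open>w l e\<close> stands for the scaled product of probability and penalty cost,
  \<open>W\<close> for the price of a unit of violated flow conservation. As \<open>w\<close> is
  nonnegative, the smallest admissible penalty is best, and this is the positive part in
  \<open>overload\<close>.\<close>

locale mcf =
  fixes M N m n :: nat and A b c u w :: array and W :: int
  assumes W_nonneg: "0 \<le> W" and w_nonneg: "\<And>l e. l < N \<Longrightarrow> e < m \<Longrightarrow> 0 \<le> w l e"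
begin

definition flow_cost :: "array \<Rightarrow> int" where
  "flow_cost x = (\<Sum>i<M. dot m (c i) (x i))"

text \<open>Flow conservation is penalised rather than imposed, so that \<open>0\<close> is a starting point and feasibility
  is decided by the same minimisation.\<close>

definition imbalance :: "array \<Rightarrow> int" where
  "imbalance x = (\<Sum>i<M. \<Sum>r<n. \<bar>dot m (A r) (x i) - b i r\<bar>)"

definition overload :: "array \<Rightarrow> int" where
  "overload x = (\<Sum>l<N. \<Sum>e<m. w l e * max 0 ((\<Sum>i<M. x i e) - u l e))"

definition Phi :: "array \<Rightarrow> int" where
  "Phi x = flow_cost x + W * imbalance x + overload x"

lemma Phi_cong: "(\<And>i e. i < M \<Longrightarrow> e < m \<Longrightarrow> x i e = y i e) \<Longrightarrow> Phi x = Phi y"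
  unfolding Phi_def flow_cost_def imbalance_def overload_def dot_def by simp

definition shift :: "array \<Rightarrow> array \<Rightarrow> nat \<Rightarrow> nat \<Rightarrow> int" where
  "shift x y = (\<lambda>i e. x i e + y i e)"

lemma dot_shift: "dot m a (shift x y i) = dot m a (x i) + dot m a (y i)"
  unfolding shift_def by (rule dot_add)

lemma Phi_superadditive:
  assumes "\<And>i r. i < M \<Longrightarrow> r < n \<Longrightarrow> agree_sign (dot m (A r) (y i)) (dot m (A r) (z i))"
    and "\<And>e. e < m \<Longrightarrow> agree_sign (\<Sum>i<M. y i e) (\<Sum>i<M. z i e)"
  shows "Phi (shift x y) + Phi (shift x z) \<le> Phi x + Phi (shift (shift x y) z)"
proof -
  have "flow_cost (shift x y) + flow_cost (shift x z) = flow_cost x + flow_cost (shift (shift x y) z)"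
    by (simp add: flow_cost_def dot_shift sum.distrib)
  moreover have "imbalance (shift x y) + imbalance (shift x z) \<le> imbalance x + imbalance (shift (shift x y) z)"
    unfolding imbalance_def sum.distrib[symmetric] dot_shift
    using assms(1) by (intro sum_mono superadditive_abs) (auto simp: agree_sign_def)
  then have "W * imbalance (shift x y) + W * imbalance (shift x z) \<le> W * imbalance x + W * imbalance (shift (shift x y) z)"
    using W_nonneg by (simp add: mult_left_mono flip: distrib_left)
  moreover have "overload (shift x y) + overload (shift x z) \<le> overload x + overload (shift (shift x y) z)"
    unfolding overload_def sum.distrib[symmetric] distrib_left[symmetric] shift_def
  proof (intro sum_mono mult_left_mono)
    fix l e assume "l \<in> {..<N}" "e \<in> {..<m}"
    then show "0 \<le> w l e" using w_nonneg by simp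
    show "max 0 ((\<Sum>i<M. x i e + y i e) - u l e) + max 0 ((\<Sum>i<M. x i e + z i e) - u l e) \<le>
      max 0 ((\<Sum>i<M. x i e) - u l e) + max 0 ((\<Sum>i<M. x i e + y i e + z i e) - u l e)"
      unfolding sum.distrib using assms(2)[of e] \<open>e \<in> {..<m}\<close>
      by (intro superadditive_max) (auto simp: agree_sign_def)
  qed
  ultimately show ?thesis unfolding Phi_def by linarith
qed

text \<open>Pieces conformal to one \<open>d\<close> agree in sign with each other and with their
  partial sums, so they can be added one at a time. Read with reversed signs, the gain of the sum is
  at most the sum of the separate gains.\<close>

lemma Phi_sum_superadditive:
  assumes "finite P" "\<And>p. p \<in> P \<Longrightarrow> conf_move M m n A (s p) d"
  shows "(\<Sum>p\<in>P. Phi (shift x (s p)) - Phi x) \<le> Phi (shift x (\<lambda>i e. \<Sum>p\<in>P. s p i e)) - Phi x"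
  using assms
proof (induction P)
  case empty
  show ?case by (simp add: shift_def)
next
  case (insert p P)
  define y where "y = (\<lambda>i e. \<Sum>p\<in>P. s p i e)"
  have sg: "agree_sign (\<Sum>q\<in>P. f q) (f p)"
    if "\<And>q. q \<in> insert p P \<Longrightarrow> conf (f q) t" for f :: "_ \<Rightarrow> int" and t
  proof (cases "0 \<le> t")
    case True
    then have "\<And>q. q \<in> insert p P \<Longrightarrow> 0 \<le> f q" using that by (fastforce simp: conf_def)
    then show ?thesis by (auto simp: agree_sign_def intro!: sum_nonneg)
  next
    case False
    then have "\<And>q. q \<in> insert p P \<Longrightarrow> f q \<le> 0" using that by (fastforce simp: conf_def)
    then show ?thesis by (auto simp: agree_sign_def intro!: sum_nonpos)
  qed
  have "Phi (shift x y) + Phi (shift x (s p)) \<le> Phi x + Phi (shift (shift x y) (s p))"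
  proof (rule Phi_superadditive)
    fix i r assume "i < M" "r < n"
    then show "agree_sign (dot m (A r) (y i)) (dot m (A r) (s p i))"
      unfolding y_def dot_sum[where k = "\<lambda>_. 1", unfolded mult_1] using insert.prems
      by (intro sg) (auto simp: conf_move_def)
  next
    fix e assume "e < m"
    then show "agree_sign (\<Sum>i<M. y i e) (\<Sum>i<M. s p i e)"
      unfolding y_def using insert.prems
      by (subst sum.swap, intro sg) (auto simp: conf_move_def)
  qed
  moreover have "shift (shift x y) (s p) = shift x (\<lambda>i e. \<Sum>p\<in>insert p P. s p i e)"
    unfolding y_def shift_def using insert.hyps by (simp add: algebra_simps)
  ultimately show ?case using insert unfolding y_def[symmetric] by simp
qed

section \<open>Augmenting steps inside a box\<close>

definition in_box :: "int \<Rightarrow> array \<Rightarrow> bool" where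
  "in_box B x \<longleftrightarrow> (\<forall>i<M. \<forall>e<m. 0 \<le> x i e \<and> x i e \<le> B)"

text \<open>Arrays are total functions; fixing the values outside the block makes the set
  finite.\<close>

definition moves :: "nat \<Rightarrow> array set" where
  "moves K = {g. (\<forall>i e. \<not> (i < M \<and> e < m) \<longrightarrow> g i e = 0) \<and> nonzero M m g \<and> size_of M m g \<le> int K}"

lemma finite_moves: "finite (moves K)"
proof -
  let ?f = "\<lambda>g :: nat \<Rightarrow> nat \<Rightarrow> int. \<lambda>p \<in> {..<M} \<times> {..<m}. g (fst p) (snd p)"
  have "inj_on ?f (moves K)"
  proof (rule inj_onI, intro ext)
    fix g h i e assume g: "g \<in> moves K" "h \<in> moves K" "?f g = ?f h"
    show "g i e = h i e"
    proof (cases "i < M \<and> e < m")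
      case True
      then show ?thesis using fun_cong[OF g(3), of "(i, e)"] by simp
    next
      case False
      then show ?thesis using g(1,2) by (auto simp: moves_def)
    qed
  qed
  moreover have "?f ` moves K \<subseteq> PiE ({..<M} \<times> {..<m}) (\<lambda>_. {-int K..int K})"
  proof
    fix h assume "h \<in> ?f ` moves K"
    then obtain g where g: "g \<in> moves K" "h = ?f g" by blast
    have "g i e \<in> {-int K..int K}" if "i < M" "e < m" for i e
      using abs_le_size_of[OF that, of g] g(1) by (auto simp: moves_def)
    then show "h \<in> PiE ({..<M} \<times> {..<m}) (\<lambda>_. {-int K..int K})" using g(2) by auto
  qed
  moreover have "finite (PiE ({..<M} \<times> {..<m}) (\<lambda>_. {-int K..int K}))" by (intro finite_PiE) auto
  ultimately show ?thesis by (meson finite_imageD finite_subset)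
qed

text \<open>This is \<open>conf_decomposition\<close> for whole arrays, with imbalances and totals
  among the coordinates. A piece granted by \<open>pieces_bound\<close> becomes a member of
  \<open>moves K\<close> once it is cut off outside the block.\<close>

lemma move_decomposition:
  assumes K: "pieces_bound m n A K"
  obtains \<alpha> :: "array \<Rightarrow> nat" where
    "\<And>i e. i < M \<Longrightarrow> e < m \<Longrightarrow> d i e = (\<Sum>g\<in>moves K. int (\<alpha> g) * g i e)"
    "\<And>g. g \<in> moves K \<Longrightarrow> conf_move M m n A (\<lambda>i e. int (\<alpha> g) * g i e) d"
proof -
  let ?J = "Inl ` ({..<M} \<times> {..<m}) \<union> Inr ` (Inl ` ({..<M} \<times> {..<n}) \<union> Inr ` {..<m})"
  define \<phi> :: "array \<Rightarrow> (nat \<times> nat) + (nat \<times> nat) + nat \<Rightarrow> int" where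
    "\<phi> = (\<lambda>g. case_sum (\<lambda>p. g (fst p) (snd p))
      (case_sum (\<lambda>p. dot m (A (snd p)) (g (fst p))) (\<lambda>e. \<Sum>i<M. g i e)))"
  have conf_iff: "(\<forall>j\<in>?J. conf (\<phi> g j) (\<phi> d j)) \<longleftrightarrow> conf_move M m n A g d" for g d
    unfolding \<phi>_def conf_move_def ball_Un ball_simps(9) sum.case by auto
  have "\<exists>\<alpha> :: array \<Rightarrow> nat. \<forall>j\<in>?J. \<phi> d j = (\<Sum>g\<in>moves K. int (\<alpha> g) * \<phi> g j) \<and>
      (\<forall>g\<in>moves K. conf (int (\<alpha> g) * \<phi> g j) (\<phi> d j))"
  proof (rule conf_decomposition[where \<phi> = \<phi> and G = "moves K" and J = ?J and d = d])
    show "\<exists>z. \<forall>j\<in>?J. \<phi> z j = \<phi> x j - \<phi> y j" for x y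
      by (rule exI[of _ "\<lambda>i e. x i e - y i e"]) (auto simp: \<phi>_def dot_diff sum_subtractf)
    fix d :: array assume "\<exists>j\<in>?J. \<phi> d j \<noteq> 0"
    then have "nonzero M m d"
      unfolding nonzero_def
    proof (rule contrapos_pp)
      assume *: "\<not> (\<exists>i<M. \<exists>e<m. d i e \<noteq> 0)"
      then have "dot m (A r) (d i) = 0" if "i < M" for r i
        unfolding dot_def using that by (intro sum.neutral) auto
      then show "\<not> (\<exists>j\<in>?J. \<phi> d j \<noteq> 0)" using * by (auto simp: \<phi>_def)
    qed
    then obtain g0 where g0: "nonzero M m g0" "conf_move M m n A g0 d" "size_of M m g0 \<le> int K"
      using K unfolding pieces_bound_def by blast
    define g where "g = (\<lambda>i e. if i < M \<and> e < m then g0 i e else 0)"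
    have d: "dot m (A r) (g i) = dot m (A r) (g0 i)" if "i < M" for i r
      using that by (intro dot_cong) (simp add: g_def)
    have "size_of M m g = size_of M m g0" by (simp add: size_of_def g_def)
    then have "g \<in> moves K" using g0(1,3) by (auto simp: moves_def g_def nonzero_def)
    moreover have "conf_move M m n A g d"
      using g0(2) d unfolding conf_move_def by (simp add: g_def)
    moreover obtain i e where "i < M" "e < m" "g0 i e \<noteq> 0" using g0(1) unfolding nonzero_def by blast
    then have "\<exists>j\<in>?J. \<phi> g j \<noteq> 0" by (intro bexI[of _ "Inl (i, e)"]) (auto simp: \<phi>_def g_def)
    ultimately show "\<exists>g\<in>moves K. (\<exists>j\<in>?J. \<phi> g j \<noteq> 0) \<and> (\<forall>j\<in>?J. conf (\<phi> g j) (\<phi> d j))"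
      unfolding conf_iff by blast
  qed (use finite_moves in auto)
  then obtain \<alpha> :: "array \<Rightarrow> nat" where
    \<alpha>: "\<forall>j\<in>?J. \<phi> d j = (\<Sum>g\<in>moves K. int (\<alpha> g) * \<phi> g j) \<and>
      (\<forall>g\<in>moves K. conf (int (\<alpha> g) * \<phi> g j) (\<phi> d j))" ..
  show thesis
  proof (rule that[of \<alpha>])
    show "d i e = (\<Sum>g\<in>moves K. int (\<alpha> g) * g i e)" if "i < M" "e < m" for i e
      using bspec[OF \<alpha>, of "Inl (i, e)"] that unfolding \<phi>_def sum.case fst_conv snd_conv by blast
    fix g assume g: "g \<in> moves K"
    have "conf (\<phi> (\<lambda>i e. int (\<alpha> g) * g i e) j) (\<phi> d j)" if j: "j \<in> ?J" for j
    proof -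
      have "\<phi> (\<lambda>i e. int (\<alpha> g) * g i e) j = int (\<alpha> g) * \<phi> g j"
        using j by (auto simp: \<phi>_def dot_scale sum_distrib_left)
      moreover have "conf (int (\<alpha> g) * \<phi> g j) (\<phi> d j)" using bspec[OF \<alpha> j] g by blast
      ultimately show ?thesis by (simp only:)
    qed
    then show "conf_move M m n A (\<lambda>i e. int (\<alpha> g) * g i e) d"
      unfolding conf_iff[symmetric] by blast
  qed
qed

lemma conf_scale: "p \<le> q \<Longrightarrow> conf (int p * t) (int q * t)"
  by (cases "t \<ge> 0") (auto simp: conf_def mult_right_mono mult_right_mono_neg mult_nonneg_nonpos)

text \<open>Splitting the multiplicities into powers of two makes every piece a candidate step, so the best
  candidate closes at least the fraction \<open>1 / (card (moves K) * L)\<close> of the gap.\<close>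

lemma improving_step:
  assumes K: "pieces_bound m n A K" and x: "in_box B x" and z: "in_box B z" and L: "B < 2 ^ L" and less: "Phi z < Phi x"
  obtains g k where "g \<in> moves K" "k < L" "in_box B (shift x (\<lambda>i e. 2 ^ k * g i e))"
    "Phi x - Phi z \<le> int (card (moves K \<times> {..<L})) * (Phi x - Phi (shift x (\<lambda>i e. 2 ^ k * g i e)))"
proof -
  define d where "d i e = z i e - x i e" for i e
  obtain \<alpha> :: "array \<Rightarrow> nat" where
    \<alpha>: "\<And>i e. i < M \<Longrightarrow> e < m \<Longrightarrow> d i e = (\<Sum>g\<in>moves K. int (\<alpha> g) * g i e)"
    "\<And>g. g \<in> moves K \<Longrightarrow> conf_move M m n A (\<lambda>i e. int (\<alpha> g) * g i e) d"
    using move_decomposition[OF K, of d] by blast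
  define P where "P = {p \<in> moves K \<times> {..<L}. bit (\<alpha> (fst p)) (snd p)}"
  define s where "s p = (\<lambda>i e. 2 ^ snd p * fst p i e)" for p :: "array \<times> nat"
  have finP: "finite P" using finite_moves by (simp add: P_def)
  \<comment> \<open>A nonzero entry of \<open>g\<close>, taken \<open>\<alpha> g\<close> times, is
    still conformal to an entry of \<open>d\<close>, and the entries of \<open>d\<close> are at most
    \<open>B\<close> in absolute value. Hence \<open>L\<close> binary digits suffice.\<close>
  have small: "\<alpha> g < 2 ^ L" if g: "g \<in> moves K" for g
  proof -
    obtain i e where ie: "i < M" "e < m" "g i e \<noteq> 0" using g by (auto simp: moves_def nonzero_def)
    have "conf (int (\<alpha> g) * g i e) (d i e)" using \<alpha>(2)[OF g] ie by (auto simp: conf_move_def)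
    then have "int (\<alpha> g) * \<bar>g i e\<bar> \<le> \<bar>d i e\<bar>" by (auto simp: conf_def abs_mult)
    moreover have "int (\<alpha> g) * 1 \<le> int (\<alpha> g) * \<bar>g i e\<bar>" using ie by (intro mult_left_mono) auto
    moreover have "\<bar>d i e\<bar> \<le> B" using x z ie by (fastforce simp: in_box_def d_def)
    ultimately have "int (\<alpha> g) < 2 ^ L" using L by linarith
    then show ?thesis by (metis of_nat_less_numeral_power_cancel_iff)
  qed
  have conf_s: "conf_move M m n A (s p) d" if p: "p \<in> P" for p
  proof -
    obtain g k where gk: "p = (g, k)" "g \<in> moves K" "bit (\<alpha> g) k" using p by (auto simp: P_def)
    have "2 ^ k \<le> \<alpha> g"
      using gk(3) by (metis bit_iff_odd div_less even_zero not_le)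
    then have c: "conf (2 ^ k * t) (int (\<alpha> g) * t)" for t using conf_scale[of "2 ^ k" "\<alpha> g" t] by simp
    show ?thesis
      using \<alpha>(2)[OF gk(2)] unfolding conf_move_def s_def gk(1) fst_conv snd_conv dot_scale sum_distrib_left[symmetric]
      using c conf_trans by blast
  qed
  have "(\<Sum>p\<in>P. s p i e) = d i e" if "i < M" "e < m" for i e
  proof -
    have "(\<Sum>p\<in>P. s p i e) = (\<Sum>p\<in>moves K \<times> {..<L}. if bit (\<alpha> (fst p)) (snd p) then s p i e else 0)"
      unfolding P_def using finite_moves by (intro sum.inter_filter) auto
    also have "\<dots> = (\<Sum>g\<in>moves K. \<Sum>k<L. if bit (\<alpha> g) k then 2 ^ k * g i e else 0)"
      unfolding sum.cartesian_product by (rule sum.cong) (auto simp: s_def)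
    also have "\<dots> = (\<Sum>g\<in>moves K. int (\<alpha> g) * g i e)"
    proof (rule sum.cong[OF refl])
      fix g assume g: "g \<in> moves K"
      have "take_bit L (\<alpha> g) = \<alpha> g" using small[OF g] by (simp add: take_bit_nat_eq_self)
      then have "\<alpha> g = (\<Sum>k = 0..<L. push_bit k (of_bool (bit (\<alpha> g) k)))" using take_bit_sum by metis
      from arg_cong[OF this, of int] have "int (\<alpha> g) = (\<Sum>k<L. int (push_bit k (of_bool (bit (\<alpha> g) k))))"
        by (simp add: atLeast0LessThan)
      also have "\<dots> = (\<Sum>k<L. if bit (\<alpha> g) k then 2 ^ k else 0)"
        by (rule sum.cong) (auto simp: push_bit_eq_mult)
      finally have "int (\<alpha> g) = (\<Sum>k<L. if bit (\<alpha> g) k then 2 ^ k else 0)" .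
      then show "(\<Sum>k<L. if bit (\<alpha> g) k then 2 ^ k * g i e else 0) = int (\<alpha> g) * g i e"
        by (simp add: sum_distrib_right if_distrib[of "\<lambda>t. t * g i e"] cong: if_cong)
    qed
    finally show ?thesis using \<alpha>(1)[OF that] by simp
  qed
  then have "Phi (shift x (\<lambda>i e. \<Sum>p\<in>P. s p i e)) = Phi z"
    by (intro Phi_cong) (simp add: shift_def d_def)
  then have total: "Phi x - Phi z \<le> (\<Sum>p\<in>P. Phi x - Phi (shift x (s p)))"
    using Phi_sum_superadditive[of P s d x, OF finP conf_s] by (simp add: sum_subtractf)
  define C where "C = int (card (moves K \<times> {..<L}))"
  \<comment> \<open>Averaging over at most \<open>C\<close> pieces. If all failed, then
    \<open>C\<close> times each gain would, by integrality, be at most the gap minus 1, which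
    contradicts \<open>total\<close>.\<close>
  have "\<exists>p\<in>P. Phi x - Phi z \<le> C * (Phi x - Phi (shift x (s p)))"
  proof (rule ccontr)
    assume neg: "\<not> ?thesis"
    have CP: "int (card P) \<le> C"
      unfolding C_def of_nat_le_iff P_def using finite_moves by (intro card_mono) auto
    have "P \<noteq> {}" using total less by auto
    then have "0 < card P" using finP by (simp add: card_gt_0_iff)
    then have C: "0 < C" using CP by simp
    have "C * (Phi x - Phi z) \<le> (\<Sum>p\<in>P. C * (Phi x - Phi (shift x (s p))))"
      using mult_left_mono[OF total, of C] C by (simp add: sum_distrib_left)
    also have "\<dots> \<le> (\<Sum>p\<in>P. Phi x - Phi z - 1)" using neg by (intro sum_mono) (auto simp: not_le)
    also have "\<dots> = int (card P) * (Phi x - Phi z - 1)" by simp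
    also have "\<dots> \<le> C * (Phi x - Phi z - 1)" using CP less by (intro mult_right_mono) auto
    finally show False using C by (simp add: algebra_simps)
  qed
  then obtain g k where gk: "(g, k) \<in> P" "Phi x - Phi z \<le> C * (Phi x - Phi (shift x (s (g, k))))" by auto
  \<comment> \<open>A piece conformal to \<open>z - x\<close> keeps every coordinate between those
    of \<open>x\<close> and \<open>z\<close>, and both lie in the box.\<close>
  have "in_box B (shift x (s (g, k)))"
    using conf_s[OF gk(1)] x z unfolding in_box_def conf_move_def shift_def conf_def d_def by fastforce
  then show thesis using that[of g k] gk unfolding C_def s_def by (auto simp: P_def)
qed

end

section \<open>Bounded minimisers and exactness of the imbalance penalty\<close>

context mcf
begin

definition single :: "nat \<Rightarrow> vector \<Rightarrow> nat \<Rightarrow> nat \<Rightarrow> int" where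
  "single j v = (\<lambda>i e. if i = j then v e else 0)"

lemma Phi_shift_single:
  assumes j: "j < M"
  shows "Phi (shift x (single j v)) - Phi x = dot m (c j) v +
    W * (\<Sum>r<n. \<bar>dot m (A r) (x j) + dot m (A r) v - b j r\<bar> - \<bar>dot m (A r) (x j) - b j r\<bar>) +
    (\<Sum>l<N. \<Sum>e<m. w l e * (max 0 ((\<Sum>i<M. x i e) + v e - u l e) - max 0 ((\<Sum>i<M. x i e) - u l e)))"
proof -
  have s: "dot m a (single j v i) = (if i = j then dot m a v else 0)" for a i
    by (simp add: single_def dot_def)
  have "flow_cost (shift x (single j v)) =
      (\<Sum>i<M. dot m (c i) (x i) + (if i = j then dot m (c j) v else 0))"
    unfolding flow_cost_def by (rule sum.cong) (auto simp: dot_shift s)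
  then have "flow_cost (shift x (single j v)) = flow_cost x + dot m (c j) v"
    using j by (simp add: flow_cost_def sum.distrib)
  moreover have "imbalance (shift x (single j v)) = (\<Sum>i<M. (\<Sum>r<n. \<bar>dot m (A r) (x i) - b i r\<bar>) +
      (if i = j then \<Sum>r<n. \<bar>dot m (A r) (x j) + dot m (A r) v - b j r\<bar> - \<bar>dot m (A r) (x j) - b j r\<bar> else 0))"
    unfolding imbalance_def by (rule sum.cong) (auto simp: dot_shift s sum_subtractf)
  then have "imbalance (shift x (single j v)) = imbalance x +
      (\<Sum>r<n. \<bar>dot m (A r) (x j) + dot m (A r) v - b j r\<bar> - \<bar>dot m (A r) (x j) - b j r\<bar>)"
    using j by (simp add: sum.distrib imbalance_def)
  moreover have "(\<Sum>i<M. shift x (single j v) i e) = (\<Sum>i<M. x i e) + v e" for e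
    using j by (simp add: shift_def single_def sum.distrib)
  then have "overload (shift x (single j v)) = overload x +
      (\<Sum>l<N. \<Sum>e<m. w l e * (max 0 ((\<Sum>i<M. x i e) + v e - u l e) - max 0 ((\<Sum>i<M. x i e) - u l e)))"
    by (simp add: overload_def right_diff_distrib sum_subtractf)
  ultimately show ?thesis by (simp add: Phi_def algebra_simps)
qed

definition abs_costs :: int where
  "abs_costs = (\<Sum>i<M. \<Sum>e<m. \<bar>c i e\<bar>)"

definition total_weight :: int where
  "total_weight = (\<Sum>l<N. \<Sum>e<m. w l e)"

lemma abs_dot_cost_le:
  assumes "i < M" "\<And>e. e < m \<Longrightarrow> \<bar>v e\<bar> \<le> R"
  shows "\<bar>dot m (c i) v\<bar> \<le> R * abs_costs"
proof -
  have "\<bar>dot m (c i) v\<bar> \<le> (\<Sum>e<m. \<bar>c i e\<bar> * \<bar>v e\<bar>)"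
    unfolding dot_def by (rule order_trans[OF sum_abs]) (simp add: abs_mult)
  also have "\<dots> \<le> (\<Sum>e<m. \<bar>c i e\<bar> * R)" using assms(2) by (intro sum_mono mult_left_mono) auto
  also have "\<dots> = R * (\<Sum>e<m. \<bar>c i e\<bar>)" by (simp add: sum_distrib_left mult.commute)
  also have "\<dots> \<le> R * abs_costs"
  proof (cases "m = 0")
    case True
    then show ?thesis unfolding abs_costs_def by simp
  next
    case False
    then have "0 \<le> R" using assms(2)[of 0] by simp
    then show ?thesis unfolding abs_costs_def using assms(1)
      by (intro mult_left_mono member_le_sum[of i _ "\<lambda>i. \<Sum>e<m. \<bar>c i e\<bar>"]) (auto intro: sum_nonneg)
  qed
  finally show ?thesis .
qed

text \<open>The slope of \<open>Phi\<close> far out along a ray, where every scenario is overloaded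
  on each edge that the ray uses.\<close>

definition ray_cost :: "nat \<Rightarrow> vector \<Rightarrow> int" where
  "ray_cost i v = dot m (\<lambda>e. c i e + (\<Sum>l<N. w l e)) v"

lemma ray_cost_eq: "ray_cost i v = dot m (c i) v + (\<Sum>l<N. \<Sum>e<m. w l e * v e)"
  unfolding ray_cost_def dot_def
  by (subst sum.swap) (simp add: distrib_right sum.distrib sum_distrib_right)

text \<open>A piece occurring more than \<open>\<beta>\<close> times keeps all terms of \<open>Phi\<close> on one side of their kinks, so
  removing one copy changes \<open>Phi\<close> by a constant whose sign is known.\<close>

lemma remove_piece:
  assumes j: "j < M" and x: "nonneg_on M m x"
    and k: "\<beta> < int k" and v: "\<And>e. e < m \<Longrightarrow> conf (int k * v e) (x j e)"
      "\<And>r. r < n \<Longrightarrow> conf (int k * dot m (A r) v) (dot m (A r) (x j))"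
    and \<beta>: "0 \<le> \<beta>" "\<And>r. r < n \<Longrightarrow> \<bar>b j r\<bar> \<le> \<beta>" "\<And>l e. l < N \<Longrightarrow> e < m \<Longrightarrow> \<bar>u l e\<bar> \<le> \<beta>"
    and R: "\<And>e. e < m \<Longrightarrow> \<bar>v e\<bar> \<le> R" "R * abs_costs \<le> W"
    and no_ray: "ray m n A v \<Longrightarrow> 0 \<le> ray_cost j v"
  shows "\<And>e. e < m \<Longrightarrow> 0 \<le> v e \<and> v e \<le> x j e"
    and "Phi (shift x (single j (\<lambda>e. - v e))) \<le> Phi x"
proof -
  have large: "(\<beta> + 1) * t \<le> int k * t" if "0 \<le> t" for t
    using k that by (intro mult_right_mono) auto
  have kpos: "0 < int k" using k \<beta>(1) by simp
  have v0: "0 \<le> v e" "(\<beta> + 1) * v e \<le> x j e" if e: "e < m" for e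
  proof -
    have "0 \<le> int k * v e \<and> int k * v e \<le> x j e" using v(1)[OF e] nonneg_onD[OF x j e] by (auto simp: conf_def)
    then show "0 \<le> v e" "(\<beta> + 1) * v e \<le> x j e"
      using kpos large[of "v e"] by (auto simp: zero_le_mult_iff)
  qed
  show "0 \<le> v e \<and> v e \<le> x j e" if e: "e < m" for e
    using v0[OF e] mult_right_mono[of 1 "\<beta> + 1" "v e"] \<beta>(1) by simp
  have bal: "\<bar>dot m (A r) (x j) - dot m (A r) v - b j r\<bar> - \<bar>dot m (A r) (x j) - b j r\<bar> = - \<bar>dot m (A r) v\<bar>"
    if r: "r < n" for r
  proof -
    let ?t = "dot m (A r) v" and ?X = "dot m (A r) (x j)"
    consider "?t = 0" | "0 < ?t" | "?t < 0" by linarith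
    then show ?thesis
    proof cases
      case 2
      then have "0 < int k * ?t" using kpos by simp
      then have "int k * ?t \<le> ?X" using v(2)[OF r] by (auto simp: conf_def)
      then have "(\<beta> + 1) * ?t \<le> ?X" using large[of ?t] 2 by linarith
      moreover have "\<beta> * 1 \<le> \<beta> * ?t" using \<beta>(1) 2 by (intro mult_left_mono) auto
      ultimately show ?thesis using \<beta>(2)[OF r] 2 unfolding distrib_right by linarith
    next
      case 3
      then have "int k * ?t < 0" using kpos by (simp add: mult_less_0_iff)
      then have "?X \<le> int k * ?t" using v(2)[OF r] by (auto simp: conf_def)
      then have "?X \<le> (\<beta> + 1) * ?t" using large[of "- ?t"] 3 unfolding mult_minus_right by linarith
      moreover have "\<beta> * ?t \<le> \<beta> * - 1" using \<beta>(1) 3 by (intro mult_left_mono) auto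
      ultimately show ?thesis using \<beta>(2)[OF r] 3 unfolding distrib_right by linarith
    qed simp
  qed
  have over: "max 0 ((\<Sum>i<M. x i e) - v e - u l e) - max 0 ((\<Sum>i<M. x i e) - u l e) = - v e"
    if le: "l < N" "e < m" for l e
  proof (cases "v e = 0")
    case False
    have "x j e \<le> (\<Sum>i<M. x i e)" using j nonneg_onD[OF x] le by (intro member_le_sum) auto
    moreover have "\<beta> * 1 \<le> \<beta> * v e" using \<beta>(1) False v0(1)[OF le(2)] by (intro mult_left_mono) auto
    ultimately show ?thesis
      using v0[OF le(2)] \<beta>(3)[OF le] unfolding distrib_right by linarith
  qed simp
  have neg: "dot m a (\<lambda>e. - v e) = - dot m a v" for a
    using dot_scale[of m a "-1" v] by simp
  have "Phi (shift x (single j (\<lambda>e. - v e))) - Phi x =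
      - dot m (c j) v + W * (\<Sum>r<n. - \<bar>dot m (A r) v\<bar>) + (\<Sum>l<N. \<Sum>e<m. w l e * - v e)"
    unfolding Phi_shift_single[OF j] neg using bal over by simp
  also have "\<dots> = - (ray_cost j v + W * (\<Sum>r<n. \<bar>dot m (A r) v\<bar>))"
    by (simp add: ray_cost_eq sum_negf)
  also have "\<dots> \<le> 0"
  proof (cases "ray m n A v")
    case True
    then show ?thesis using no_ray by (simp add: ray_def)
  next
    case False
    then obtain r where r: "r < n" "dot m (A r) v \<noteq> 0" using v0(1) by (auto simp: ray_def)
    \<comment> \<open>Removing a vector that is not a ray lowers the imbalance by at least 1; at
      price \<open>W\<close> this pays for the flow cost that is lost, at most
      \<open>R * abs_costs\<close>.\<close>
    have "\<bar>dot m (A r) v\<bar> \<le> (\<Sum>r<n. \<bar>dot m (A r) v\<bar>)" using r(1) by (intro member_le_sum) auto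
    then have "1 \<le> (\<Sum>r<n. \<bar>dot m (A r) v\<bar>)" using r(2) by linarith
    then have "W * 1 \<le> W * (\<Sum>r<n. \<bar>dot m (A r) v\<bar>)" using W_nonneg by (intro mult_left_mono)
    moreover have "- (R * abs_costs) \<le> dot m (c j) v" using abs_dot_cost_le[of j v R, OF j R(1)] by (simp add: abs_le_iff)
    moreover have "0 \<le> (\<Sum>l<N. \<Sum>e<m. w l e * v e)" using v0(1) w_nonneg by (auto intro!: sum_nonneg)
    ultimately show ?thesis using R(2) unfolding ray_cost_eq by linarith
  qed
  finally show "Phi (shift x (single j (\<lambda>e. - v e))) \<le> Phi x" by simp
qed

text \<open>Removal of pieces stops because the sum of the entries drops. Afterwards every vector of
  \<open>G\<close> occurs at most \<open>\<beta>\<close> times in each commodity, with entries at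
  most \<open>R\<close>; this is where the size of the box comes from.\<close>

lemma bounded_representative:
  assumes G: "test_set m n A G" and R: "\<And>v e. v \<in> G \<Longrightarrow> e < m \<Longrightarrow> \<bar>v e\<bar> \<le> R" "0 \<le> R" "R * abs_costs \<le> W"
    and \<beta>: "0 \<le> \<beta>" "\<And>i r. i < M \<Longrightarrow> r < n \<Longrightarrow> \<bar>b i r\<bar> \<le> \<beta>" "\<And>l e. l < N \<Longrightarrow> e < m \<Longrightarrow> \<bar>u l e\<bar> \<le> \<beta>"
    and no_ray: "\<And>i v. i < M \<Longrightarrow> v \<in> G \<Longrightarrow> ray m n A v \<Longrightarrow> 0 \<le> ray_cost i v"
    and x: "nonneg_on M m x"
  shows "\<exists>y. in_box (int (card G) * (\<beta> * R)) y \<and> Phi y \<le> Phi x"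
  using x
proof (induction "nat (\<Sum>i<M. \<Sum>e<m. x i e)" arbitrary: x rule: less_induct)
  case less
  have "\<forall>i. \<exists>\<mu>. decomposes m n A G \<mu> (x i)" using test_set_decomposition[OF G] by blast
  from choice[OF this] obtain \<mu> where "\<forall>i. decomposes m n A G (\<mu> i) (x i)" ..
  then have \<mu>': "decomposes m n A G (\<mu> i) (x i)" for i by blast
  note \<mu> = decomposesD[OF \<mu>']
  show ?case
  proof (cases "\<exists>j<M. \<exists>v\<in>G. \<beta> < int (\<mu> j v)")
    case True
    then obtain j v where jv: "j < M" "v \<in> G" "\<beta> < int (\<mu> j v)" by blast
    define y where "y = shift x (single j (\<lambda>e. - v e))"
    have c: "\<And>e. e < m \<Longrightarrow> conf (int (\<mu> j v) * v e) (x j e)"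
      "\<And>r. r < n \<Longrightarrow> conf (int (\<mu> j v) * dot m (A r) v) (dot m (A r) (x j))"
      using \<mu>(2,4) jv(2) by blast+
    note remove = remove_piece[of j x \<beta> "\<mu> j v" v R, OF jv(1) less.prems jv(3) c \<beta>(1) \<beta>(2)[OF jv(1)] \<beta>(3)
        R(1)[OF jv(2)] R(3) no_ray[OF jv(1,2)]]
    have v: "\<And>e. e < m \<Longrightarrow> 0 \<le> v e \<and> v e \<le> x j e" and Phi: "Phi y \<le> Phi x"
      unfolding y_def using remove by blast+
    have y: "y i e = (if i = j then x i e - v e else x i e)" for i e
      by (simp add: y_def shift_def single_def)
    have y0: "0 \<le> y i e" if "i < M" "e < m" for i e
      using v[OF that(2)] nonneg_onD[OF less.prems that] by (simp add: y)
    obtain e0 where e0: "e0 < m" "v e0 \<noteq> 0" using test_setD(2)[OF G jv(2)] by blast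
    have "(\<Sum>i<M. \<Sum>e<m. y i e) < (\<Sum>i<M. \<Sum>e<m. x i e)"
    proof (rule sum_strict_mono_ex1)
      show "\<forall>i\<in>{..<M}. (\<Sum>e<m. y i e) \<le> (\<Sum>e<m. x i e)" using v by (auto simp: y intro!: sum_mono)
      have "(\<Sum>e<m. y j e) < (\<Sum>e<m. x j e)"
      proof (rule sum_strict_mono_ex1)
        show "\<forall>e\<in>{..<m}. y j e \<le> x j e" using v by (auto simp: y)
        show "\<exists>e\<in>{..<m}. y j e < x j e" using v[OF e0(1)] e0 by (intro bexI[of _ e0]) (auto simp: y)
      qed simp
      then show "\<exists>i\<in>{..<M}. (\<Sum>e<m. y i e) < (\<Sum>e<m. x i e)" using jv(1) by blast
    qed auto
    then have "nat (\<Sum>i<M. \<Sum>e<m. y i e) < nat (\<Sum>i<M. \<Sum>e<m. x i e)"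
      by (subst nat_less_eq_zless) (auto intro!: sum_nonneg y0)
    moreover have "nonneg_on M m y" using y0 by (simp add: nonneg_on_def)
    ultimately show ?thesis using less.hyps[of y] Phi by fastforce
  next
    case False
    have "x i e \<le> int (card G) * (\<beta> * R)" if "i < M" "e < m" for i e
    proof -
      have "x i e = (\<Sum>v\<in>G. int (\<mu> i v) * v e)" using \<mu>(1)[OF that(2)] .
      also have "\<dots> \<le> (\<Sum>v\<in>G. \<beta> * R)"
      proof (rule sum_mono)
        fix v assume v: "v \<in> G"
        have "int (\<mu> i v) * v e \<le> int (\<mu> i v) * R" using R(1)[OF v that(2)] by (intro mult_left_mono) auto
        moreover have "int (\<mu> i v) \<le> \<beta>" using False that(1) v not_less by blast
        then have "int (\<mu> i v) * R \<le> \<beta> * R" using R(2) by (intro mult_right_mono)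
        ultimately show "int (\<mu> i v) * v e \<le> \<beta> * R" by simp
      qed
      finally show ?thesis by simp
    qed
    then show ?thesis using nonneg_onD[OF less.prems] by (intro exI[of _ x]) (auto simp: in_box_def)
  qed
qed

definition balanced :: "array \<Rightarrow> bool" where
  "balanced x \<longleftrightarrow> (\<forall>i<M. \<forall>r<n. dot m (A r) (x i) = b i r)"

text \<open>If a minimiser \<open>x\<close> violated a row, some test vector in the decomposition of
  \<open>y - x\<close> would move that row. By conformity it brings every row closer to
  \<open>b\<close> and keeps \<open>x\<close> nonnegative. It lowers the imbalance by at least 1 and
  raises costs and penalties by at most \<open>R * (abs_costs + total_weight)\<close>, which is less
  than \<open>W\<close>.\<close>

lemma exact_penalty:
  assumes G: "test_set m n A G" and R: "\<And>v e. v \<in> G \<Longrightarrow> e < m \<Longrightarrow> \<bar>v e\<bar> \<le> R" "R * (abs_costs + total_weight) < W"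
    and x: "nonneg_on M m x"
    and opt: "\<And>y. nonneg_on M m y \<Longrightarrow> Phi x \<le> Phi y"
    and y: "nonneg_on M m y" "balanced y"
  shows "balanced x"
  unfolding balanced_def
proof (intro allI impI, rule ccontr)
  fix j r0 assume j: "j < M" and r0: "r0 < n" "dot m (A r0) (x j) \<noteq> b j r0"
  define d where "d e = y j e - x j e" for e
  have Ad: "dot m (A r) d = b j r - dot m (A r) (x j)" if "r < n" for r
    using y(2) j that by (simp add: balanced_def d_def[abs_def] dot_diff)
  obtain \<mu> where "decomposes m n A G \<mu> d" using test_set_decomposition[OF G] by blast
  note \<mu> = decomposesD[OF this]
  have "dot m (A r0) d \<noteq> 0" using Ad r0 by simp
  then have "\<exists>v\<in>G. int (\<mu> v) * dot m (A r0) v \<noteq> 0"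
    unfolding \<mu>(3)[OF r0(1)] by (rule contrapos_np) (simp add: sum.neutral)
  then obtain v where v: "v \<in> G" "0 < \<mu> v" "dot m (A r0) v \<noteq> 0" by auto
  have conf1: "conf t s" if "conf (int (\<mu> v) * t) s" for t s
    using conf_trans[OF conf_scale[of 1 "\<mu> v" t] that] v(2) by simp
  have ve: "conf (v e) (d e)" if "e < m" for e by (rule conf1[OF \<mu>(2)[OF that v(1)]])
  have Av: "conf (dot m (A r) v) (b j r - dot m (A r) (x j))" if "r < n" for r
    using conf1[OF \<mu>(4)[OF that v(1)]] Ad[OF that] by simp
  have "Phi x \<le> Phi (shift x (single j v))"
  proof (rule opt, unfold nonneg_on_def, intro allI impI)
    fix i e assume ie: "i < M" "e < m"
    then show "0 \<le> shift x (single j v) i e"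
      using nonneg_onD[OF x ie] nonneg_onD[OF y(1) ie] ve[OF ie(2)] by (auto simp: shift_def single_def conf_def d_def)
  qed
  moreover have "dot m (c j) v \<le> R * abs_costs"
    using abs_dot_cost_le[of j v R, OF j R(1)[OF v(1)]] by (simp add: abs_le_iff)
  moreover have "(\<Sum>l<N. \<Sum>e<m. w l e * (max 0 ((\<Sum>i<M. x i e) + v e - u l e) - max 0 ((\<Sum>i<M. x i e) - u l e)))
      \<le> R * total_weight"
    unfolding total_weight_def sum_distrib_left
  proof (intro sum_mono)
    fix l e assume le: "l \<in> {..<N}" "e \<in> {..<m}"
    have "w l e * (max 0 ((\<Sum>i<M. x i e) + v e - u l e) - max 0 ((\<Sum>i<M. x i e) - u l e)) \<le> w l e * R"
      using w_nonneg le R(1)[OF v(1), of e] by (intro mult_left_mono) auto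
    then show "w l e * (max 0 ((\<Sum>i<M. x i e) + v e - u l e) - max 0 ((\<Sum>i<M. x i e) - u l e)) \<le> R * w l e"
      by (simp add: mult.commute)
  qed
  moreover have "(\<Sum>r<n. \<bar>dot m (A r) (x j) + dot m (A r) v - b j r\<bar> - \<bar>dot m (A r) (x j) - b j r\<bar>) \<le> - 1"
  proof -
    have tm: "\<bar>dot m (A r) (x j) + dot m (A r) v - b j r\<bar> - \<bar>dot m (A r) (x j) - b j r\<bar> = - \<bar>dot m (A r) v\<bar>"
      if "r < n" for r using Av[OF that] unfolding conf_def by linarith
    have "\<bar>dot m (A r0) v\<bar> \<le> (\<Sum>r<n. \<bar>dot m (A r) v\<bar>)" using r0(1) by (intro member_le_sum) auto
    then show ?thesis using tm v(3) by (simp add: sum_negf)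
  qed
  then have "W * (\<Sum>r<n. \<bar>dot m (A r) (x j) + dot m (A r) v - b j r\<bar> - \<bar>dot m (A r) (x j) - b j r\<bar>) \<le> W * - 1"
    using W_nonneg by (intro mult_left_mono)
  moreover have "R * abs_costs + R * total_weight < W" using R(2) by (simp only: distrib_left)
  ultimately show False
    using Phi_shift_single[OF j, of x v] by linarith
qed

lemma imbalance_nonneg: "0 \<le> imbalance x"
  unfolding imbalance_def by (intro sum_nonneg) simp

lemma overload_nonneg: "0 \<le> overload x"
  unfolding overload_def by (intro sum_nonneg mult_nonneg_nonneg) (simp_all add: w_nonneg)

text \<open>A computable lower bound for the unknown minimum; it controls the initial gap and
  thereby the number of rounds.\<close>

lemma Phi_box_ge: assumes "in_box B x" shows "- (B * abs_costs) \<le> Phi x"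
proof -
  have "- (B * (\<Sum>e<m. \<bar>c i e\<bar>)) \<le> dot m (c i) (x i)" if "i < M" for i
    unfolding dot_def sum_distrib_left sum_negf[symmetric]
  proof (rule sum_mono)
    fix e assume "e \<in> {..<m}"
    then have "0 \<le> x i e" "x i e \<le> B" using assms that by (auto simp: in_box_def)
    then have "- (\<bar>c i e\<bar> * B) \<le> - (\<bar>c i e\<bar> * x i e)" by (simp add: mult_left_mono)
    also have "\<dots> \<le> c i e * x i e" using \<open>0 \<le> x i e\<close> by (simp add: abs_if mult_nonpos_nonneg)
    finally show "- (B * \<bar>c i e\<bar>) \<le> c i e * x i e" by (simp add: mult.commute)
  qed
  then have "- (B * abs_costs) \<le> flow_cost x"
    unfolding abs_costs_def flow_cost_def sum_distrib_left sum_negf[symmetric] by (intro sum_mono) auto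
  moreover have "0 \<le> W * imbalance x" using W_nonneg imbalance_nonneg by simp
  ultimately show ?thesis using overload_nonneg[of x] unfolding Phi_def by linarith
qed

end

text \<open>A step leaves at most the fraction \<open>1 - 1 / C\<close>, hence \<open>C\<close>
  steps leave at most \<open>1 / e\<close>, which is below one half. After \<open>C * B\<close>
  steps an integer that started below \<open>2 ^ B\<close> is below 1.\<close>

lemma geometric_decrease:
  fixes \<delta> :: vector
  assumes nonneg: "\<And>t. 0 \<le> \<delta> t" and dec: "\<And>t. \<delta> t \<le> int C * (\<delta> t - \<delta> (Suc t))"
    and start: "\<delta> 0 < 2 ^ B"
  shows "\<delta> (C * B) = 0"
proof (cases "C = 0")
  case True
  then show ?thesis using dec[of 0] nonneg[of 0] by simp
next
  case False
  define q where "q = 1 - 1 / real C"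
  have q: "0 \<le> q" using False by (simp add: q_def)
  have step: "real_of_int (\<delta> (Suc t)) \<le> q * real_of_int (\<delta> t)" for t
  proof -
    have "real_of_int (\<delta> t) \<le> real_of_int (int C * (\<delta> t - \<delta> (Suc t)))"
      using dec[of t] by (simp only: of_int_le_iff)
    then have "real_of_int (\<delta> t) \<le> real C * (real_of_int (\<delta> t) - real_of_int (\<delta> (Suc t)))" by simp
    then have "real_of_int (\<delta> t) / real C \<le> real_of_int (\<delta> t) - real_of_int (\<delta> (Suc t))"
      using False by (simp add: divide_le_eq mult.commute)
    then show ?thesis by (simp add: q_def algebra_simps)
  qed
  have pow: "real_of_int (\<delta> t) \<le> q ^ t * real_of_int (\<delta> 0)" for t
  proof (induction t)
    case (Suc t)
    have "real_of_int (\<delta> (Suc t)) \<le> q * (q ^ t * real_of_int (\<delta> 0))"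
      using step[of t] mult_left_mono[OF Suc q] by linarith
    then show ?case by simp
  qed simp
  have "q \<le> exp (- (1 / real C))" using exp_ge_add_one_self[of "- (1 / real C)"] by (simp add: q_def)
  then have "q ^ C \<le> exp (- (1 / real C)) ^ C" using q by (rule power_mono)
  also have "\<dots> = exp (- 1)" using False by (simp flip: exp_of_nat_mult)
  also have "\<dots> \<le> 1 / 2" using exp_ge_add_one_self[of 1] by (simp add: exp_minus field_simps)
  finally have "(q ^ C) ^ B \<le> (1 / 2) ^ B" using q by (intro power_mono) auto
  then have qB: "q ^ (C * B) \<le> 1 / 2 ^ B" by (simp add: power_mult power_one_over)
  have "real_of_int (\<delta> (C * B)) \<le> q ^ (C * B) * real_of_int (\<delta> 0)" by (rule pow)
  also have "\<dots> \<le> 1 / 2 ^ B * real_of_int (\<delta> 0)" using qB nonneg[of 0] by (intro mult_right_mono) auto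
  also have "\<dots> < 1"
  proof -
    have "real_of_int (\<delta> 0) < real_of_int (2 ^ B)" using start by (simp only: of_int_less_iff)
    then show ?thesis by simp
  qed
  finally show ?thesis using nonneg[of "C * B"] by simp
qed

section \<open>The augmentation program\<close>

type_synonym rows = "int list list"

definition entry :: "rows \<Rightarrow> nat \<Rightarrow> nat \<Rightarrow> int" where
  "entry X i e = elt (X ! i) e"

definition row_list :: "nat \<Rightarrow> nat \<Rightarrow> array \<Rightarrow> rows" where
  "row_list M m x = map (\<lambda>i. map (x i) [0..<m]) [0..<M]"

lemma length_row_list [simp]: "length (row_list M m x) = M"
  by (simp add: row_list_def)

lemma entry_row_list [simp]: "i < M \<Longrightarrow> e < m \<Longrightarrow> entry (row_list M m x) i e = x i e"
  by (simp add: entry_def row_list_def elt_def)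

lemma row_list_cong: "(\<And>i e. i < M \<Longrightarrow> e < m \<Longrightarrow> x i e = y i e) \<Longrightarrow> row_list M m x = row_list M m y"
  by (simp add: row_list_def)

definition total :: "rows \<Rightarrow> nat \<Rightarrow> int" where
  "total X e = (\<Sum>x\<leftarrow>X. elt x e)"

lemma ptime_total: "ptime X \<Longrightarrow> ptime (\<lambda>a. total (X a) e)"
  unfolding total_def by (intro ptime_intros) assumption

lemma total_entry: "total X e = (\<Sum>i<length X. entry X i e)"
  by (simp add: total_def entry_def sum_list_sum_nth atLeast0LessThan)

lemma sum_list_zip:
  "length xs = length ys \<Longrightarrow> (\<Sum>p\<leftarrow>zip xs ys. f p) = (\<Sum>i<length xs. f (xs ! i, ys ! i))"
  by (simp add: sum_list_sum_nth atLeast0LessThan)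

definition abs_sum :: "nat \<Rightarrow> rows \<Rightarrow> int" where
  "abs_sum m X = (\<Sum>x\<leftarrow>X. \<Sum>e\<leftarrow>[0..<m]. \<bar>elt x e\<bar>)"

lemma ptime_abs_sum: "ptime X \<Longrightarrow> ptime (\<lambda>a. abs_sum m (X a))"
  unfolding abs_sum_def by (intro ptime_intros) assumption

lemma abs_sum_entry: "abs_sum m X = (\<Sum>i<length X. \<Sum>e<m. \<bar>entry X i e\<bar>)"
  by (simp add: abs_sum_def entry_def sum_list_sum_nth atLeast0LessThan sum_list_upt)

definition flow_cost_list :: "nat \<Rightarrow> rows \<Rightarrow> rows \<Rightarrow> int" where
  "flow_cost_list m cs X = (\<Sum>p\<leftarrow>zip cs X. \<Sum>e\<leftarrow>[0..<m]. elt (fst p) e * elt (snd p) e)"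

definition imbalance_list :: "nat \<Rightarrow> nat \<Rightarrow> array \<Rightarrow> rows \<Rightarrow> rows \<Rightarrow> int" where
  "imbalance_list m n A bs X = (\<Sum>p\<leftarrow>zip bs X. \<Sum>r\<leftarrow>[0..<n].
     \<bar>(\<Sum>e\<leftarrow>[0..<m]. A r e * elt (snd p) e) - elt (fst p) r\<bar>)"

definition overload_list :: "nat \<Rightarrow> rows \<Rightarrow> rows \<Rightarrow> rows \<Rightarrow> int" where
  "overload_list m us ws X = (\<Sum>p\<leftarrow>zip us ws. \<Sum>e\<leftarrow>[0..<m]. elt (snd p) e * max 0 (total X e - elt (fst p) e))"

lemma ptime_flow_cost_list:
  assumes "ptime cs" "ptime X" shows "ptime (\<lambda>a. flow_cost_list m (cs a) (X a))"
  unfolding flow_cost_list_def by (intro ptime_intros assms)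

lemma ptime_imbalance_list:
  assumes "ptime bs" "ptime X" shows "ptime (\<lambda>a. imbalance_list m n A (bs a) (X a))"
  unfolding imbalance_list_def by (intro ptime_intros assms)

lemma ptime_overload_list:
  assumes "ptime us" "ptime ws" "ptime X" shows "ptime (\<lambda>a. overload_list m (us a) (ws a) (X a))"
  unfolding overload_list_def by (intro ptime_intros ptime_total ptime_comp[OF assms(3)] assms(1,2))

definition Phi_list :: "nat \<Rightarrow> nat \<Rightarrow> array \<Rightarrow> int \<Rightarrow> rows \<Rightarrow> rows \<Rightarrow>
    rows \<Rightarrow> rows \<Rightarrow> rows \<Rightarrow> int" where
  "Phi_list m n A W bs cs us ws X =
    flow_cost_list m cs X + W * imbalance_list m n A bs X + overload_list m us ws X"

lemma ptime_Phi_list: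
  assumes "ptime W" "ptime bs" "ptime cs" "ptime us" "ptime ws" "ptime X"
  shows "ptime (\<lambda>a. Phi_list m n A (W a) (bs a) (cs a) (us a) (ws a) (X a))"
  unfolding Phi_list_def
  by (intro ptime_add ptime_mult ptime_flow_cost_list ptime_imbalance_list ptime_overload_list assms)

definition madd :: "nat \<Rightarrow> rows \<Rightarrow> rows \<Rightarrow> rows" where
  "madd m X Y = map (\<lambda>p. map (\<lambda>e. elt (fst p) e + elt (snd p) e) [0..<m]) (zip X Y)"

lemma ptime_madd:
  assumes "ptime X" "ptime Y" shows "ptime (\<lambda>a. madd m (X a) (Y a))"
  unfolding madd_def by (intro ptime_intros assms)

lemma madd_row_list: "madd m (row_list M m x) (row_list M m y) = row_list M m (\<lambda>i e. x i e + y i e)"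
  by (rule nth_equalityI) (simp_all add: madd_def row_list_def elt_def)

section \<open>Enumeration of the moves\<close>

definition zero_rows :: "nat \<Rightarrow> 'a list \<Rightarrow> rows" where
  "zero_rows m bs = map (\<lambda>_. map (\<lambda>_. 0) [0..<m]) bs"

lemma ptime_zero_rows: "ptime bs \<Longrightarrow> ptime (\<lambda>a. zero_rows m (bs a))"
  unfolding zero_rows_def by (intro ptime_intros) assumption

lemma zero_rows_eq: "zero_rows m bs = row_list (length bs) m (\<lambda>_ _. 0)"
  by (rule nth_equalityI) (simp_all add: zero_rows_def row_list_def)

text \<open>All arrays with a single nonzero entry, 1 or -1. Edge and sign range over constants of
  the program, only the commodity over the input; the values in \<open>bs\<close> do not matter,
  just their number.\<close>

definition units :: "nat \<Rightarrow> 'a list \<Rightarrow> rows list" where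
  "units m bs = concat (map (\<lambda>i. map (\<lambda>es. map (\<lambda>j. map (\<lambda>e. if j = i then of_bool (e = fst es) * snd es else 0) [0..<m])
     (indices bs)) (List.product [0..<m] [1, -1])) (indices bs))"

lemma ptime_units:
  assumes "ptime bs" shows "ptime (\<lambda>a. units m (bs a))"
  unfolding units_def by (intro ptime_intros assms ptime_comp[OF assms])

lemma unit_in_units:
  assumes "i < length bs" "e < m" "s = 1 \<or> s = -1"
  shows "row_list (length bs) m (\<lambda>j f. if j = i then of_bool (f = e) * s else 0) \<in> set (units m bs)"
proof -
  have "row_list (length bs) m (\<lambda>j f. if j = i then of_bool (f = e) * s else 0) =
      map (\<lambda>j. map (\<lambda>f. if j = int i then of_bool (f = e) * s else 0) [0..<m]) (indices bs)"
    by (simp add: row_list_def indices_def)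
  also have "\<dots> = (\<lambda>es. map (\<lambda>j. map (\<lambda>f. if j = int i then of_bool (f = fst es) * snd es else 0) [0..<m]) (indices bs)) (e, s)"
    by simp
  also have "\<dots> \<in> set (units m bs)"
    unfolding units_def set_concat set_map using assms
    by (intro UN_I[OF imageI[of "int i"]]) (unfold set_map, (intro imageI)?, auto simp: indices_def)
  finally show ?thesis .
qed

text \<open>Sums of at most \<open>k\<close> unit arrays, with repetitions. The recursion is over a
  constant of the program, and for fixed \<open>k\<close> the length is polynomial in the number of
  commodities.\<close>

primrec moves_list :: "nat \<Rightarrow> 'a list \<Rightarrow> nat \<Rightarrow> rows list" where
  "moves_list m bs 0 = [zero_rows m bs]"
| "moves_list m bs (Suc k) = moves_list m bs k @ concat (map (\<lambda>g. map (\<lambda>y. madd m g y) (units m bs)) (moves_list m bs k))"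

lemma ptime_moves_list:
  assumes "ptime bs" shows "ptime (\<lambda>a. moves_list m (bs a) k)"
proof (induction k)
  case 0
  show ?case by (simp, intro ptime_Cons ptime_const ptime_zero_rows assms)
next
  case (Suc k)
  show ?case
    by (simp, intro ptime_append ptime_concat ptime_map ptime_madd ptime_units ptime_fst ptime_snd ptime_id
        Suc ptime_comp[OF assms])
qed

text \<open>Taking off a unit with the sign of a nonzero entry lowers the 1-norm by exactly
  1.\<close>

lemma moves_list_complete:
  "size_of (length bs) m g \<le> int k \<Longrightarrow> row_list (length bs) m g \<in> set (moves_list m bs k)"
proof (induction k arbitrary: g)
  case 0
  have "g i e = 0" if "i < length bs" "e < m" for i e
  proof -
    have "\<bar>g i e\<bar> \<le> (\<Sum>e<m. \<bar>g i e\<bar>)" using that by (intro member_le_sum) auto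
    also have "\<dots> \<le> size_of (length bs) m g"
      unfolding size_of_def using that by (intro member_le_sum[of i]) (auto intro: sum_nonneg)
    finally show ?thesis using 0 by simp
  qed
  then show ?case by (simp add: zero_rows_eq cong: row_list_cong)
next
  case (Suc k)
  show ?case
  proof (cases "\<exists>i<length bs. \<exists>e<m. g i e \<noteq> 0")
    case False
    then have "size_of (length bs) m g = 0" by (simp add: size_of_def)
    then show ?thesis using Suc.IH[of g] by simp
  next
    case True
    then obtain i e where ie: "i < length bs" "e < m" "g i e \<noteq> 0" by blast
    define s where "s = sgn (g i e)"
    define y where "y = (\<lambda>j f. if j = i then of_bool (f = e) * s else 0)"
    define h where "h = (\<lambda>j f. g j f - y j f)"
    have "\<bar>g j f\<bar> = \<bar>h j f\<bar> + (if j = i then of_bool (f = e) else 0)" for j f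
      using ie(3) by (auto simp: h_def y_def s_def sgn_if)
    then have "size_of (length bs) m g = (\<Sum>j<length bs. \<Sum>f<m. \<bar>h j f\<bar> + (if j = i then of_bool (f = e) else 0))"
      unfolding size_of_def by simp
    also have "\<dots> = (\<Sum>j<length bs. (\<Sum>f<m. \<bar>h j f\<bar>) + (if j = i then 1 else 0))"
      using ie(2) by (intro sum.cong) (auto simp: sum.distrib of_bool_def)
    also have "\<dots> = size_of (length bs) m h + 1" using ie(1) by (simp add: sum.distrib size_of_def)
    finally have "row_list (length bs) m h \<in> set (moves_list m bs k)" using Suc by simp
    moreover have "row_list (length bs) m y \<in> set (units m bs)"
      unfolding y_def by (rule unit_in_units) (use ie in \<open>auto simp: s_def sgn_if\<close>)
    moreover have "row_list (length bs) m g = madd m (row_list (length bs) m h) (row_list (length bs) m y)"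
      unfolding madd_row_list by (simp add: h_def)
    ultimately show ?thesis by auto
  qed
qed

lemma moves_list_shape:
  "X \<in> set (moves_list m bs k) \<Longrightarrow> \<exists>x. X = row_list (length bs) m x"
proof (induction k arbitrary: X)
  case 0
  then show ?case by (auto simp: zero_rows_eq)
next
  case (Suc k)
  have u: "\<exists>y. Y = row_list (length bs) m y" if Y: "Y \<in> set (units m bs)" for Y
  proof -
    obtain i f s where "Y = map (\<lambda>j. map (\<lambda>e. if j = i then of_bool (e = f) * s else 0) [0..<m]) (indices bs)"
      using Y by (auto simp: units_def)
    then show ?thesis
      by (intro exI[of _ "\<lambda>j e. if int j = i then of_bool (e = f) * s else 0"])
        (simp add: row_list_def indices_def)
  qed
  consider "X \<in> set (moves_list m bs k)" |
    G Y where "G \<in> set (moves_list m bs k)" "Y \<in> set (units m bs)" "X = madd m G Y"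
    using Suc.prems by auto
  then show ?case
  proof cases
    case 2
    obtain x y where "G = row_list (length bs) m x" "Y = row_list (length bs) m y"
      using 2 Suc.IH[of G] u[of Y] by blast
    then show ?thesis using 2(3) by (auto simp: madd_row_list)
  qed (rule Suc.IH)
qed

definition candidates :: "nat \<Rightarrow> 'a list \<Rightarrow> nat \<Rightarrow> int \<Rightarrow> rows list" where
  "candidates m bs K B = concat (map (\<lambda>g. map (\<lambda>p. map (\<lambda>r. map (\<lambda>t. p * t) r) g) (powers B)) (moves_list m bs K))"

lemma ptime_candidates:
  assumes "ptime bs" "ptime B" shows "ptime (\<lambda>a. candidates m (bs a) K (B a))"
  unfolding candidates_def by (intro ptime_intros ptime_moves_list assms ptime_comp[OF assms(2)])

lemma length_candidates: "length (candidates m bs K B) = length (moves_list m bs K) * length (powers B)"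
  unfolding candidates_def by (simp add: length_concat comp_def sum_list_triv)

lemma scale_row_list: "map (\<lambda>r. map (\<lambda>t. p * t) r) (row_list M m x) = row_list M m (\<lambda>i e. p * x i e)"
  by (simp add: row_list_def)

definition in_box_list :: "int \<Rightarrow> rows \<Rightarrow> bool" where
  "in_box_list B X \<longleftrightarrow> list_all (\<lambda>r. list_all (\<lambda>t. 0 \<le> t \<and> t \<le> B) r) X"

lemma ptime_in_box_list:
  assumes "ptime B" "ptime X" shows "ptime (\<lambda>a. in_box_list (B a) (X a))"
  unfolding in_box_list_def by (intro ptime_intros assms ptime_comp[OF assms(1)])

text \<open>The current point takes part in the minimisation, so no step increases \<open>f\<close>.
  Filtering by the box keeps the numbers short.\<close>

definition best_step :: "nat \<Rightarrow> (rows \<Rightarrow> int) \<Rightarrow> int \<Rightarrow> rows list \<Rightarrow> rows \<Rightarrow> rows" where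
  "best_step m f B Gs X = argmin f X (filter (in_box_list B) (map (madd m X) Gs))"

text \<open>Only the length of \<open>ticks\<close> matters: it is the number of candidate steps times the number of binary
  digits of a bound on the initial gap.\<close>

definition augment :: "nat \<Rightarrow> nat \<Rightarrow> array \<Rightarrow> nat \<Rightarrow> int \<Rightarrow> int \<Rightarrow>
    rows \<Rightarrow> rows \<Rightarrow> rows \<Rightarrow> rows \<Rightarrow> rows" where
  "augment m n A K W B bs cs us ws = (
    let Z = zero_rows m bs; Gs = candidates m bs K B;
      ticks = concat (map (\<lambda>_. powers (Phi_list m n A W bs cs us ws Z + B * abs_sum m cs)) Gs)
    in foldl (\<lambda>X _. best_step m (Phi_list m n A W bs cs us ws) B Gs X) Z ticks)"

lemma best_step_cases:
  "best_step m f B Gs X = X \<or> (\<exists>g\<in>set Gs. best_step m f B Gs X = madd m X g \<and> in_box_list B (madd m X g))"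
  using argmin_in[of f X "filter (in_box_list B) (map (madd m X) Gs)"] by (auto simp: best_step_def)

lemma ptime_augment:
  assumes W: "ptime W" and B: "ptime B" and bs: "ptime bs" and cs: "ptime cs" and us: "ptime us" and ws: "ptime ws"
  shows "ptime (\<lambda>a. augment m n A K (W a) (B a) (bs a) (cs a) (us a) (ws a))"
proof -
  have Gs: "ptime (\<lambda>a. candidates m (bs a) K (B a))" by (intro ptime_candidates bs B)
  obtain u where u: "\<And>a. sz (candidates m (bs a) K (B a)) \<le> poly u (sz a)"
    using ptime_size[OF Gs] by blast
  obtain v where v: "\<And>a. sz (B a) \<le> poly v (sz a)" using ptime_size[OF B] by blast
  show ?thesis
    unfolding augment_def Let_def
  proof (rule ptime_foldl)
    show "ptime (\<lambda>p. best_step m (Phi_list m n A (W (fst p)) (bs (fst p)) (cs (fst p)) (us (fst p)) (ws (fst p)))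
        (B (fst p)) (candidates m (bs (fst p)) K (B (fst p))) (fst (snd p)))"
      unfolding best_step_def
      by (intro ptime_argmin ptime_filter ptime_map ptime_Phi_list ptime_in_box_list ptime_madd ptime_fst ptime_snd ptime_id
          ptime_comp[OF W] ptime_comp[OF B] ptime_comp[OF bs] ptime_comp[OF cs] ptime_comp[OF us] ptime_comp[OF ws]
          ptime_comp[OF Gs])
    show "ptime (\<lambda>a. zero_rows m (bs a))" by (intro ptime_zero_rows bs)
    show "ptime (\<lambda>a. concat (map (\<lambda>_. powers (Phi_list m n A (W a) (bs a) (cs a) (us a) (ws a)
        (zero_rows m (bs a)) + B a * abs_sum m (cs a))) (candidates m (bs a) K (B a))))"
      by (intro ptime_concat ptime_map ptime_powers ptime_add ptime_mult ptime_abs_sum ptime_Phi_list ptime_zero_rows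
          ptime_fst ptime_id Gs
          ptime_comp[OF W] ptime_comp[OF B] ptime_comp[OF bs] ptime_comp[OF cs] ptime_comp[OF us] ptime_comp[OF ws])
    show "polyf (\<lambda>k. 1 + poly u k * (1 + (1 + m * (1 + poly v k))))" by (intro polyf_intros)
    fix a and X :: rows and x :: int
    let ?f = "Phi_list m n A (W a) (bs a) (cs a) (us a) (ws a)" and ?G = "candidates m (bs a) K (B a)"
    \<comment> \<open>An accepted point lies in the box, so its entries are no longer than
      \<open>B\<close>, whatever \<open>X\<close> was. This is the uniform bound that
      \<open>ptime_foldl\<close> asks for.\<close>
    have "sz (madd m X g) \<le> 1 + poly u (sz a) * (1 + (1 + m * (1 + poly v (sz a))))"
      if g: "g \<in> set ?G" "in_box_list (B a) (madd m X g)" for g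
    proof -
      have row: "sz r \<le> 1 + m * (1 + poly v (sz a))" if r: "r \<in> set (madd m X g)" for r
      proof -
        have "sz t \<le> poly v (sz a)" if "t \<in> set r" for t
        proof -
          have "\<bar>t\<bar> \<le> \<bar>B a\<bar>" using g(2) r that by (fastforce simp: in_box_list_def list_all_iff)
          then show ?thesis using int_length_mono v[of a] by (fastforce simp: sz_int)
        qed
        then have "sz r \<le> 1 + length r * (1 + poly v (sz a))" by (rule sz_list_bound)
        then show ?thesis using r by (auto simp: madd_def)
      qed
      then have "sz (madd m X g) \<le> 1 + length (madd m X g) * (1 + (1 + m * (1 + poly v (sz a))))"
        by (rule sz_list_bound)
      also have "\<dots> \<le> 1 + poly u (sz a) * (1 + (1 + m * (1 + poly v (sz a))))"
      proof -
        have "length (madd m X g) \<le> length g" by (simp add: madd_def)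
        also have "\<dots> \<le> poly u (sz a)" using length_le_sz[of g] sz_elem[OF g(1)] u[of a] by simp
        finally show ?thesis by (intro add_left_mono mult_right_mono) auto
      qed
      finally show ?thesis .
    qed
    then show "sz (best_step m ?f (B a) ?G X) \<le> max (sz X) (1 + poly u (sz a) * (1 + (1 + m * (1 + poly v (sz a)))))"
      using best_step_cases[of m ?f "B a" ?G X] by (auto simp: le_max_iff_disj)
  qed
qed

lemma elt_row_list: "i < M \<Longrightarrow> e < m \<Longrightarrow> elt (row_list M m x ! i) e = x i e"
  using entry_row_list[of i M e m x] by (simp add: entry_def)

lemma imbalance_list_eq:
  "imbalance_list m n A bs (row_list (length bs) m x) =
    (\<Sum>i<length bs. \<Sum>r<n. \<bar>dot m (A r) (x i) - entry bs i r\<bar>)"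
  unfolding imbalance_list_def
  by (simp add: sum_list_zip sum_list_upt entry_def dot_def elt_row_list)

locale int_instance =
  fixes m n :: nat and A :: array and W :: int and bs cs us ws :: rows
  assumes length_cs: "length cs = length bs" and length_ws: "length ws = length us"
    and W_ge: "0 \<le> W" and ws_ge: "\<And>l e. l < length us \<Longrightarrow> e < m \<Longrightarrow> 0 \<le> entry ws l e"
begin

sublocale mcf "length bs" "length us" m n A "entry bs" "entry cs" "entry us" "entry ws" W
  by unfold_locales (use W_ge ws_ge in auto)

lemma total_row_list: "e < m \<Longrightarrow> total (row_list M m x) e = (\<Sum>i<M. x i e)"
  by (simp add: total_entry)

lemma Phi_list_eq: "Phi_list m n A W bs cs us ws (row_list (length bs) m x) = Phi x"
proof -
  have "flow_cost_list m cs (row_list (length bs) m x) = flow_cost x"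
    unfolding flow_cost_list_def flow_cost_def
    by (simp add: sum_list_zip length_cs sum_list_upt entry_def dot_def elt_row_list)
  moreover have "overload_list m us ws (row_list (length bs) m x) = overload x"
    unfolding overload_list_def overload_def
    by (simp add: sum_list_zip length_ws sum_list_upt entry_def total_row_list)
  ultimately show ?thesis by (simp add: Phi_list_def Phi_def imbalance_list_eq imbalance_def)
qed

text \<open>The list may repeat moves but misses none, so its length can replace the cardinality in
  the rate of decrease.\<close>

lemma card_moves_le: "card (moves K) \<le> length (moves_list m bs K)"
proof -
  have "inj_on (row_list (length bs) m) (moves K)"
  proof (rule inj_onI, intro ext)
    fix g h i e assume g: "g \<in> moves K" "h \<in> moves K" "row_list (length bs) m g = row_list (length bs) m h"
    show "g i e = h i e"
    proof (cases "i < length bs \<and> e < m")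
      case True
      then have "entry (row_list (length bs) m g) i e = g i e" "entry (row_list (length bs) m h) i e = h i e" by simp_all
      then show ?thesis using g(3) by simp
    next
      case False
      then show ?thesis using g(1,2) by (auto simp: moves_def)
    qed
  qed
  moreover have "row_list (length bs) m ` moves K \<subseteq> set (moves_list m bs K)"
    using moves_list_complete by (auto simp: moves_def)
  ultimately have "card (moves K) \<le> card (set (moves_list m bs K))" by (intro card_inj_on_le) auto
  then show ?thesis using card_length order_trans by blast
qed

lemma augment_optimal:
  assumes K: "pieces_bound m n A K" and B: "0 \<le> B"
    and rep: "\<And>x. nonneg_on (length bs) m x \<Longrightarrow> \<exists>y. in_box B y \<and> Phi y \<le> Phi x"
  obtains x where "augment m n A K W B bs cs us ws = row_list (length bs) m x" "in_box B x"
    "\<And>y. nonneg_on (length bs) m y \<Longrightarrow> Phi x \<le> Phi y"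
proof -
  define M where "M = length bs"
  define L where "L = length (powers B)"
  define Gs where "Gs = candidates m bs K B"
  define f where "f = Phi_list m n A W bs cs us ws"
  define next_mat where "next_mat = best_step m f B Gs"
  \<comment> \<open>The minimum is unknown, so the distance to it is measured against the lower
    bound of \<open>Phi_box_ge\<close>.\<close>
  define gap where "gap = f (zero_rows m bs) + B * abs_sum m cs"
  have fM: "f (row_list M m x) = Phi x" for x unfolding f_def M_def by (rule Phi_list_eq)
  have costs: "abs_sum m cs = abs_costs" unfolding abs_sum_entry abs_costs_def length_cs ..
  have L: "B < 2 ^ L" unfolding L_def by (rule less_power_length_powers)
  have box_list: "in_box_list B (row_list M m x) \<longleftrightarrow> in_box B x" for x
    by (auto simp: in_box_list_def in_box_def row_list_def list_all_iff M_def)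
  have zero_box: "in_box B (\<lambda>_ _. 0)" using B by (simp add: in_box_def)
  \<comment> \<open>By \<open>Phi_box_ge\<close> the shifted values are nonnegative on the box, so a
    minimiser exists by well-foundedness of the natural numbers.\<close>
  obtain z where z: "in_box B z"
    and z_le: "\<And>y. in_box B y \<Longrightarrow> nat (Phi z + B * abs_costs) \<le> nat (Phi y + B * abs_costs)"
    using ex_has_least_nat[of "in_box B" "\<lambda>_ _. 0" "\<lambda>x. nat (Phi x + B * abs_costs)", OF zero_box] by blast
  have z_min: "Phi z \<le> Phi y" if "in_box B y" for y
    using z_le[OF that] Phi_box_ge[OF that] Phi_box_ge[OF z] by linarith
  have step: "\<exists>y. next_mat (row_list M m x) = row_list M m y \<and> in_box B y \<and>
      Phi x - Phi z \<le> int (length Gs) * (Phi x - Phi y)" if x: "in_box B x" for x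
  proof -
    let ?cands = "filter (in_box_list B) (map (madd m (row_list M m x)) Gs)"
    have shape: "\<exists>y. Y = row_list M m y \<and> in_box B y" if Y: "Y \<in> set (row_list M m x # ?cands)" for Y
    proof (cases "Y = row_list M m x")
      case False
      then obtain g where g: "g \<in> set Gs" "Y = madd m (row_list M m x) g" "in_box_list B Y" using Y by auto
      then obtain p h where h: "h \<in> set (moves_list m bs K)" "g = map (\<lambda>r. map (\<lambda>t. p * t) r) h"
        by (auto simp: Gs_def candidates_def)
      then obtain y where "g = row_list M m y" using moves_list_shape[OF h(1)] scale_row_list unfolding M_def by blast
      then show ?thesis using g by (auto simp: madd_row_list box_list)
    qed (use x in auto)
    obtain y where y: "next_mat (row_list M m x) = row_list M m y" "in_box B y"
      using shape[OF argmin_in[of f "row_list M m x" ?cands]] unfolding next_mat_def best_step_def by blast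
    have le: "Phi y \<le> f Y" if "Y \<in> set (row_list M m x # ?cands)" for Y
      using argmin_le[OF that, of f] unfolding y(1)[unfolded next_mat_def best_step_def] fM .
    have "Phi x - Phi z \<le> int (length Gs) * (Phi x - Phi y)"
    proof (cases "Phi z < Phi x")
      case True
      obtain g k where g: "g \<in> moves K" "k < L" "in_box B (shift x (\<lambda>i e. 2 ^ k * g i e))"
        "Phi x - Phi z \<le> int (card (moves K \<times> {..<L})) * (Phi x - Phi (shift x (\<lambda>i e. 2 ^ k * g i e)))"
        using improving_step[OF K x z L True] by blast
      define Y where "Y = row_list M m (shift x (\<lambda>i e. 2 ^ k * g i e))"
      have "row_list M m g \<in> set (moves_list m bs K)"
        using g(1) moves_list_complete unfolding M_def by (auto simp: moves_def)
      moreover have "2 ^ k \<in> set (powers B)" using g(2) by (auto simp: powers_def L_def)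
      ultimately have "row_list M m (\<lambda>i e. 2 ^ k * g i e) \<in> set Gs"
        unfolding Gs_def candidates_def scale_row_list[symmetric] by auto
      moreover have "Y = madd m (row_list M m x) (row_list M m (\<lambda>i e. 2 ^ k * g i e))"
        unfolding Y_def madd_row_list shift_def ..
      ultimately have "Y \<in> set (map (madd m (row_list M m x)) Gs)" by simp
      moreover have "in_box_list B Y" using g(3) by (simp add: Y_def box_list)
      ultimately have "Y \<in> set (row_list M m x # ?cands)" by simp
      from le[OF this] have yY: "Phi y \<le> Phi (shift x (\<lambda>i e. 2 ^ k * g i e))" unfolding Y_def fM .
      have "card (moves K \<times> {..<L}) \<le> length Gs"
        unfolding Gs_def length_candidates L_def card_cartesian_product card_lessThan
        using card_moves_le by (rule mult_right_mono) simp
      moreover have "Phi y \<le> Phi x" using le[of "row_list M m x"] fM by simp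
      ultimately have "int (card (moves K \<times> {..<L})) * (Phi x - Phi y) \<le> int (length Gs) * (Phi x - Phi y)"
        by (intro mult_right_mono) auto
      moreover have "int (card (moves K \<times> {..<L})) * (Phi x - Phi (shift x (\<lambda>i e. 2 ^ k * g i e)))
          \<le> int (card (moves K \<times> {..<L})) * (Phi x - Phi y)"
        using yY by (intro mult_left_mono) auto
      ultimately show ?thesis using g(4) by linarith
    next
      case False
      have "Phi y \<le> Phi x" using le[of "row_list M m x"] fM by simp
      then have "0 \<le> int (length Gs) * (Phi x - Phi y)" by simp
      then show ?thesis using False by linarith
    qed
    then show ?thesis using y by blast
  qed
  \<comment> \<open>The program iterates on lists; the choice function \<open>nxt\<close> follows it
    on arrays, where \<open>Phi\<close> is defined.\<close>
  have "\<forall>x. \<exists>y. in_box B x \<longrightarrow> next_mat (row_list M m x) = row_list M m y \<and> in_box B y \<and>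
      Phi x - Phi z \<le> int (length Gs) * (Phi x - Phi y)"
    using step by blast
  from choice[OF this] obtain nxt where
    nxt: "\<forall>x. in_box B x \<longrightarrow> next_mat (row_list M m x) = row_list M m (nxt x) \<and> in_box B (nxt x) \<and>
      Phi x - Phi z \<le> int (length Gs) * (Phi x - Phi (nxt x))" ..
  define xs where "xs t = (nxt ^^ t) (\<lambda>_ _. 0)" for t
  have box: "in_box B (xs t)" for t
    by (induction t) (use zero_box nxt in \<open>auto simp: xs_def\<close>)
  have iter: "(next_mat ^^ t) (zero_rows m bs) = row_list M m (xs t)" for t
  proof (induction t)
    case (Suc t)
    then show ?case using nxt box[of t] by (simp add: xs_def)
  qed (simp add: xs_def zero_rows_eq M_def)
  have "(\<lambda>t. Phi (xs t) - Phi z) (length Gs * length (powers gap)) = 0"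
  proof (rule geometric_decrease)
    show "0 \<le> Phi (xs t) - Phi z" for t using z_min[OF box] by simp
    show "Phi (xs t) - Phi z \<le> int (length Gs) * (Phi (xs t) - Phi z - (Phi (xs (Suc t)) - Phi z))" for t
      using nxt box[of t] by (simp add: xs_def)
    have "Phi (xs 0) - Phi z \<le> gap"
      using Phi_box_ge[OF z] unfolding gap_def costs zero_rows_eq M_def[symmetric] fM by (simp add: xs_def)
    also have "\<dots> < 2 ^ length (powers gap)" by (rule less_power_length_powers)
    finally show "Phi (xs 0) - Phi z < 2 ^ length (powers gap)" .
  qed
  then have eq: "Phi (xs (length Gs * length (powers gap))) = Phi z" by simp
  have foldl: "foldl (\<lambda>X _. h X) Z ys = (h ^^ length ys) Z" for h :: "rows \<Rightarrow> rows" and Z and ys :: "int list"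
    by (induction ys arbitrary: Z) (simp_all add: funpow_swap1)
  have "augment m n A K W B bs cs us ws = row_list M m (xs (length Gs * length (powers gap)))"
    unfolding augment_def Let_def Gs_def[symmetric] f_def[symmetric] gap_def[symmetric] next_mat_def[symmetric] foldl
    by (simp add: length_concat comp_def sum_list_triv iter)
  moreover have "Phi (xs (length Gs * length (powers gap))) \<le> Phi y"
    if y: "nonneg_on (length bs) m y" for y
  proof -
    obtain y' where "in_box B y'" "Phi y' \<le> Phi y" using rep[OF y] by blast
    then show ?thesis using z_min[of y'] eq by simp
  qed
  ultimately show thesis using that box unfolding M_def by blast
qed

end

text \<open>The first computed argument is the penalty \<open>W\<close>, one above the threshold of
  \<open>exact_penalty\<close>. The second is the box of \<open>bounded_representative\<close>,
  where \<open>g\<close> stands for the size of the test set and \<open>\<beta>\<close> is the sum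
  of the absolute values of all supplies and capacities.\<close>

definition solve :: "nat \<Rightarrow> nat \<Rightarrow> array \<Rightarrow> nat \<Rightarrow> int \<Rightarrow> int \<Rightarrow>
    rows \<Rightarrow> rows \<Rightarrow> rows \<Rightarrow> rows \<Rightarrow> rows" where
  "solve m n A K R g bs cs us ws = augment m n A K (1 + R * (abs_sum m cs + abs_sum m ws))
     (g * ((abs_sum n bs + abs_sum m us) * R)) bs cs us ws"

lemma ptime_solve:
  assumes "ptime bs" "ptime cs" "ptime us" "ptime ws"
  shows "ptime (\<lambda>a. solve m n A K R g (bs a) (cs a) (us a) (ws a))"
  unfolding solve_def by (intro ptime_augment ptime_add ptime_mult ptime_const ptime_abs_sum assms)

lemma abs_entry_le_abs_sum: "i < length X \<Longrightarrow> e < m \<Longrightarrow> \<bar>entry X i e\<bar> \<le> abs_sum m X"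
  using abs_le_size_of[of i "length X" e m "entry X"] unfolding abs_sum_entry size_of_def .

lemma abs_sum_nonneg: "0 \<le> abs_sum m X"
  unfolding abs_sum_entry by (intro sum_nonneg) auto

definition plan_cost :: "nat \<Rightarrow> nat \<Rightarrow> nat \<Rightarrow> rows \<Rightarrow> rows \<Rightarrow>
    array \<Rightarrow> array \<Rightarrow> int" where
  "plan_cost M N m cs ws x p = (\<Sum>i<M. dot m (entry cs i) (x i)) + (\<Sum>l<N. \<Sum>e<m. entry ws l e * p l e)"

text \<open>The least nonnegative penalty that leaves a nonnegative slack.\<close>

definition shortfall :: "nat \<Rightarrow> rows \<Rightarrow> array \<Rightarrow> nat \<Rightarrow> nat \<Rightarrow> int" where
  "shortfall M us x l e = max 0 ((\<Sum>i<M. x i e) - entry us l e)"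

definition balances :: "nat \<Rightarrow> nat \<Rightarrow> array \<Rightarrow> rows \<Rightarrow> array \<Rightarrow> bool" where
  "balances m n A bs x \<longleftrightarrow> (\<forall>i<length bs. \<forall>r<n. dot m (A r) (x i) = entry bs i r)"

lemma imbalance_list_eq_0_iff:
  "imbalance_list m n A bs (row_list (length bs) m x) = 0 \<longleftrightarrow> balances m n A bs x"
  unfolding imbalance_list_eq balances_def by (auto simp: sum_nonneg_eq_0_iff sum_nonneg)

text \<open>By the choice of \<open>W\<close> and of the box, \<open>bounded_representative\<close>
  and \<open>exact_penalty\<close> both apply to the result of \<open>augment\<close>. Whether the
  computed \<open>x\<close> is balanced decides feasibility: if any nonnegative balanced flow
  exists, then \<open>x\<close> is one.\<close>

lemma solve_optimal:
  assumes G: "test_set m n A G" and R_ge: "\<forall>v\<in>G. \<forall>e<m. \<bar>v e\<bar> \<le> R" and R0: "0 \<le> R"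
    and K: "pieces_bound m n A K"
    and len: "length cs = length bs" "length ws = length us"
    and ws: "nonneg_on (length us) m (entry ws)"
    and no_ray: "\<forall>i<length bs. \<forall>v\<in>G. ray m n A v \<longrightarrow>
      0 \<le> dot m (\<lambda>e. entry cs i e + (\<Sum>l<length us. entry ws l e)) v"
  shows "\<exists>x. solve m n A K R (int (card G)) bs cs us ws = row_list (length bs) m x \<and> nonneg_on (length bs) m x \<and>
    (\<forall>y. nonneg_on (length bs) m y \<longrightarrow> balances m n A bs y \<longrightarrow> balances m n A bs x \<and>
       plan_cost (length bs) (length us) m cs ws x (shortfall (length bs) us x) \<le>
       plan_cost (length bs) (length us) m cs ws y (shortfall (length bs) us y))"
proof -
  define W where "W = 1 + R * (abs_sum m cs + abs_sum m ws)"
  define B where "B = int (card G) * ((abs_sum n bs + abs_sum m us) * R)"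
  have R: "\<And>v e. v \<in> G \<Longrightarrow> e < m \<Longrightarrow> \<bar>v e\<bar> \<le> R" "0 \<le> R" using R_ge R0 by auto
  have RC: "0 \<le> R * abs_sum m cs" "0 \<le> R * abs_sum m ws" using R(2) abs_sum_nonneg by auto
  interpret int_instance m n A W bs cs us ws
    by unfold_locales (use len nonneg_onD[OF ws] RC in \<open>auto simp: W_def distrib_left\<close>)
  have costs: "abs_sum m cs = abs_costs" unfolding abs_sum_entry abs_costs_def len ..
  have weight: "abs_sum m ws = total_weight"
    unfolding abs_sum_entry total_weight_def len using nonneg_onD[OF ws] by (intro sum.cong refl abs_of_nonneg) auto
  have RW: "R * abs_costs \<le> W" "R * (abs_costs + total_weight) < W"
    using RC by (auto simp: W_def costs[symmetric] weight[symmetric] distrib_left)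
  have B: "0 \<le> B" unfolding B_def using abs_sum_nonneg R(2) by (intro mult_nonneg_nonneg add_nonneg_nonneg) auto
  have rep: "\<exists>y. in_box B y \<and> Phi y \<le> Phi x" if x0: "nonneg_on (length bs) m x" for x
    unfolding B_def
  proof (rule bounded_representative[where G = G and R = R and x = x and \<beta> = "abs_sum n bs + abs_sum m us"])
    show "\<bar>entry bs i r\<bar> \<le> abs_sum n bs + abs_sum m us" if "i < length bs" "r < n" for i r
      using abs_entry_le_abs_sum[OF that] abs_sum_nonneg[of m us] by simp
    show "\<bar>entry us l e\<bar> \<le> abs_sum n bs + abs_sum m us" if "l < length us" "e < m" for l e
      using abs_entry_le_abs_sum[OF that] abs_sum_nonneg[of n bs] by simp
    show "0 \<le> ray_cost i v" if "i < length bs" "v \<in> G" "ray m n A v" for i v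
      using no_ray that by (simp add: ray_cost_def)
    show "test_set m n A G" "0 \<le> R" "R * abs_costs \<le> W" by (fact G R(2) RW(1))+
    show "\<bar>v e\<bar> \<le> R" if "v \<in> G" "e < m" for v e using R(1)[OF that] .
    show "0 \<le> abs_sum n bs + abs_sum m us" using abs_sum_nonneg[of n bs] abs_sum_nonneg[of m us] by simp
  qed (fact x0)
  from augment_optimal[OF K B rep] obtain x where x: "augment m n A K W B bs cs us ws = row_list (length bs) m x"
    "in_box B x" "\<And>y. nonneg_on (length bs) m y \<Longrightarrow> Phi x \<le> Phi y" by blast
  have x0: "nonneg_on (length bs) m x" using x(2) by (simp add: in_box_def nonneg_on_def)
  have "balances m n A bs x \<and> flow_cost x + overload x \<le> flow_cost y + overload y"
    if y: "nonneg_on (length bs) m y" "balances m n A bs y" for y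
  proof -
    have yb: "balanced y" using y(2) by (simp add: balanced_def balances_def)
    have xb: "balanced x"
    proof (rule exact_penalty[of G R x y])
      show "\<bar>v e\<bar> \<le> R" if "v \<in> G" "e < m" for v e using R(1)[OF that] .
      show "Phi x \<le> Phi y'" if "nonneg_on (length bs) m y'" for y' by (rule x(3)[OF that])
    qed (fact G RW(2) yb x0 y(1))+
    have "imbalance x = 0" "imbalance y = 0" using xb yb by (simp_all add: imbalance_def balanced_def)
    then show ?thesis using x(3)[OF y(1)] xb by (simp add: Phi_def balances_def balanced_def)
  qed
  moreover have "flow_cost x + overload x =
      plan_cost (length bs) (length us) m cs ws x (shortfall (length bs) us x)" for x
    by (simp add: flow_cost_def overload_def plan_cost_def shortfall_def)
  ultimately show ?thesis
    using x(1) x0 by (intro exI[of _ x]) (simp add: solve_def W_def B_def)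
qed

section \<open>Rational data\<close>

text \<open>A product instead of a least common multiple: its length is still at most linear in that
  of the denominators, and no gcd has to be computed.\<close>

definition common_denom :: "(int \<times> int) list list \<Rightarrow> (int \<times> int) list list \<Rightarrow> (int \<times> int) list \<Rightarrow> int" where
  "common_denom fc pc pr = prod_list (map snd (concat fc @ concat pc @ pr))"

text \<open>Expected penalties multiply two rationals, hence everything is scaled by \<open>D\<^sup>2\<close>.\<close>

definition int_costs :: "int \<Rightarrow> (int \<times> int) list list \<Rightarrow> rows" where
  "int_costs D fc = map (\<lambda>c. map (\<lambda>q. fst q * (D * (D div snd q))) c) fc"

definition int_weights :: "int \<Rightarrow> (int \<times> int) list \<Rightarrow> (int \<times> int) list list \<Rightarrow> rows" where
  "int_weights D pr pc = map (\<lambda>p. map (\<lambda>q. (fst (fst p) * (D div snd (fst p))) * (fst q * (D div snd q))) (snd p)) (zip pr pc)"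

lemma ptime_common_denom:
  assumes "ptime fc" "ptime pc" "ptime pr" shows "ptime (\<lambda>a. common_denom (fc a) (pc a) (pr a))"
  unfolding common_denom_def by (intro ptime_intros assms)

lemma ptime_int_costs:
  assumes "ptime D" "ptime fc" shows "ptime (\<lambda>a. int_costs (D a) (fc a))"
  unfolding int_costs_def by (intro ptime_intros ptime_comp[OF assms(1)] assms(2))

lemma ptime_int_weights:
  assumes "ptime D" "ptime pr" "ptime pc" shows "ptime (\<lambda>a. int_weights (D a) (pr a) (pc a))"
  unfolding int_weights_def by (intro ptime_intros ptime_comp[OF assms(1)] assms(2,3))

text \<open>With a negative weight, slack and penalty of one edge in one scenario can grow together.
  The second alternative is a ray with negative \<open>ray_cost\<close> for some commodity.\<close>

definition unbounded_direction :: "nat \<Rightarrow> rows \<Rightarrow> rows \<Rightarrow> rows \<Rightarrow> bool" where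
  "unbounded_direction m rays cs ws \<longleftrightarrow> list_ex (\<lambda>w. list_ex (\<lambda>t. t < 0) w) ws \<or>
     list_ex (\<lambda>c. list_ex (\<lambda>v. (\<Sum>e\<leftarrow>[0..<m]. (elt c e + total ws e) * elt v e) < 0) rays) cs"

lemma ptime_unbounded_direction:
  assumes "ptime cs" "ptime ws" shows "ptime (\<lambda>a. unbounded_direction m rays (cs a) (ws a))"
  unfolding unbounded_direction_def
  by (intro ptime_intros ptime_total ptime_comp[OF assms(2)] assms)

text \<open>The penalties are obtained for \<open>s = 1\<close> and the slacks for \<open>s = -1\<close>.\<close>

definition excess :: "nat \<Rightarrow> int \<Rightarrow> rows \<Rightarrow> rows \<Rightarrow> rows" where
  "excess m s us X = map (\<lambda>u. map (\<lambda>e. max 0 (s * (total X e - elt u e))) [0..<m]) us"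

lemma ptime_excess:
  assumes "ptime us" "ptime X" shows "ptime (\<lambda>a. excess m s (us a) (X a))"
  unfolding excess_def by (intro ptime_intros ptime_total ptime_comp[OF assms(2)] assms)

text \<open>Given a direction of unbounded improvement, only feasibility is left to decide, which is done with
  zero costs.\<close>

definition int_answer :: "nat \<Rightarrow> nat \<Rightarrow> array \<Rightarrow> nat \<Rightarrow> int \<Rightarrow> int \<Rightarrow> rows \<Rightarrow>
    rows \<Rightarrow> rows \<Rightarrow> rows \<Rightarrow> rows \<Rightarrow> data" where
  "int_answer m n A K R g rays bs cs us ws = (
    if unbounded_direction m rays cs ws then
      if imbalance_list m n A bs (solve m n A K R g bs (zero_rows m bs) us (zero_rows m us)) = 0
      then Num 1 else Num 0
    else
      let X = solve m n A K R g bs cs us ws in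
      if imbalance_list m n A bs X = 0
      then enc (X, (excess m (-1) us X, (excess m 1 us X, 0 :: int))) else Num 0)"

lemma ptime_int_answer:
  assumes "ptime bs" "ptime cs" "ptime us" "ptime ws"
  shows "ptime (\<lambda>a. int_answer m n A K R g rays (bs a) (cs a) (us a) (ws a))"
  unfolding int_answer_def
  by (intro ptime_If ptime_Let ptime_eq ptime_enc ptime_Pair ptime_const ptime_id ptime_fst ptime_snd
      ptime_unbounded_direction ptime_imbalance_list ptime_solve ptime_zero_rows ptime_excess assms
      ptime_comp[OF assms(1)] ptime_comp[OF assms(3)])

text \<open>Nested pairs that end in the integer 0 have the encoding of a list, which allows the
  components to have different types, as in \<open>enc_instance\<close>. The answer is built in the
  same way.\<close>

type_synonym program_input =
  "rows \<times> (int \<times> int) list list \<times> rows \<times> (int \<times> int) list list \<times> (int \<times> int) list \<times> int"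

definition flow_program :: "nat \<Rightarrow> nat \<Rightarrow> array \<Rightarrow> nat \<Rightarrow> int \<Rightarrow> int \<Rightarrow> rows \<Rightarrow> program_input \<Rightarrow> data" where
  "flow_program m n A K R g rays a = (
    let D = common_denom (fst (snd a)) (fst (snd (snd (snd a)))) (fst (snd (snd (snd (snd a))))) in
    int_answer m n A K R g rays (fst a) (int_costs D (fst (snd a))) (fst (snd (snd a)))
      (int_weights D (fst (snd (snd (snd (snd a))))) (fst (snd (snd (snd a))))))"

lemma ptime_flow_program: "ptime (flow_program m n A K R g rays)"
proof -
  have "ptime (\<lambda>a. flow_program m n A K R g rays a)"
    unfolding flow_program_def
    by (intro ptime_Let ptime_int_answer ptime_int_costs ptime_int_weights ptime_common_denom ptime_fst ptime_snd ptime_id)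
  then show ?thesis .
qed

section \<open>Correctness\<close>

definition encode_instance :: "flow_instance \<Rightarrow> program_input" where
  "encode_instance I = (map list_of_vec (supplies I), map (\<lambda>c. map quotient_of (list_of_vec c)) (flow_costs I),
     map list_of_vec (capacities I), map (\<lambda>q. map quotient_of (list_of_vec q)) (penalty_costs I),
     map quotient_of (probabilities I), 0)"

lemma enc_int_eq: "enc = Num"
  by (rule ext) (simp add: enc_int_def)

lemma enc_rat_eq: "enc_rat = (\<lambda>r. Cell (Num (fst (quotient_of r))) (Num (snd (quotient_of r))))"
  by (rule ext) (simp add: enc_rat_def split: prod.split)

lemma enc_encode_instance: "enc (encode_instance I) = enc_instance I"
  by (simp add: encode_instance_def enc_instance_def enc_vecs_def enc_prod_def enc_list_def enc_int_eq comp_def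
      enc_rat_eq)

lemma elt_list_of_vec: "e < dim_vec v \<Longrightarrow> elt (list_of_vec v) e = v $ e"
  by (simp add: elt_def)

lemma dvd_prod_list: "x \<in> set xs \<Longrightarrow> x dvd prod_list xs" for x :: int
  by (induction xs) auto

lemma prod_list_pos: "(\<And>x. x \<in> set xs \<Longrightarrow> 0 < x) \<Longrightarrow> 0 < prod_list xs" for xs :: "int list"
  by (induction xs) auto

lemma scale_quotient:
  assumes "snd (quotient_of r) dvd D"
  shows "of_int (fst (quotient_of r) * (D div snd (quotient_of r))) = of_int D * r"
proof -
  obtain a b where ab: "quotient_of r = (a, b)" by (cases "quotient_of r")
  then obtain k where k: "D = b * k" using assms by auto
  have b: "b > 0" and r: "r = of_int a / of_int b"
    using ab quotient_of_denom_pos quotient_of_div by blast+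
  show ?thesis unfolding ab k fst_conv snd_conv unfolding r using b by simp
qed

locale flow_problem =
  fixes A :: "int mat" and I :: flow_instance
  assumes I: "I \<in> flow_instances A"
begin

abbreviation "m \<equiv> dim_col A"
abbreviation "n \<equiv> dim_row A"
abbreviation "M \<equiv> num_commodities I"
abbreviation "N \<equiv> num_scenarios I"

definition a :: array where "a r e = A $$ (r, e)"
definition bs where "bs = map list_of_vec (supplies I)"
definition us where "us = map list_of_vec (capacities I)"
definition D where "D = common_denom (map (\<lambda>c. map quotient_of (list_of_vec c)) (flow_costs I))
  (map (\<lambda>q. map quotient_of (list_of_vec q)) (penalty_costs I)) (map quotient_of (probabilities I))"
definition cs where "cs = int_costs D (map (\<lambda>c. map quotient_of (list_of_vec c)) (flow_costs I))"
definition ws where "ws = int_weights D (map quotient_of (probabilities I))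
  (map (\<lambda>q. map quotient_of (list_of_vec q)) (penalty_costs I))"

lemma lengths: "length bs = M" "length cs = M" "length us = N" "length ws = N"
  using I by (auto simp: bs_def cs_def us_def ws_def int_costs_def int_weights_def num_commodities_def
      num_scenarios_def flow_instances_def)

lemma dims:
  "i < M \<Longrightarrow> dim_vec (supplies I ! i) = n" "i < M \<Longrightarrow> dim_vec (flow_costs I ! i) = m"
  "l < N \<Longrightarrow> dim_vec (capacities I ! l) = m" "l < N \<Longrightarrow> dim_vec (penalty_costs I ! l) = m"
  "length (flow_costs I) = M" "length (penalty_costs I) = N" "length (probabilities I) = N"
  "length (supplies I) = M" "length (capacities I) = N"
  using I unfolding flow_instances_def num_commodities_def num_scenarios_def
  by (auto simp: subset_iff dest!: nth_mem)

lemma D_pos: "0 < D"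
  unfolding D_def common_denom_def by (rule prod_list_pos) (auto simp: quotient_of_denom_pos')

lemma entry_bs: "i < M \<Longrightarrow> r < n \<Longrightarrow> entry bs i r = supplies I ! i $ r"
  using dims by (simp add: entry_def bs_def elt_list_of_vec)

lemma entry_us: "l < N \<Longrightarrow> e < m \<Longrightarrow> entry us l e = capacities I ! l $ e"
  using dims by (simp add: entry_def us_def elt_list_of_vec)

lemma entry_cs:
  assumes "i < M" "e < m"
  shows "rat_of_int (entry cs i e) = of_int (D * D) * (flow_costs I ! i $ e)"
proof -
  let ?r = "flow_costs I ! i $ e"
  have "?r \<in> set (list_of_vec (flow_costs I ! i))" "flow_costs I ! i \<in> set (flow_costs I)"
    using assms dims(5) dims(2)[OF assms(1)] nth_mem[of e "list_of_vec (flow_costs I ! i)"] by simp_all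
  then have "snd (quotient_of ?r) dvd D" unfolding D_def common_denom_def by (intro dvd_prod_list) force
  from scale_quotient[OF this] have "rat_of_int (fst (quotient_of ?r) * (D * (D div snd (quotient_of ?r)))) = of_int (D * D) * ?r"
    by (simp add: algebra_simps)
  moreover have "entry cs i e = fst (quotient_of ?r) * (D * (D div snd (quotient_of ?r)))"
    using assms dims(5) dims(2)[OF assms(1)] by (simp add: entry_def cs_def int_costs_def elt_def)
  ultimately show ?thesis by simp
qed

lemma entry_ws:
  assumes "l < N" "e < m"
  shows "rat_of_int (entry ws l e) = of_int (D * D) * (probabilities I ! l * (penalty_costs I ! l $ e))"
proof -
  let ?r = "penalty_costs I ! l $ e" and ?p = "probabilities I ! l"
  have "?r \<in> set (list_of_vec (penalty_costs I ! l))" "penalty_costs I ! l \<in> set (penalty_costs I)"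
    "?p \<in> set (probabilities I)"
    using assms dims(6,7) dims(4)[OF assms(1)] nth_mem[of e "list_of_vec (penalty_costs I ! l)"] by simp_all
  then have "snd (quotient_of ?r) dvd D" "snd (quotient_of ?p) dvd D"
    unfolding D_def common_denom_def by (intro dvd_prod_list; force)+
  from this[THEN scale_quotient] have "rat_of_int (fst (quotient_of ?p) * (D div snd (quotient_of ?p)) *
      (fst (quotient_of ?r) * (D div snd (quotient_of ?r)))) = of_int (D * D) * (?p * ?r)"
    unfolding of_int_mult[of "_ * _" "_ * _"] by simp
  moreover have "entry ws l e = fst (quotient_of ?p) * (D div snd (quotient_of ?p)) *
      (fst (quotient_of ?r) * (D div snd (quotient_of ?r)))"
    using assms dims(6,7) dims(4)[OF assms(1)] by (simp add: entry_def ws_def int_weights_def elt_def)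
  ultimately show ?thesis by simp
qed

definition solution :: "array \<Rightarrow> array \<Rightarrow> flow_solution" where
  "solution x p = \<lparr>flows = map (\<lambda>i. vec m (x i)) [0..<M],
     slacks = map (\<lambda>l. vec m (\<lambda>e. entry us l e + p l e - (\<Sum>i<M. x i e))) [0..<N],
     penalties = map (\<lambda>l. vec m (p l)) [0..<N]\<rparr>"

abbreviation "cost \<equiv> plan_cost M N m cs ws"
abbreviation "short \<equiv> shortfall M us"

definition feasible_flow :: "array \<Rightarrow> bool" where
  "feasible_flow x \<longleftrightarrow> nonneg_on M m x \<and> balances m n a bs x"

lemma feasible_flow_iff: "feasible_flow x \<longleftrightarrow>
    (\<forall>i<M. \<forall>e<m. 0 \<le> x i e) \<and> (\<forall>i<M. \<forall>r<n. dot m (a r) (x i) = entry bs i r)"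
  by (simp add: feasible_flow_def nonneg_on_def balances_def lengths)

lemma mult_mat_vec_eq:
  assumes "dim_vec v = m" "i < M" "\<And>e. e < m \<Longrightarrow> v $ e = x e"
  shows "A *\<^sub>v v = supplies I ! i \<longleftrightarrow> (\<forall>r<n. dot m (a r) x = entry bs i r)"
proof -
  have "(A *\<^sub>v v) $ r = dot m (a r) x" if "r < n" for r
    using that assms by (simp add: mult_mat_vec_def scalar_prod_def dot_def a_def atLeast0LessThan)
  then show ?thesis using dims(1)[OF assms(2)] entry_bs[OF assms(2)] by (auto simp: vec_eq_iff)
qed

lemma feasible_solution:
  assumes x: "feasible_flow x" and p: "\<And>l e. l < N \<Longrightarrow> e < m \<Longrightarrow> short x l e \<le> p l e"
  shows "feasible A I (solution x p)"
proof -
  have "0\<^sub>v m \<le> v" if "v \<in> set (flows (solution x p)) \<union> set (slacks (solution x p)) \<union> set (penalties (solution x p))" for v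
    using that x p by (fastforce simp: solution_def less_eq_vec_def feasible_flow_iff shortfall_def)
  moreover have "A *\<^sub>v (flows (solution x p) ! i) = supplies I ! i" if "i < M" for i
    using x that mult_mat_vec_eq[of "vec m (x i)" i "x i"] by (simp add: solution_def feasible_flow_iff)
  moreover have "vec m (\<lambda>e. \<Sum>i<M. flows (solution x p) ! i $ e) + slacks (solution x p) ! l - penalties (solution x p) ! l
      = capacities I ! l" if "l < N" for l
    using that dims(3)[OF that] entry_us[OF that] by (intro eq_vecI) (simp_all add: solution_def)
  ultimately show ?thesis unfolding feasible_def by (simp add: solution_def)
qed

lemma objective_eq:
  assumes "length (flows X) = M" "length (penalties X) = N"
    and "\<And>i. i < M \<Longrightarrow> dim_vec (flows X ! i) = m" "\<And>l. l < N \<Longrightarrow> dim_vec (penalties X ! l) = m"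
    and "\<And>i e. i < M \<Longrightarrow> e < m \<Longrightarrow> flows X ! i $ e = x i e" "\<And>l e. l < N \<Longrightarrow> e < m \<Longrightarrow> penalties X ! l $ e = p l e"
  shows "of_int (D * D) * objective I X = of_int (cost x p)"
proof -
  have "of_int (D * D) * (flow_costs I ! i \<bullet> map_vec of_int (flows X ! i)) = of_int (dot m (entry cs i) (x i))"
    if "i < M" for i
    using that assms(3,5)[OF that] entry_cs[OF that] 
    by (simp add: scalar_prod_def dot_def sum_distrib_left atLeast0LessThan mult.assoc)
  moreover have "of_int (D * D) * (probabilities I ! l * (penalty_costs I ! l \<bullet> map_vec of_int (penalties X ! l))) =
      of_int (\<Sum>e<m. entry ws l e * p l e)" if "l < N" for l
    using that assms(4,6)[OF that] entry_ws[OF that]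
    by (simp add: scalar_prod_def sum_distrib_left atLeast0LessThan mult.assoc)
  ultimately show ?thesis
    unfolding objective_def plan_cost_def distrib_left sum_distrib_left of_int_add of_int_sum[of _ "{..<M}"] of_int_sum[of _ "{..<N}"]
    by (intro arg_cong2[of _ _ _ _ "(+)"] sum.cong) auto
qed

lemma objective_solution: "of_int (D * D) * objective I (solution x p) = of_int (cost x p)"
  by (rule objective_eq) (simp_all add: solution_def)

text \<open>Nonnegative slacks force each penalty to be at least the shortfall. Together with
  \<open>feasible_solution\<close> this replaces the slack equations by one inequality.\<close>

lemma feasibleE:
  assumes "feasible A I X"
  obtains x p where "feasible_flow x" "\<And>l e. l < N \<Longrightarrow> e < m \<Longrightarrow> short x l e \<le> p l e"
    "of_int (D * D) * objective I X = of_int (cost x p)"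
proof -
  define x where "x i e = flows X ! i $ e" for i e
  define p where "p l e = penalties X ! l $ e" for l e
  have len: "length (flows X) = M" "length (slacks X) = N" "length (penalties X) = N"
    using assms by (auto simp: feasible_def)
  have nn: "0\<^sub>v m \<le> v" if "v \<in> set (flows X) \<union> set (slacks X) \<union> set (penalties X)" for v
    using assms that unfolding feasible_def by blast
  have nf: "dim_vec (flows X ! i) = m" "\<And>e. e < m \<Longrightarrow> 0 \<le> flows X ! i $ e" if "i < M" for i
    using nn[of "flows X ! i"] that len by (auto simp: less_eq_vec_def)
  have ns: "dim_vec (slacks X ! l) = m" "\<And>e. e < m \<Longrightarrow> 0 \<le> slacks X ! l $ e" if "l < N" for l
    using nn[of "slacks X ! l"] that len by (auto simp: less_eq_vec_def)
  have np: "dim_vec (penalties X ! l) = m" "\<And>e. e < m \<Longrightarrow> 0 \<le> penalties X ! l $ e" if "l < N" for l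
    using nn[of "penalties X ! l"] that len by (auto simp: less_eq_vec_def)
  have "feasible_flow x"
    using assms nf mult_mat_vec_eq[of "flows X ! _" _ "x _"]
    unfolding feasible_flow_iff feasible_def x_def by blast
  moreover have "short x l e \<le> p l e" if "l < N" "e < m" for l e
  proof -
    have "(vec m (\<lambda>e. \<Sum>i<M. flows X ! i $ e) + slacks X ! l - penalties X ! l) $ e = capacities I ! l $ e"
      using assms that by (simp add: feasible_def)
    then have "(\<Sum>i<M. x i e) + slacks X ! l $ e - p l e = entry us l e"
      using that ns(1)[OF that(1)] np(1)[OF that(1)] entry_us[OF that] by (simp add: x_def p_def)
    then show ?thesis using ns(2)[OF that] np(2)[OF that] by (simp add: shortfall_def p_def)
  qed
  moreover have "of_int (D * D) * objective I X = of_int (cost x p)"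
    by (rule objective_eq) (use len nf np in \<open>simp_all add: x_def p_def\<close>)
  ultimately show thesis by (rule that)
qed

lemma objective_le_iff:
  assumes "of_int (D * D) * objective I X = of_int j" "of_int (D * D) * objective I Y = of_int k"
  shows "objective I X \<le> objective I Y \<longleftrightarrow> j \<le> k"
proof -
  have "rat_of_int (D * D) > 0" using D_pos by simp
  then have "objective I X \<le> objective I Y \<longleftrightarrow> of_int (D * D) * objective I X \<le> of_int (D * D) * objective I Y"
    by (simp add: mult_le_cancel_left_pos)
  then show ?thesis unfolding assms by simp
qed

text \<open>\<open>C\<close> is meant to be the cost of one feasible flow, from which the
  \<open>k\<close>-th multiple of an improving direction descends by at least \<open>k\<close>,
  since scaled costs are integers.\<close>

lemma unboundedI:
  assumes "\<And>k :: nat. \<exists>x p. feasible_flow x \<and> (\<forall>l<N. \<forall>e<m. short x l e \<le> p l e) \<and> cost x p \<le> C - int k"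
  shows "correct_answer A I Unbounded"
proof -
  have "\<exists>X. feasible A I X \<and> objective I X < q" for q
  proof -
    have pos: "rat_of_int (D * D) > 0" using D_pos by simp
    obtain k :: nat where k: "of_int C - of_int (D * D) * q < of_nat k" using reals_Archimedean2 by blast
    obtain x p where x: "feasible_flow x" "\<forall>l<N. \<forall>e<m. short x l e \<le> p l e" "cost x p \<le> C - int k"
      using assms by blast
    have "rat_of_int (cost x p) \<le> rat_of_int (C - int k)" using x(3) by (simp only: of_int_le_iff)
    then have "of_int (D * D) * objective I (solution x p) < of_int (D * D) * q"
      unfolding objective_solution using k by simp
    then have "objective I (solution x p) < q" using pos by (simp add: mult_less_cancel_left_pos)
    then show ?thesis using feasible_solution[of x p] x by blast
  qed
  then show ?thesis by simp
qed

end

section \<open>Unbounded and infeasible instances, correctness of the answer\<close>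

lemma entry_zero_rows: "entry (zero_rows m xs) i e = 0" if "i < length xs"
  using that by (simp add: entry_def zero_rows_def elt_def)

context flow_problem
begin

lemma entry_ws_index: "l < N \<Longrightarrow> ws ! l = map (entry ws l) [0..<m]"
proof -
  assume l: "l < N"
  have "length (ws ! l) = m" using l dims(6,7) dims(4)[OF l] by (simp add: ws_def int_weights_def)
  then show ?thesis by (intro nth_equalityI) (simp_all add: entry_def elt_def)
qed

text \<open>A positive part grows by no more than its argument, so with nonnegative weights the
  slope far out is an upper bound for the slope along the entire ray.\<close>

lemma cost_ray:
  fixes x :: array
  assumes i: "i < M" and v: "\<And>e. e < m \<Longrightarrow> 0 \<le> v e" and ws: "\<And>l e. l < N \<Longrightarrow> e < m \<Longrightarrow> 0 \<le> entry ws l e"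
  defines "y \<equiv> \<lambda>k j e. x j e + (if j = i then int k * v e else 0)"
  shows "cost (y k) (short (y k)) \<le> cost x (short x) +
    int k * (\<Sum>e<m. (entry cs i e + (\<Sum>l<N. entry ws l e)) * v e)"
proof -
  have "dot m (entry cs j) (y k j) = dot m (entry cs j) (x j) + (if j = i then int k * dot m (entry cs i) v else 0)" for j
    by (auto simp: y_def dot_add dot_scale)
  then have "(\<Sum>j<M. dot m (entry cs j) (y k j)) = (\<Sum>j<M. dot m (entry cs j) (x j)) + int k * dot m (entry cs i) v"
    using i by (simp add: sum.distrib)
  moreover have "(\<Sum>l<N. \<Sum>e<m. entry ws l e * short (y k) l e) \<le>
      (\<Sum>l<N. \<Sum>e<m. entry ws l e * (short x l e + int k * v e))"
  proof (intro sum_mono mult_left_mono)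
    fix l e assume "l \<in> {..<N}" "e \<in> {..<m}"
    then show "0 \<le> entry ws l e" using ws by simp
    have "(\<Sum>j<M. y k j e) = (\<Sum>j<M. x j e) + int k * v e" using i by (simp add: y_def sum.distrib)
    moreover have "0 \<le> int k * v e" using v \<open>e \<in> {..<m}\<close> by simp
    ultimately show "short (y k) l e \<le> short x l e + int k * v e" by (simp add: shortfall_def)
  qed
  moreover have "(\<Sum>l<N. \<Sum>e<m. entry ws l e * (short x l e + int k * v e)) =
      (\<Sum>l<N. \<Sum>e<m. entry ws l e * short x l e) + (\<Sum>l<N. \<Sum>e<m. entry ws l e * (int k * v e))"
    by (simp only: distrib_left sum.distrib)
  moreover have "(\<Sum>l<N. \<Sum>e<m. entry ws l e * (int k * v e)) = int k * (\<Sum>e<m. (\<Sum>l<N. entry ws l e) * v e)"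
    by (subst sum.swap) (simp add: sum_distrib_left sum_distrib_right mult.left_commute)
  moreover have "int k * (\<Sum>e<m. (entry cs i e + (\<Sum>l<N. entry ws l e)) * v e) =
      int k * dot m (entry cs i) v + int k * (\<Sum>e<m. (\<Sum>l<N. entry ws l e) * v e)"
    by (simp only: dot_def distrib_left distrib_right sum.distrib)
  ultimately show ?thesis unfolding plan_cost_def by linarith
qed

lemma unbounded_direction_correct:
  assumes rays: "set rays \<subseteq> (\<lambda>v. map v [0..<m]) ` {v. ray m n a v}"
    and dir: "unbounded_direction m rays cs ws" and x: "feasible_flow x"
  shows "correct_answer A I Unbounded"
proof (cases "\<exists>l<N. \<exists>e<m. entry ws l e < 0")
  case True
  then obtain l e where le: "l < N" "e < m" "entry ws l e < 0" by blast
  show ?thesis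
  proof (rule unboundedI)
    fix k :: nat
    \<comment> \<open>The flow stays fixed: only the penalty with negative weight is raised by
      \<open>k\<close>, and \<open>solution\<close> raises the slack by the same amount.\<close>
    define p where "p l' e' = short x l' e' + (if l' = l then if e' = e then int k else 0 else 0)" for l' e'
    have "(\<Sum>l'<N. \<Sum>e'<m. entry ws l' e' * p l' e') =
        (\<Sum>l'<N. (\<Sum>e'<m. entry ws l' e' * short x l' e') + (if l' = l then entry ws l e * int k else 0))"
    proof (rule sum.cong[OF refl])
      fix l'
      have "(\<Sum>e'<m. entry ws l' e' * p l' e') =
        (\<Sum>e'<m. entry ws l' e' * short x l' e' + (if e' = e then if l' = l then entry ws l e * int k else 0 else 0))"
        by (rule sum.cong) (auto simp: p_def distrib_left)
      then show "(\<Sum>e'<m. entry ws l' e' * p l' e') =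
          (\<Sum>e'<m. entry ws l' e' * short x l' e') + (if l' = l then entry ws l e * int k else 0)"
        using le(2) by (simp add: sum.distrib)
    qed
    then have "cost x p = cost x (short x) + entry ws l e * int k"
      using le(1) by (simp add: plan_cost_def sum.distrib)
    moreover have "entry ws l e * int k \<le> - 1 * int k" using le(3) by (intro mult_right_mono) auto
    ultimately have "cost x p \<le> cost x (short x) - int k" by simp
    moreover have "\<forall>l<N. \<forall>e<m. short x l e \<le> p l e" by (simp add: p_def)
    ultimately show "\<exists>x' p. feasible_flow x' \<and> (\<forall>l<N. \<forall>e<m. short x' l e \<le> p l e) \<and>
        cost x' p \<le> cost x (short x) - int k" using x by blast
  qed
next
  case False
  have ws: "0 \<le> entry ws l e" if "l < N" "e < m" for l e
  proof (rule ccontr)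
    assume "\<not> 0 \<le> entry ws l e"
    then have "entry ws l e < 0" by simp
    then show False using False that by blast
  qed
  have "\<not> list_ex (\<lambda>w. list_ex (\<lambda>t. t < 0) w) ws"
  proof
    assume "list_ex (\<lambda>w. list_ex (\<lambda>t. t < 0) w) ws"
    then obtain w t where "w \<in> set ws" and t: "t \<in> set w" "t < 0" unfolding list_ex_iff by blast
    then obtain l where "l < length ws" "w = ws ! l" unfolding in_set_conv_nth by blast
    then have l: "l < N" "w = ws ! l" using lengths(4) by simp_all
    then obtain e where "e < m" "t = entry ws l e" using t(1) entry_ws_index[OF l(1)] by auto
    then show False using ws[OF l(1), of e] t(2) by simp
  qed
  then obtain c w where c: "c \<in> set cs" and w: "w \<in> set rays" "(\<Sum>e\<leftarrow>[0..<m]. (elt c e + total ws e) * elt w e) < 0"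
    using dir unfolding unbounded_direction_def list_ex_iff[of _ cs] list_ex_iff[of _ rays] by blast
  from c obtain i where k: "i < length cs" "c = cs ! i" unfolding in_set_conv_nth by blast
  then have i: "i < M" "w \<in> set rays" "(\<Sum>e\<leftarrow>[0..<m]. (elt (cs ! i) e + total ws e) * elt w e) < 0"
    using w lengths(2) by simp_all
  from i(2) obtain v where v: "w = map v [0..<m]" "\<And>e. e < m \<Longrightarrow> 0 \<le> v e" "\<And>r. r < n \<Longrightarrow> dot m (a r) v = 0"
    using rays unfolding ray_def by blast
  have neg: "(\<Sum>e<m. (entry cs i e + (\<Sum>l<N. entry ws l e)) * v e) < 0"
    using i(3) by (simp add: v(1) elt_def sum_list_upt total_entry lengths entry_def)
  show ?thesis
  proof (rule unboundedI)
    fix k :: nat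
    define y where "y j e = x j e + (if j = i then int k * v e else 0)" for j e
    have "cost y (short y) \<le> cost x (short x) + int k * (\<Sum>e<m. (entry cs i e + (\<Sum>l<N. entry ws l e)) * v e)"
      using cost_ray[where x = x and k = k, OF i(1) v(2) ws] unfolding y_def[abs_def] by simp
    moreover have "int k * (\<Sum>e<m. (entry cs i e + (\<Sum>l<N. entry ws l e)) * v e) \<le> int k * - 1"
      using neg by (intro mult_left_mono) auto
    ultimately have "cost y (short y) \<le> cost x (short x) - int k" by simp
    moreover have "feasible_flow y"
      unfolding feasible_flow_iff
    proof (intro conjI allI impI)
      fix j e assume "j < M" "e < m"
      then show "0 \<le> y j e" using x v(2) by (auto simp: feasible_flow_iff y_def)
    next
      fix j r assume jr: "j < M" "r < n"
      have "dot m (a r) (y j) = dot m (a r) (x j) + (if j = i then int k * dot m (a r) v else 0)"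
        by (auto simp: y_def[abs_def] dot_add dot_scale)
      then show "dot m (a r) (y j) = entry bs j r" using x jr v(3) by (simp add: feasible_flow_iff)
    qed
    ultimately show "\<exists>x' p. feasible_flow x' \<and> (\<forall>l<N. \<forall>e<m. short x' l e \<le> p l e) \<and>
        cost x' p \<le> cost x (short x) - int k" by blast
  qed
qed

lemma infeasibleI:
  assumes "\<And>y. \<not> feasible_flow y"
  shows "correct_answer A I Infeasible"
proof -
  have "\<not> feasible A I X" for X
  proof
    assume "feasible A I X"
    then show False by (rule feasibleE) (rule notE[OF assms])
  qed
  then show ?thesis by simp
qed

lemma enc_solution:
  "enc (row_list M m x, (excess m (-1) us (row_list M m x), (excess m 1 us (row_list M m x), 0 :: int))) =
    enc_answer (Optimal (solution x (short x)))"
proof -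
  have t: "total (row_list M m x) e = (\<Sum>i<M. x i e)" if "e < m" for e
    using that by (simp add: total_entry)
  have "excess m (-1) us (row_list M m x) =
      map (\<lambda>l. map (\<lambda>e. entry us l e + short x l e - (\<Sum>i<M. x i e)) [0..<m]) [0..<N]"
    by (rule nth_equalityI) (auto simp: excess_def lengths t entry_def shortfall_def)
  moreover have "excess m 1 us (row_list M m x) = map (\<lambda>l. map (short x l) [0..<m]) [0..<N]"
    by (rule nth_equalityI) (auto simp: excess_def lengths t entry_def shortfall_def)
  ultimately show ?thesis
    by (simp add: solution_def enc_prod_def enc_list_def enc_int_eq enc_vecs_def comp_def row_list_def)
qed

text \<open>If no unbounded direction is found, the hypotheses of \<open>solve_optimal\<close> hold,
  so a feasible instance has an optimum and the three outcomes are exhaustive.\<close>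

lemma int_answer_correct:
  assumes G: "test_set m n a G" and R: "\<forall>v\<in>G. \<forall>e<m. \<bar>v e\<bar> \<le> R" "0 \<le> R"
    and K: "pieces_bound m n a K" and rays: "set rays = (\<lambda>v. map v [0..<m]) ` {v\<in>G. ray m n a v}"
  shows "\<exists>out. int_answer m n a K R (int (card G)) rays bs cs us ws = enc_answer out \<and> correct_answer A I out"
proof (cases "unbounded_direction m rays cs ws")
  case True
  have nn: "nonneg_on (length us) m (entry (zero_rows m us))"
    by (simp add: nonneg_on_def entry_zero_rows)
  have nr: "\<forall>i<length bs. \<forall>v\<in>G. ray m n a v \<longrightarrow>
      0 \<le> dot m (\<lambda>e. entry (zero_rows m bs) i e + (\<Sum>l<length us. entry (zero_rows m us) l e)) v"
    by (simp add: entry_zero_rows dot_def)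
  have len: "length (zero_rows m xs) = length xs" for xs :: rows by (simp add: zero_rows_def)
  have "\<exists>x. solve m n a K R (int (card G)) bs (zero_rows m bs) us (zero_rows m us) = row_list (length bs) m x \<and>
    nonneg_on (length bs) m x \<and> (\<forall>y. feasible_flow y \<longrightarrow> balances m n a bs x)"
    by (rule ex_forward[OF solve_optimal[OF G R K len len nn nr]]) (unfold feasible_flow_def lengths, blast)
  then obtain x where x: "solve m n a K R (int (card G)) bs (zero_rows m bs) us (zero_rows m us) = row_list (length bs) m x"
    "nonneg_on (length bs) m x" "\<And>y. feasible_flow y \<Longrightarrow> balances m n a bs x" by blast
  show ?thesis
  proof (cases "balances m n a bs x")
    case bal_x: True
    then have "feasible_flow x" using x(2) by (simp add: feasible_flow_def lengths)
    then have "correct_answer A I Unbounded"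
      using rays by (intro unbounded_direction_correct[OF _ True]) auto
    moreover have "int_answer m n a K R (int (card G)) rays bs cs us ws = enc_answer Unbounded"
      using True bal_x by (simp add: int_answer_def x(1) imbalance_list_eq_0_iff)
    ultimately show ?thesis by blast
  next
    case False
    then have "\<not> feasible_flow y" for y using x(3)[of y] by blast
    then have "correct_answer A I Infeasible" by (rule infeasibleI)
    moreover have "int_answer m n a K R (int (card G)) rays bs cs us ws = enc_answer Infeasible"
      using True False by (simp add: int_answer_def x(1) imbalance_list_eq_0_iff)
    ultimately show ?thesis by blast
  qed
next
  case False
  have ws_ge: "0 \<le> entry ws l e" if "l < N" "e < m" for l e
  proof -
    have "\<not> list_ex (\<lambda>t. t < 0) (ws ! l)"
      using False that lengths(4) unfolding unbounded_direction_def by (auto simp: list_ex_iff)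
    then show ?thesis using that by (simp add: entry_ws_index list_ex_iff not_less)
  qed
  then have nn: "nonneg_on (length us) m (entry ws)" by (simp add: nonneg_on_def lengths)
  have "0 \<le> dot m (\<lambda>e. entry cs i e + (\<Sum>l<length us. entry ws l e)) v"
    if "i < length bs" "v \<in> G" "ray m n a v" for i v
  proof -
    have "map v [0..<m] \<in> set rays" using that unfolding rays by blast
    moreover have "cs ! i \<in> set cs" using that(1) lengths by simp
    ultimately have "\<not> (\<Sum>e\<leftarrow>[0..<m]. (elt (cs ! i) e + total ws e) * elt (map v [0..<m]) e) < 0"
      using False unfolding unbounded_direction_def list_ex_iff by blast
    then show ?thesis
      by (simp add: elt_def sum_list_upt total_entry lengths entry_def dot_def not_less)
  qed
  then have nr: "\<forall>i<length bs. \<forall>v\<in>G. ray m n a v \<longrightarrow>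
      0 \<le> dot m (\<lambda>e. entry cs i e + (\<Sum>l<length us. entry ws l e)) v" by blast
  have len: "length cs = length bs" "length ws = length us" by (simp_all add: lengths)
  obtain x where x: "solve m n a K R (int (card G)) bs cs us ws = row_list (length bs) m x"
    "nonneg_on (length bs) m x"
    "\<And>y. feasible_flow y \<Longrightarrow> balances m n a bs x \<and> cost x (short x) \<le> cost y (short y)"
    using solve_optimal[OF G R K len nn nr] unfolding feasible_flow_def lengths by blast
  show ?thesis
  proof (cases "balances m n a bs x")
    case bal_x: True
    then have flow: "feasible_flow x" using x(2) by (simp add: feasible_flow_def lengths)
    have "objective I (solution x (short x)) \<le> objective I Y" if Y: "feasible A I Y" for Y
    proof -
      obtain y p where y: "feasible_flow y" "\<And>l e. l < N \<Longrightarrow> e < m \<Longrightarrow> short y l e \<le> p l e"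
        "of_int (D * D) * objective I Y = of_int (cost y p)" by (rule feasibleE[OF Y]) (rule that, assumption+)
      have "cost x (short x) \<le> cost y (short y)"
        using x(3)[OF y(1)] by blast
      \<comment> \<open>All weights are nonnegative in this case, so a penalty above the shortfall
        cannot pay.\<close>
      also have "\<dots> \<le> cost y p"
        unfolding plan_cost_def using y(2) ws_ge by (intro add_left_mono sum_mono mult_left_mono) auto
      finally show ?thesis using objective_le_iff[OF objective_solution y(3)] by simp
    qed
    then have "correct_answer A I (Optimal (solution x (short x)))"
      using feasible_solution[OF flow] by simp
    moreover have "int_answer m n a K R (int (card G)) rays bs cs us ws = enc_answer (Optimal (solution x (short x)))"
      using False bal_x enc_solution[of x]
      by (simp add: int_answer_def x(1) imbalance_list_eq_0_iff Let_def lengths(1)[symmetric] del: enc_answer.simps)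
    ultimately show ?thesis by blast
  next
    case not_bal: False
    then have "\<not> feasible_flow y" for y using x(3)[of y] by blast
    then have "correct_answer A I Infeasible" by (rule infeasibleI)
    moreover have "int_answer m n a K R (int (card G)) rays bs cs us ws = enc_answer Infeasible"
      using False not_bal by (simp add: int_answer_def x(1) imbalance_list_eq_0_iff Let_def)
    ultimately show ?thesis by blast
  qed
qed

section \<open>Encoding sizes and the step to the machine model\<close>

lemma flow_program_eq:
  "flow_program m n a K R g rays (encode_instance I) = int_answer m n a K R g rays bs cs us ws"
  by (simp add: flow_program_def encode_instance_def bs_def cs_def us_def ws_def D_def Let_def)

text \<open>A vector costs a cell and a terminator even if it has no entries; this is how the
  numbers of commodities and scenarios enter besides the encoding length.\<close>

lemma data_size_enc_vecs:
  assumes "\<And>a. 1 + data_size (f a) \<le> 3 * len a"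
  shows "data_size (enc_vecs f xs) \<le> 1 + 2 * length xs + 3 * vecs_length len xs"
proof -
  have vec: "data_size (enc_list (map f ys)) \<le> 1 + 3 * (\<Sum>a\<leftarrow>ys. len a)" for ys
  proof (induction ys)
    case (Cons y ys)
    then show ?case using assms[of y] by simp
  qed (simp add: int_length_def floorlog_def)
  show ?thesis
  proof (induction xs)
    case (Cons x xs)
    then show ?case using vec[of "list_of_vec x"] by (simp add: enc_vecs_def vecs_length_def)
  qed (simp add: enc_vecs_def vecs_length_def int_length_def floorlog_def)
qed

lemma data_size_enc_instance:
  "data_size (enc_instance I) \<le> 11 + 4 * (M + N + encoding_length I)"
proof -
  have int: "1 + data_size (Num k) \<le> 3 * int_length k" for k
    using int_length_ge_1[of k] by (simp del: int_length_ge_1)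
  have rat: "1 + data_size (enc_rat r) \<le> 3 * rat_length r" for r
    using int_length_ge_1[of "fst (quotient_of r)"] int_length_ge_1[of "snd (quotient_of r)"]
    by (simp add: enc_rat_eq rat_length_def case_prod_beta del: int_length_ge_1)
  have probs: "data_size (enc_list (map enc_rat ps)) \<le> 1 + 3 * (\<Sum>r\<leftarrow>ps. rat_length r)" for ps
  proof (induction ps)
    case (Cons p ps)
    then show ?case using rat[of p] by simp
  qed (simp add: int_length_def floorlog_def)
  have "data_size (enc_instance I) \<le> 6 + (1 + 2 * M + 3 * vecs_length int_length (supplies I)) +
      (1 + 2 * M + 3 * vecs_length rat_length (flow_costs I)) + (1 + 2 * N + 3 * vecs_length int_length (capacities I)) +
      (1 + 2 * N + 3 * vecs_length rat_length (penalty_costs I)) + (1 + 3 * (\<Sum>r\<leftarrow>probabilities I. rat_length r))"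
    using data_size_enc_vecs[of Num int_length "supplies I", OF int] data_size_enc_vecs[of enc_rat rat_length "flow_costs I", OF rat]
      data_size_enc_vecs[of Num int_length "capacities I", OF int] data_size_enc_vecs[of enc_rat rat_length "penalty_costs I", OF rat]
      probs[of "probabilities I"]
    by (simp add: enc_instance_def dims int_length_def floorlog_def)
  then show ?thesis by (simp add: encoding_length_def)
qed

end

text \<open>The calculus leaves the result in variable 0, the problem asks for it in variable 1. The
  final copy costs the size of the result, again polynomial by \<open>ptime_size\<close>.\<close>

lemma ptime_solvable:
  assumes f: "ptime f" and enc: "\<And>I. I \<in> Inst \<Longrightarrow> enc (code I) = enc_in I"
    and size: "\<And>I. I \<in> Inst \<Longrightarrow> data_size (enc_in I) \<le> poly q (len I)"
    and correct: "\<And>I. I \<in> Inst \<Longrightarrow> \<exists>out. enc (f (code I)) = enc_out out \<and> correct I out"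
  shows "solvable_in_poly_time Inst enc_in len enc_out correct"
proof -
  obtain c p k where c: "computes c (poly p) k UNIV f" using f unfolding ptime_on_def by blast
  obtain r where r: "\<And>a. sz (f a) \<le> poly r (sz a)" using ptime_size[OF f] by blast
  obtain b :: "nat poly" where b: "\<And>n. poly p (poly q n) + poly r (poly q n) = poly b n"
    by (rule polyf_obtain[of "\<lambda>n. poly p (poly q n) + poly r (poly q n)"]) (intro polyf_intros, auto)
  have "\<exists>t s out. exec (Seq c (Assign 1 (Var 0))) ((\<lambda>_. Num 0)(0 := enc_in I)) t s \<and> t \<le> poly b (len I) \<and>
      s 1 = enc_out out \<and> correct I out" if I: "I \<in> Inst" for I
  proof -
    obtain out where out: "enc (f (code I)) = enc_out out" "correct I out" using correct[OF I] by blast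
    obtain t s where s: "exec c ((\<lambda>_. Num 0)(0 := enc_in I)) t s" "t \<le> poly p (sz (code I))" "s 0 = enc (f (code I))"
      by (rule computesE[OF c, of "code I" "(\<lambda>_. Num 0)(0 := enc_in I)"]) (use enc[OF I] in auto)
    have "exec (Seq c (Assign 1 (Var 0))) ((\<lambda>_. Num 0)(0 := enc_in I)) (t + sz (f (code I))) (s(1 := enc (f (code I))))"
      using exec.Seq[OF s(1) exec.Assign[of 1 "Var 0" s]] s(3) by (simp add: eval_cost_eqs sz_def)
    moreover have "sz (code I) \<le> poly q (len I)" using size[OF I] enc[OF I] by (simp add: sz_def)
    then have "t + sz (f (code I)) \<le> poly b (len I)"
      using s(2) r[of "code I"] poly_nat_mono[of "sz (code I)" "poly q (len I)" p]
        poly_nat_mono[of "sz (code I)" "poly q (len I)" r] unfolding b[symmetric] by simp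
    ultimately show ?thesis using out
      by (intro exI[of _ "t + sz (f (code I))"] exI[of _ "s(1 := enc (f (code I)))"] exI[of _ out]) auto
  qed
  then show ?thesis unfolding solvable_in_poly_time_def by blast
qed

text \<open>\<open>G\<close>, \<open>R\<close>, \<open>K\<close> and \<open>rays\<close> depend on
  \<open>A\<close> alone and are built into the program as constants, so it is enough that they
  exist; nothing has to compute them.\<close>

theorem solvable_flow_instances:
  fixes A :: "int mat"
  shows "solvable_in_poly_time (flow_instances A) enc_instance
    (\<lambda>I. num_commodities I + num_scenarios I + encoding_length I) enc_answer (correct_answer A)"
proof -
  define m n where "m = dim_col A" and "n = dim_row A"
  define a where a_eq: "a = (\<lambda>r e. A $$ (r, e))"
  obtain G where G: "test_set m n a G" using test_set_exists by blast
  have finG: "finite G" by (rule test_setD(1)[OF G])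
  define R where "R = (\<Sum>v\<in>G. \<Sum>e<m. \<bar>v e\<bar>)"
  have R_ge: "\<bar>v e\<bar> \<le> R" if "v \<in> G" "e < m" for v e
  proof -
    have "\<bar>v e\<bar> \<le> (\<Sum>e<m. \<bar>v e\<bar>)" using that(2) by (intro member_le_sum) auto
    also have "\<dots> \<le> R" unfolding R_def using that(1) finG by (intro member_le_sum[of v]) (auto intro: sum_nonneg)
    finally show ?thesis .
  qed
  have R: "\<forall>v\<in>G. \<forall>e<m. \<bar>v e\<bar> \<le> R" using R_ge by blast
  have R0: "0 \<le> R" unfolding R_def by (intro sum_nonneg) auto
  obtain K where K: "pieces_bound m n a K" using bounded_pieces by blast
  have "finite ((\<lambda>v. map v [0..<m]) ` {v\<in>G. ray m n a v})" using finG by simp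
  from finite_list[OF this] obtain rays where rays: "set rays = (\<lambda>v. map v [0..<m]) ` {v\<in>G. ray m n a v}"
    ..
  obtain q :: "nat poly" where q: "\<And>n. 11 + 4 * n = poly q n"
    by (rule polyf_obtain[of "\<lambda>n. 11 + 4 * n"]) (intro polyf_intros, auto)
  show ?thesis
  proof (rule ptime_solvable[where code = encode_instance and q = q])
    show "ptime (flow_program m n a K R (int (card G)) rays)" by (rule ptime_flow_program)
    show "enc (encode_instance I) = enc_instance I" for I by (rule enc_encode_instance)
    fix I assume "I \<in> flow_instances A"
    then interpret flow_problem A I by unfold_locales
    have aA: "flow_problem.a A = a" by (intro ext) (simp add: a_def a_eq)
    show "\<exists>out. enc (flow_program m n a K R (int (card G)) rays (encode_instance I)) = enc_answer out \<and>
        correct_answer A I out"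
      unfolding enc_data_def flow_program_eq[of K R "int (card G)" rays, unfolded aA, folded m_def n_def]
      by (rule int_answer_correct[of G R K rays, unfolded aA, folded m_def n_def, OF G R R0 K rays])
    show "data_size (enc_instance I) \<le> poly q (num_commodities I + num_scenarios I + encoding_length I)"
      using data_size_enc_instance unfolding q .
  qed
qed

theorem theorem4:
  fixes G :: "('a, 'b) pre_digraph" and vs :: "'a list" and es :: "'b list"
  assumes "fin_digraph G"
    and "distinct vs" and "set vs = verts G"
    and "distinct es" and "set es = arcs G"
  shows "solvable_in_poly_time
    (flow_instances (incidence_mat G vs es))
    enc_instance
    (\<lambda>I. num_commodities I + num_scenarios I + encoding_length I)
    enc_answer
    (correct_answer (incidence_mat G vs es))"
  by (rule solvable_flow_instances)

end
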